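(* Let $n\ge0$, $k\ge0$ be fixed integers and let $f:[0,1]\to[0,1]$ be a continuous map having no cycles of minimal period $2^n(2k+1)$. Then: 1) if $B=B(\mathrm{orb}\,I,f)$ is a basic set and $I$ has period $m$, then $2^n(2k+1)\prec m\prec2^{n-1}$ (for $n=0$ the second relation is omitted); 2) $\Omega(f)=\Omega(f^{2^n})$; 3) if $f$ is of type $2^l$ for some $0\le l\le\infty$, then $\Omega(f)=\Omega(f^r)$ for all $r\ge1$.
   Context: $\prec$ is the Sharkovskii ordering of positive integers, used here in the strict sense: $3\prec5\prec7\prec\cdots\prec2\cdot3\prec2\cdot5\prec2\cdot7\prec\cdots\prec2^2\cdot3\prec2^2\cdot5\prec\cdots\prec2^3\prec2^2\prec2\prec1$. The map $f$ is of type $m$ if $m$ is the first (leftmost) integer in this ordering among the minimal periods of cycles of $f$; $f$ is of type $2^\infty$ if the minimal periods of its cycles are exactly $1,2,2^2,2^3,\dots$. $\Omega(T)$ is the set of non-wandering points of $T$. A closed interval $I$ is periodic of period $m$ if $I,fI,\dots,f^{m-1}I$ are pairwise disjoint and $f^mI=I$; $\mathrm{orb}\,I=\bigcup_{i=0}^{m-1}f^iI$. For a set $U$, $\mathrm{orb}\,U=\bigcup_{i\ge0}f^iU$. With $M=\mathrm{orb}\,I$, the set $\{x\in M:\overline{\mathrm{orb}\,U}=M$ for every relative neighborhood $U$ of $x$ in $M\}$, if infinite, is called a basic set and denoted $B(\mathrm{orb}\,I,f)$. *)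

theory Defs
  imports "HOL-Analysis.Analysis"
begin

text \<open>The strict Sharkovskii ordering of the positive integers; \<open>0\<close> is related to nothing.
  Every positive integer is \<open>2 ^ a * p\<close> for a unique \<open>a\<close> and a unique odd \<open>p\<close>.\<close>

definition sharkovskii_less :: "nat \<Rightarrow> nat \<Rightarrow> bool"  (infix "\<prec>\<^sub>S" 50) where
  "i \<prec>\<^sub>S j \<longleftrightarrow>
     (\<exists>a p b q. i = 2 ^ a * p \<and> odd p \<and> j = 2 ^ b * q \<and> odd q \<and>
        ((p > 1 \<and> q > 1 \<and> (a < b \<or> a = b \<and> p < q)) \<or>
         (p > 1 \<and> q = 1) \<or>
         (p = 1 \<and> q = 1 \<and> b < a)))"

text \<open>A self-map of a subset \<open>X\<close> of a type is given by a function on the whole type;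
  only its values on \<open>X\<close> matter.\<close>

definition cycle_periods :: "'a set \<Rightarrow> ('a \<Rightarrow> 'a) \<Rightarrow> nat set" where
  "cycle_periods X f =
     {p. p \<ge> 1 \<and> (\<exists>x\<in>X. (f ^^ p) x = x \<and> (\<forall>i. 1 \<le> i \<and> i < p \<longrightarrow> (f ^^ i) x \<noteq> x))}"

definition of_type :: "'a set \<Rightarrow> ('a \<Rightarrow> 'a) \<Rightarrow> nat \<Rightarrow> bool" where
  "of_type X f m \<longleftrightarrow>
     m \<in> cycle_periods X f \<and> (\<forall>j\<in>cycle_periods X f. j \<noteq> m \<longrightarrow> m \<prec>\<^sub>S j)"

definition of_type_2_infinity :: "'a set \<Rightarrow> ('a \<Rightarrow> 'a) \<Rightarrow> bool" where
  "of_type_2_infinity X f \<longleftrightarrow> cycle_periods X f = {2 ^ i | i. True}"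

definition nonwandering :: "'a::topological_space set \<Rightarrow> ('a \<Rightarrow> 'a) \<Rightarrow> 'a set" where
  "nonwandering X T =
     {x\<in>X. \<forall>U. openin (top_of_set X) U \<and> x \<in> U \<longrightarrow> (\<exists>i\<ge>1. (T ^^ i) ` U \<inter> U \<noteq> {})}"

definition orb :: "('a \<Rightarrow> 'a) \<Rightarrow> 'a set \<Rightarrow> 'a set" where
  "orb f U = (\<Union>i. (f ^^ i) ` U)"

text \<open>Degenerate intervals are admitted here; their orbits are finite, so they carry no basic set.\<close>

definition periodic_interval :: "real set \<Rightarrow> (real \<Rightarrow> real) \<Rightarrow> nat \<Rightarrow> real set \<Rightarrow> bool" where
  "periodic_interval X f m I \<longleftrightarrow>
     m \<ge> 1 \<and> (\<exists>a b. a \<le> b \<and> I = {a..b}) \<and> I \<subseteq> X \<and>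
     (\<forall>i<m. \<forall>j<m. i \<noteq> j \<longrightarrow> (f ^^ i) ` I \<inter> (f ^^ j) ` I = {}) \<and>
     (f ^^ m) ` I = I"

definition interval_orb :: "(real \<Rightarrow> real) \<Rightarrow> nat \<Rightarrow> real set \<Rightarrow> real set" where
  "interval_orb f m I = (\<Union>i<m. (f ^^ i) ` I)"

definition basic_points :: "(real \<Rightarrow> real) \<Rightarrow> real set \<Rightarrow> real set" where
  "basic_points f M =
     {x\<in>M. \<forall>U. U \<subseteq> M \<and> (\<exists>V. openin (top_of_set M) V \<and> x \<in> V \<and> V \<subseteq> U)
              \<longrightarrow> closure (orb f U) = M}"

text \<open>\<open>B\<close> is a basic set and \<open>B = B(orb I, f)\<close>, where \<open>I\<close> is a periodic interval of period \<open>m\<close>.\<close>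

definition is_basic_set ::
    "real set \<Rightarrow> (real \<Rightarrow> real) \<Rightarrow> nat \<Rightarrow> real set \<Rightarrow> real set \<Rightarrow> bool" where
  "is_basic_set X f m I B \<longleftrightarrow>
     periodic_interval X f m I \<and> B = basic_points f (interval_orb f m I) \<and> infinite B"

end

theory Submission imports Defs begin

text \<open>
  By Sharkovskii's theorem, a map without a cycle of period \<open>2 ^ n * (2 * k + 1)\<close> has no cycle of
  period \<open>2 ^ i * r\<close> with \<open>r \<ge> 3\<close> odd and \<open>i < n\<close>, and none of period \<open>2 ^ n * 3\<close>. So every claim
  reduces to the production of such a cycle, and period 3 of an iterate comes from a horseshoe.

  For \<open>\<Omega>\<close>, let \<open>U\<close> be a neighbourhood of \<open>x \<in> \<Omega>(f)\<close>. The component of \<open>orb U\<close> around \<open>x\<close> first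
  returns to itself at some time \<open>p\<close>, and it contains a point \<open>z\<close> of period \<open>p\<close> that lies in
  \<open>f ^^ (p * i) ` U\<close> for all large \<open>i\<close>. Hence the limit sets of \<open>U\<close> under the powers \<open>f ^^ (p * r)\<close> are
  intervals through \<open>z\<close>, which \<open>f ^^ p\<close> permutes. For odd \<open>r\<close> an interval permutation of this kind is
  trivial, so \<open>\<Omega>(f) = \<Omega>(f ^^ r)\<close>. For \<open>r = 2\<close> and \<open>x \<notin> \<Omega>(f ^^ 2)\<close>, either \<open>p > 1\<close> is odd, or \<open>f\<close>
  swaps two different intervals around a fixed point and \<open>f ^^ 2\<close> has a horseshoe.

  For a basic set on a periodic interval of period \<open>m\<close>, the map \<open>g = f ^^ m\<close> either has a cycle of odd
  period above 1 or swaps two intervals that cover its domain; in the second case density of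
  orbits yields a horseshoe for \<open>g ^^ 2\<close>. So \<open>g\<close> has a cycle of period 6 or of odd period above 1.
\<close>

section \<open>Least periods\<close>

text \<open>Most arguments run for a power \<open>f ^^ (2 ^ j)\<close>, whose cycles do not
  determine periods under \<open>f\<close>: an odd period \<open>q > 1\<close> may come from
  \<open>2 ^ i * q\<close> for any \<open>i \<le> j\<close>. The hypothesis suffices because all
  these values precede \<open>2 ^ n * (2 * k + 1)\<close> when \<open>j < n\<close>; squaring up to
  exponent \<open>n\<close> adds at worst \<open>2 ^ n * 3\<close>, the extreme value that is still
  excluded. For \<Omega> the obstacle is that all returns of a neighbourhood might occur at times
  not divisible by \<open>r\<close>. Orbits of single points give no control over this. Late images
  of a connected neighbourhood that share a point have an interval as limit set, and the order of
  the line restricts how intervals through a common fixed point can be permuted. In claim 3 only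
  powers of 2 are periods, so \<open>2 ^ i * 3\<close> is missing for every \<open>i\<close>; a
  power of 2 times an odd number then covers every \<open>r\<close>. Basic sets enter through their
  infinitude: four fixed spreading points force an odd period above 1, and two spreading points on
  one side give the horseshoe.\<close>

definition min_period :: "('a \<Rightarrow> 'a) \<Rightarrow> 'a \<Rightarrow> nat \<Rightarrow> bool" where
  "min_period f x p \<longleftrightarrow> p \<ge> 1 \<and> (f ^^ p) x = x \<and> (\<forall>i. 1 \<le> i \<and> i < p \<longrightarrow> (f ^^ i) x \<noteq> x)"

lemma cycle_periods_iff: "p \<in> cycle_periods X f \<longleftrightarrow> (\<exists>x\<in>X. min_period f x p)"
  by (auto simp: cycle_periods_def min_period_def)

lemma funpow_fix_mult:
  assumes "(f ^^ p) x = x"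
  shows "(f ^^ (p * k)) x = x"
  by (induction k) (simp_all add: funpow_add assms)

lemma min_period_dvd_iff:
  assumes "min_period f x p"
  shows "(f ^^ n) x = x \<longleftrightarrow> p dvd n"
proof
  assume n: "(f ^^ n) x = x"
  have p: "p \<ge> 1" "(f ^^ p) x = x" using assms by (auto simp: min_period_def)
  have "(f ^^ (n mod p)) x = (f ^^ (n mod p)) ((f ^^ (p * (n div p))) x)"
    using funpow_fix_mult[OF p(2)] by simp
  also have "\<dots> = (f ^^ n) x"
    by (metis comp_apply funpow_add mod_mult_div_eq mult.commute)
  finally have "(f ^^ (n mod p)) x = x" using n by simp
  moreover have "n mod p < p" using p by simp
  ultimately have "n mod p = 0"
    using assms unfolding min_period_def by (metis less_one linorder_not_le)
  then show "p dvd n" by auto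
next
  assume "p dvd n"
  then show "(f ^^ n) x = x"
    using assms by (auto simp: min_period_def funpow_fix_mult)
qed

lemma min_period_exists:
  assumes "(f ^^ n) x = x" "n \<ge> 1"
  obtains d where "min_period f x d" "d dvd n"
proof -
  define d where "d = (LEAST d. d \<ge> 1 \<and> (f ^^ d) x = x)"
  have "d \<ge> 1 \<and> (f ^^ d) x = x" unfolding d_def by (rule LeastI) (use assms in auto)
  moreover have "(f ^^ i) x \<noteq> x" if "1 \<le> i" "i < d" for i
    using not_less_Least[of i "\<lambda>d. d \<ge> 1 \<and> (f ^^ d) x = x"] that unfolding d_def by auto
  ultimately have "min_period f x d" by (auto simp: min_period_def)
  with that assms min_period_dvd_iff show ?thesis by metis
qed

lemma min_periodI:
  assumes "\<And>n. (f ^^ n) x = x \<longleftrightarrow> p dvd n" "p \<ge> 1"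
  shows "min_period f x p"
  using assms by (auto simp: min_period_def dest: dvd_imp_le)

lemma min_period_funpow:
  assumes "min_period f x d" "k \<ge> 1"
  shows "min_period (f ^^ k) x (d div gcd d k)"
proof (rule min_periodI)
  have d: "d \<ge> 1" using assms by (simp add: min_period_def)
  show "d div gcd d k \<ge> 1" using d by (simp add: Suc_leI div_greater_zero_iff gcd_le1_nat)
  fix n
  have "((f ^^ k) ^^ n) x = x \<longleftrightarrow> d dvd k * n"
    by (simp add: funpow_mult min_period_dvd_iff[OF assms(1)] mult.commute)
  also have "\<dots> \<longleftrightarrow> d div gcd d k dvd n"
  proof -
    define g where "g = gcd d k"
    have g: "g > 0" using d by (simp add: g_def)
    obtain d' k' where dk: "d = g * d'" "k = g * k'" unfolding g_def by (meson dvdE gcd_dvd1 gcd_dvd2)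
    have "coprime d' k'" using dk g
      by (metis d div_gcd_coprime g_def less_numeral_extra(3) nonzero_mult_div_cancel_left not_one_le_zero)
    then show ?thesis using dk g
      by (metis coprime_dvd_mult_right_iff g_def mult.assoc nat_mult_dvd_cancel1
          nonzero_mult_div_cancel_left less_numeral_extra(3))
  qed
  finally show "((f ^^ k) ^^ n) x = x \<longleftrightarrow> d div gcd d k dvd n" .
qed

lemma min_period_unique:
  assumes "min_period f x p" "min_period f x q" shows "p = q"
  using assms by (metis dvd_antisym min_period_def min_period_dvd_iff)

lemma cycle_periods_funpow:
  assumes "m \<in> cycle_periods X f" "k \<ge> 1"
  shows "m div gcd m k \<in> cycle_periods X (f ^^ k)"
  using assms min_period_funpow unfolding cycle_periods_iff by metis

text \<open>Under \<open>f\<close> the point has a period \<open>d = 2 ^ i * q\<close>, where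
  \<open>2 ^ i\<close> is the gcd of \<open>d\<close> and \<open>2 ^ j\<close>. If \<open>q\<close>
  were even and \<open>i < j\<close>, then \<open>2 ^ Suc i\<close> would divide both; so an even
  \<open>q\<close> forces the full factor \<open>2 ^ j\<close>.\<close>

lemma cycle_periods_pow2:
  assumes "q \<in> cycle_periods X (f ^^ (2 ^ j))"
  obtains i where "i \<le> j" "2 ^ i * q \<in> cycle_periods X f" "even q \<Longrightarrow> i = j"
proof -
  obtain x where x: "x \<in> X" "min_period (f ^^ (2 ^ j)) x q" using assms by (auto simp: cycle_periods_iff)
  then have "(f ^^ (q * 2 ^ j)) x = x" "q * 2 ^ j \<ge> 1"
    by (auto simp: min_period_def funpow_mult mult.commute)
  then obtain d where d: "min_period f x d" by (rule min_period_exists)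
  have q: "q = d div gcd d (2 ^ j)" using min_period_unique[OF x(2) min_period_funpow[OF d]] by simp
  obtain i where i: "i \<le> j" "gcd d (2 ^ j) = 2 ^ i"
    using divides_primepow_nat[of 2 "gcd d (2^j)" j] by auto
  have dq: "d = 2 ^ i * q" using q i by (metis dvd_mult_div_cancel gcd_dvd1)
  have "i = j" if "even q"
  proof (rule ccontr)
    assume "i \<noteq> j"
    then have "Suc i \<le> j" using i by simp
    then have "2 ^ Suc i dvd (2::nat) ^ j" by (rule le_imp_power_dvd)
    moreover have "2 ^ Suc i dvd d" using that dq by (auto simp: mult.commute)
    ultimately have "2 ^ Suc i dvd (2::nat) ^ i" using i(2) by (metis gcd_greatest)
    then have "(2::nat) ^ Suc i \<le> 2 ^ i" by (rule dvd_imp_le) simp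
    then show False by simp
  qed
  with that i dq d x show ?thesis by (auto simp: cycle_periods_iff)
qed

lemma min_period_orbit:
  assumes "min_period f x m"
  defines "P \<equiv> (\<lambda>i. (f ^^ i) x) ` {..<m}"
  shows "finite P" "card P = m" "x \<in> P" "f ` P = P" "inj_on f P"
    "\<And>s t. s \<in> P \<Longrightarrow> t \<in> P \<Longrightarrow> \<exists>j<m. (f ^^ j) s = t"
    "\<And>s. s \<in> P \<Longrightarrow> min_period f s m"
proof -
  have m: "m \<ge> 1" "(f ^^ m) x = x" using assms by (auto simp: min_period_def)
  have mod: "(f ^^ n) x = (f ^^ (n mod m)) x" for n
    using funpow_mod_eq[OF m(2)] by metis
  have inP: "(f ^^ n) x \<in> P" for n using mod[of n] m by (auto simp: P_def)
  show fin: "finite P" by (simp add: P_def)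
  have inj: "inj_on (\<lambda>i. (f ^^ i) x) {..<m}"
  proof (rule linorder_inj_onI')
    fix i j assume ij: "i \<in> {..<m}" "j \<in> {..<m}" "i < j"
    show "(f ^^ i) x \<noteq> (f ^^ j) x"
    proof
      assume "(f ^^ i) x = (f ^^ j) x"
      then have "(f ^^ (m - j)) ((f ^^ i) x) = (f ^^ (m - j)) ((f ^^ j) x)" by simp
      then have "(f ^^ (m - j + i)) x = (f ^^ m) x"
        using ij by (metis (no_types, lifting) comp_apply funpow_add le_add_diff_inverse2 less_imp_le lessThan_iff)
      then have "m dvd m - j + i" using m min_period_dvd_iff[OF assms(1)] by simp
      then show False using ij by (auto dest!: dvd_imp_le)
    qed
  qed
  show card: "card P = m" using card_image[OF inj] by (simp add: P_def)
  show "x \<in> P" using inP[of 0] by simp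
  have sub: "f ` P \<subseteq> P" using inP by (auto simp: P_def simp flip: funpow.simps(2) comp_apply[of f])
  show reach: "\<exists>j<m. (f ^^ j) s = t" if "s \<in> P" "t \<in> P" for s t
  proof -
    obtain i j where ij: "i < m" "j < m" "s = (f ^^ i) x" "t = (f ^^ j) x" using \<open>s \<in> P\<close> \<open>t \<in> P\<close> by (auto simp: P_def)
    have "(f ^^ ((j + (m - i)) mod m)) s = t"
    proof -
      have "(f ^^ m) s = s" using ij m
        by (metis comp_apply funpow_add add.commute)
      then have "(f ^^ ((j + (m - i)) mod m)) s = (f ^^ (j + (m - i))) s" by (rule funpow_mod_eq)
      also have "\<dots> = (f ^^ (j + m)) x"
        using ij funpow_add[of "j + (m - i)" i f] by simp
      also have "\<dots> = t" using ij m by (simp add: funpow_add)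
      finally show ?thesis .
    qed
    then show ?thesis using m by (metis mod_less_divisor less_eq_Suc_le One_nat_def)
  qed
  show onto: "f ` P = P"
  proof
    show "f ` P \<subseteq> P" by (rule sub)
    show "P \<subseteq> f ` P"
    proof
      fix t assume t: "t \<in> P"
      then have "f t \<in> P" using sub by auto
      from reach[OF this t] obtain j where j: "(f ^^ j) (f t) = t" by auto
      then have "f ((f ^^ j) t) = t" by (metis funpow_swap1)
      moreover have "(f ^^ j) t \<in> P" using t sub by (induction j) auto
      ultimately show "t \<in> f ` P" by (metis imageI)
    qed
  qed
  show "inj_on f P" using fin onto by (simp add: eq_card_imp_inj_on)
  show "min_period f s m" if s: "s \<in> P" for s
  proof (rule min_periodI)
    obtain i where i: "i < m" "s = (f ^^ i) x" using s by (auto simp: P_def)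
    obtain j where j: "(f ^^ j) s = x" using reach[OF s \<open>x \<in> P\<close>] by auto
    fix n
    have "(f ^^ n) s = s \<longleftrightarrow> (f ^^ n) x = x"
      using i j by (metis comp_apply funpow_add add.commute)
    then show "(f ^^ n) s = s \<longleftrightarrow> m dvd n" by (simp add: min_period_dvd_iff[OF assms(1)])
  qed (rule m)
qed

section \<open>Interval maps and coverings\<close>

locale interval_map =
  fixes a b :: real and f :: "real \<Rightarrow> real"
  assumes cont: "continuous_on {a..b} f" and maps: "f ` {a..b} \<subseteq> {a..b}"
begin

lemma in_range: "x \<in> {a..b} \<Longrightarrow> f x \<in> {a..b}"
  using maps by blast

lemma funpow_in: "x \<in> {a..b} \<Longrightarrow> (f ^^ n) x \<in> {a..b}"
  by (induction n) (use in_range in auto)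

lemma cont_funpow: "continuous_on {a..b} (f ^^ n)"
proof (induction n)
  case 0
  then show ?case by (simp add: id_def)
next
  case (Suc n)
  have "continuous_on ((f ^^ n) ` {a..b}) f"
    using cont funpow_in by (rule continuous_on_subset[OF _ image_subsetI])
  with Suc show ?case unfolding funpow.simps by (rule continuous_on_compose)
qed

lemma interval_map_funpow: "interval_map a b (f ^^ n)"
  using cont_funpow funpow_in by unfold_locales auto

end

text \<open>Conjugation by \<open>t \<mapsto> - t\<close>. It exchanges left and right, so that each
  one-sided argument is carried out once.\<close>

definition reflect :: "(real \<Rightarrow> real) \<Rightarrow> real \<Rightarrow> real" where
  "reflect f t = - f (- t)"

lemma reflect_funpow: "reflect f ^^ n = reflect (f ^^ n)"
  by (induction n) (auto simp: reflect_def fun_eq_iff)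

lemma reflect_reflect [simp]: "reflect (reflect f) = f"
  by (simp add: reflect_def fun_eq_iff)

lemma reflect_image: "reflect f ` uminus ` S = uminus ` f ` S"
  by (auto simp: reflect_def image_image)

lemma min_period_reflect: "min_period (reflect f) (- x) p \<longleftrightarrow> min_period f x p"
  by (simp add: min_period_def reflect_funpow) (simp add: reflect_def)

lemma cycle_periods_reflect: "cycle_periods {-b..-a} (reflect f) = cycle_periods {a..b} f"
proof -
  have "(\<exists>x\<in>uminus ` {a..b}. min_period (reflect f) x p) \<longleftrightarrow> (\<exists>x\<in>{a..b}. min_period f x p)" for p
    unfolding bex_simps min_period_reflect ..
  then have "p \<in> cycle_periods {-b..-a} (reflect f) \<longleftrightarrow> p \<in> cycle_periods {a..b} f" for p
    unfolding cycle_periods_iff by simp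
  then show ?thesis by blast
qed

lemma interval_map_reflect:
  assumes "interval_map a b f" shows "interval_map (- b) (- a) (reflect f)"
proof -
  interpret interval_map a b f by fact
  show ?thesis
  proof
    have "continuous_on {-b..-a} (\<lambda>t. f (- t))"
      by (rule continuous_on_compose2[OF cont]) (auto intro!: continuous_intros)
    then show "continuous_on {-b..-a} (reflect f)"
      unfolding reflect_def by (rule continuous_on_minus)
    show "reflect f ` {-b..-a} \<subseteq> {-b..-a}"
    proof (rule image_subsetI)
      fix x assume "x \<in> {-b..-a}"
      then have "f (- x) \<in> {a..b}" by (intro in_range) auto
      then show "reflect f x \<in> {-b..-a}" by (simp add: reflect_def)
    qed
  qed
qed

text \<open>\<open>s'\<close> is the last point with value \<open>c\<close>, and \<open>t'\<close>
  the first point after it with value \<open>d\<close>. If \<open>f\<close> left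
  \<open>[c, d]\<close> in between, the intermediate value theorem would give a later point with
  value \<open>c\<close> or an earlier one with value \<open>d\<close>.\<close>

lemma covering_subinterval_mono:
  fixes f :: "real \<Rightarrow> real"
  assumes "continuous_on {s..t} f" "s \<le> t" "f s = c" "f t = d" "c \<le> d"
  shows "\<exists>a b. a \<le> b \<and> {a..b} \<subseteq> {s..t} \<and> f ` {a..b} = {c..d}"
proof -
  define s' where "s' = Sup {x \<in> {s..t}. f x = c}"
  have cl: "closed {x \<in> {u..v}. f x = k}" if "{u..v} \<subseteq> {s..t}" for u v k
    using continuous_closed_preimage_constant[of "{u..v}" f k] continuous_on_subset[OF assms(1) that]
    by auto
  have "s' \<in> {x \<in> {s..t}. f x = c}" unfolding s'_def
    by (rule closed_contains_Sup) (use assms cl in auto)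
  then have s': "s \<le> s'" "s' \<le> t" "f s' = c" by auto
  have s'_max: "x \<le> s'" if "x \<in> {s..t}" "f x = c" for x
    unfolding s'_def by (rule cSup_upper) (use that in auto)
  define t' where "t' = Inf {x \<in> {s'..t}. f x = d}"
  have "t' \<in> {x \<in> {s'..t}. f x = d}" unfolding t'_def
    by (rule closed_contains_Inf) (use assms s' cl in auto)
  then have t': "s' \<le> t'" "t' \<le> t" "f t' = d" by auto
  have t'_min: "t' \<le> x" if "x \<in> {s'..t}" "f x = d" for x
    unfolding t'_def by (rule cInf_lower) (use that in auto)
  have cont': "continuous_on {u..v} f" if "s' \<le> u" "v \<le> t'" for u v
    by (rule continuous_on_subset[OF assms(1)]) (use that s' t' in auto)
  have "c \<le> f x \<and> f x \<le> d" if x: "x \<in> {s'..t'}" for x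
  proof (rule ccontr)
    assume "\<not> (c \<le> f x \<and> f x \<le> d)"
    then consider "f x < c" | "f x > d" by linarith
    then show False
    proof cases
      case 1
      then obtain y where y: "x \<le> y" "y \<le> t'" "f y = c"
        using IVT'[of f x c t'] cont'[of x t'] x t' assms by force
      then have "y = s'" using s'_max[of y] x s' t' by force
      then show False using y x 1 s' by auto
    next
      case 2
      then obtain y where y: "s' \<le> y" "y \<le> x" "f y = d"
        using IVT'[of f s' d x] cont'[of s' x] x s' assms by force
      then have "y = t'" using t'_min[of y] x s' t' by force
      then show False using y x 2 t' by auto
    qed
  qed
  moreover have "\<exists>x\<in>{s'..t'}. f x = y" if "c \<le> y" "y \<le> d" for y
    using IVT'[of f s' y t'] cont'[of s' t'] that s' t' by force
  ultimately have "f ` {s'..t'} = {c..d}" by (auto simp: image_iff) (metis atLeastAtMost_iff)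
  then show ?thesis using s' t' by (intro exI[of _ s'] exI[of _ t']) auto
qed

lemma covering_subinterval:
  fixes f :: "real \<Rightarrow> real"
  assumes "continuous_on {s..t} f" "{c..d} \<subseteq> f ` {s..t}" "c \<le> d"
  shows "\<exists>a b. a \<le> b \<and> {a..b} \<subseteq> {s..t} \<and> f ` {a..b} = {c..d}"
proof -
  obtain u v where uv: "u \<in> {s..t}" "v \<in> {s..t}" "f u = c" "f v = d"
  proof -
    have "c \<in> f ` {s..t}" "d \<in> f ` {s..t}" using assms(2,3) by auto
    then show thesis using that by blast
  qed
  show ?thesis
  proof (cases "u \<le> v")
    case True
    have sub: "{u..v} \<subseteq> {s..t}" using uv by auto
    obtain p q where "p \<le> q" "{p..q} \<subseteq> {u..v}" "f ` {p..q} = {c..d}"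
      using covering_subinterval_mono[OF continuous_on_subset[OF assms(1) sub] True uv(3,4) assms(3)] by blast
    then show ?thesis using sub by blast
  next
    case False
    \<comment> \<open>Here the value \<open>d\<close> is taken left of the value \<open>c\<close>;
      the increasing case applies to \<open>x \<mapsto> f (- x)\<close>.\<close>
    have "continuous_on {-u..-v} (\<lambda>x. f (- x))"
      by (rule continuous_on_compose2[OF assms(1)]) (use uv(1,2) in \<open>auto intro!: continuous_intros\<close>)
    then obtain p q where pq: "p \<le> q" "{p..q} \<subseteq> {-u..-v}" "(\<lambda>x. f (- x)) ` {p..q} = {c..d}"
      using covering_subinterval_mono[of "-u" "-v" "\<lambda>x. f (- x)" c d] uv(3,4) assms(3) False
      by (auto simp del: image_subset_iff)
    have "f ` {-q..-p} = (\<lambda>x. f (- x)) ` {p..q}"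
      by (simp only: image_uminus_atLeastAtMost[symmetric] image_image)
    moreover have "{-q..-p} \<subseteq> {s..t}" using pq(1,2) uv(1,2) by auto
    moreover have "-q \<le> -p" using pq(1) by simp
    ultimately show ?thesis using pq(3) by metis
  qed
qed

definition covers :: "(real \<Rightarrow> real) \<Rightarrow> nat \<Rightarrow> real set \<Rightarrow> real set \<Rightarrow> bool" where
  "covers f k A B \<longleftrightarrow> B \<subseteq> (f ^^ k) ` A"

section \<open>Orbits with a prescribed itinerary\<close>

context interval_map
begin

text \<open>A chain of coverings is realised by a single orbit: pull the covered intervals back one by one.\<close>

lemma chain_itinerary:
  assumes A: "\<And>l. l \<le> N \<Longrightarrow> \<exists>c d. c \<le> d \<and> A l = {c..d} \<and> {c..d} \<subseteq> {a..b}"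
    and cov: "\<And>l. l < N \<Longrightarrow> covers f (k l) (A l) (A (Suc l))"
  shows "\<exists>c d. c \<le> d \<and> {c..d} \<subseteq> A 0 \<and> (f ^^ (\<Sum>l<N. k l)) ` {c..d} = A N \<and>
    (\<forall>l\<le>N. (f ^^ (\<Sum>i<l. k i)) ` {c..d} \<subseteq> A l)"
  using assms
proof (induction N)
  case 0
  from 0(1)[of 0] obtain c d where "c \<le> d" "A 0 = {c..d}" by blast
  then show ?case by (intro exI[of _ c] exI[of _ d]) simp
next
  case (Suc N)
  have "\<exists>c d. c \<le> d \<and> {c..d} \<subseteq> A 0 \<and> (f ^^ (\<Sum>l<N. k l)) ` {c..d} = A N \<and>
    (\<forall>l\<le>N. (f ^^ (\<Sum>i<l. k i)) ` {c..d} \<subseteq> A l)"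
  proof (rule Suc.IH)
    show "\<exists>c d. c \<le> d \<and> A l = {c..d} \<and> {c..d} \<subseteq> {a..b}" if "l \<le> N" for l
      by (rule Suc.prems(1)) (use that in simp)
    show "covers f (k l) (A l) (A (Suc l))" if "l < N" for l
      by (rule Suc.prems(2)) (use that in simp)
  qed
  then obtain c d where cd: "c \<le> d" "{c..d} \<subseteq> A 0" "(f ^^ (\<Sum>l<N. k l)) ` {c..d} = A N"
    "\<And>l. l \<le> N \<Longrightarrow> (f ^^ (\<Sum>i<l. k i)) ` {c..d} \<subseteq> A l"
    by blast
  obtain c0 d0 where "A 0 = {c0..d0}" "{c0..d0} \<subseteq> {a..b}" using Suc.prems(1)[of 0] by blast
  then have sub: "{c..d} \<subseteq> {a..b}" using cd(2) by blast
  obtain c1 d1 where cd1: "c1 \<le> d1" "A (Suc N) = {c1..d1}" using Suc.prems(1)[of "Suc N"] by blast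
  have img: "(f ^^ (\<Sum>l<Suc N. k l)) ` {c..d} = (f ^^ k N) ` A N"
  proof -
    have "(\<Sum>l<Suc N. k l) = k N + (\<Sum>l<N. k l)" by simp
    then show ?thesis unfolding cd(3)[symmetric] by (simp only: funpow_add image_comp)
  qed
  have "{c1..d1} \<subseteq> (f ^^ (\<Sum>l<Suc N. k l)) ` {c..d}"
    using Suc.prems(2)[of N] unfolding img cd1(2) covers_def by simp
  from covering_subinterval[OF _ this cd1(1)] continuous_on_subset[OF cont_funpow sub]
  obtain c' d' where cd': "c' \<le> d'" "{c'..d'} \<subseteq> {c..d}"
    "(f ^^ (\<Sum>l<Suc N. k l)) ` {c'..d'} = {c1..d1}"
    by blast
  have "(f ^^ (\<Sum>i<l. k i)) ` {c'..d'} \<subseteq> A l" if "l \<le> Suc N" for l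
  proof (cases "l = Suc N")
    case True
    then show ?thesis using cd' cd1 by simp
  next
    case False
    then have "l \<le> N" using that by simp
    from cd(4)[OF this] image_mono[OF cd'(2)] show ?thesis by (rule order_trans[rotated])
  qed
  moreover have "{c'..d'} \<subseteq> A 0" using cd(2) cd'(2) by blast
  ultimately show ?case using cd' cd1(2) by metis
qed

text \<open>At preimages \<open>u\<close> of \<open>c\<close> and \<open>v\<close> of
  \<open>d\<close> the difference \<open>(f ^^ n) t - t\<close> is \<le> 0 and \<ge> 0 respectively,
  because both preimages lie in \<open>[c, d]\<close>.\<close>

lemma fixed_point_covering:
  assumes "c \<le> d" "{c..d} \<subseteq> {a..b}" "{c..d} \<subseteq> (f ^^ n) ` {c..d}"
  shows "\<exists>x\<in>{c..d}. (f ^^ n) x = x"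
proof -
  obtain u v where uv: "u \<in> {c..d}" "v \<in> {c..d}" "(f ^^ n) u = c" "(f ^^ n) v = d"
  proof -
    have "c \<in> (f ^^ n) ` {c..d}" "d \<in> (f ^^ n) ` {c..d}"
      using assms(1) by (auto intro: subsetD[OF assms(3)])
    then show thesis using that by (metis imageE)
  qed
  define g where "g x = (f ^^ n) x - x" for x
  have "continuous_on {c..d} g" unfolding g_def
    by (intro continuous_on_diff continuous_on_id continuous_on_subset[OF cont_funpow assms(2)])
  then have "connected (g ` {c..d})" by (rule connected_continuous_image) (rule connected_Icc)
  moreover have "g u \<in> g ` {c..d}" "g v \<in> g ` {c..d}" using uv(1,2) by simp_all
  ultimately have "{g u..g v} \<subseteq> g ` {c..d}" by (rule connected_contains_Icc)
  moreover have "0 \<in> {g u..g v}" using uv unfolding g_def by simp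
  ultimately have "0 \<in> g ` {c..d}" by (rule subsetD)
  then obtain x where "x \<in> {c..d}" "0 = g x" by (metis imageE)
  then show ?thesis unfolding g_def by (metis eq_iff_diff_eq_0)
qed

text \<open>The subinterval that follows the chain has the first interval as its final image, hence
  covers itself and contains a fixed point of the total iterate.\<close>

lemma loop_itinerary:
  assumes "\<And>l. l \<le> N \<Longrightarrow> \<exists>c d. c \<le> d \<and> A l = {c..d} \<and> {c..d} \<subseteq> {a..b}"
    and "\<And>l. l < N \<Longrightarrow> covers f (k l) (A l) (A (Suc l))" and "A N = A 0"
  obtains x where "x \<in> {a..b}" "(f ^^ (\<Sum>l<N. k l)) x = x" "\<And>l. l \<le> N \<Longrightarrow> (f ^^ (\<Sum>i<l. k i)) x \<in> A l"
proof -
  have "\<exists>c d. c \<le> d \<and> {c..d} \<subseteq> A 0 \<and> (f ^^ (\<Sum>l<N. k l)) ` {c..d} = A N \<and>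
    (\<forall>l\<le>N. (f ^^ (\<Sum>i<l. k i)) ` {c..d} \<subseteq> A l)"
    by (rule chain_itinerary) (fact assms)+
  then obtain c d where cd: "c \<le> d" "{c..d} \<subseteq> A 0" "(f ^^ (\<Sum>l<N. k l)) ` {c..d} = A N"
    "\<And>l. l \<le> N \<Longrightarrow> (f ^^ (\<Sum>i<l. k i)) ` {c..d} \<subseteq> A l"
    by blast
  have sub: "{c..d} \<subseteq> {a..b}" using cd(2) assms(1)[of 0] by blast
  obtain x where x: "x \<in> {c..d}" "(f ^^ (\<Sum>l<N. k l)) x = x"
    using fixed_point_covering[OF cd(1) sub, of "\<Sum>l<N. k l"] cd(2,3) assms(3) by auto
  show thesis
  proof (rule that)
    show "x \<in> {a..b}" using x sub by blast
    show "(f ^^ (\<Sum>l<N. k l)) x = x" by (rule x)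
    show "(f ^^ (\<Sum>i<l. k i)) x \<in> A l" if "l \<le> N" for l
      using cd(4)[OF that] x(1) by blast
  qed
qed

lemma image_interval_covers:
  assumes "{s..t} \<subseteq> {a..b}" "u \<in> {s..t}" "v \<in> {s..t}" "(f ^^ n) u \<le> c" "d \<le> (f ^^ n) v"
  shows "{c..d} \<subseteq> (f ^^ n) ` {s..t}"
proof -
  have "connected ((f ^^ n) ` {s..t})"
    by (rule connected_continuous_image[OF continuous_on_subset[OF cont_funpow assms(1)]]) simp
  moreover have "(f ^^ n) u \<in> (f ^^ n) ` {s..t}" "(f ^^ n) v \<in> (f ^^ n) ` {s..t}"
    using assms by auto
  ultimately have "{(f ^^ n) u..(f ^^ n) v} \<subseteq> (f ^^ n) ` {s..t}" by (rule connected_contains_Icc)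
  then show ?thesis using assms(4,5) by (auto simp del: image_subset_iff)
qed

end

text \<open>The intervals between \<open>p\<close> and \<open>m\<close> and between \<open>m\<close>
  and \<open>q\<close> share only \<open>m\<close>, and each has an image that contains the whole
  interval between \<open>p\<close> and \<open>q\<close>. The second disjunct is the mirror image.
  The weak inequalities allow \<open>p\<close> to be a fixed point.\<close>

definition horseshoe :: "real \<Rightarrow> real \<Rightarrow> (real \<Rightarrow> real) \<Rightarrow> bool" where
  "horseshoe a b f \<longleftrightarrow> (\<exists>p\<in>{a..b}. \<exists>m\<in>{a..b}. \<exists>q\<in>{a..b}.
     (p < m \<and> m < q \<and> f p \<le> p \<and> f q \<le> p \<and> q \<le> f m) \<or>
     (q < m \<and> m < p \<and> p \<le> f p \<and> p \<le> f q \<and> f m \<le> q))"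

lemma (in interval_map) horseshoe_period_3:
  assumes "horseshoe a b f"
  shows "3 \<in> cycle_periods {a..b} f"
proof -
  have *: "3 \<in> cycle_periods {a..b} f"
    if h: "{r..s} \<subseteq> {a..b}" "{s..t} \<subseteq> {a..b}" "r < s" "s < t" "f s \<noteq> s"
      "{r..t} \<subseteq> f ` {r..s}" "{r..t} \<subseteq> f ` {s..t}" for r s t
  proof -
    \<comment> \<open>The loop passes left, right, right, left. A fixed point on it would lie in
      both halves, hence be the middle point \<open>s\<close>, which is moved.\<close>
    define A :: "nat \<Rightarrow> real set" where "A l = (if l = 1 \<or> l = 2 then {s..t} else {r..s})" for l :: nat
    have cov: "covers f 1 (A l) (A (Suc l))" for l
    proof -
      have "{r..s} \<subseteq> {r..t}" "{s..t} \<subseteq> {r..t}" using h(3,4) by auto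
      then have "A (Suc l) \<subseteq> {r..t}" unfolding A_def by simp
      moreover have "{r..t} \<subseteq> f ` A l" using h(6,7) unfolding A_def by presburger
      ultimately show ?thesis unfolding covers_def by (simp add: order_trans)
    qed
    have int: "\<exists>c d. c \<le> d \<and> A l = {c..d} \<and> {c..d} \<subseteq> {a..b}" for l
    proof (cases "l = 1 \<or> l = 2")
      case True
      then show ?thesis using h by (intro exI[of _ s] exI[of _ t]) (auto simp: A_def)
    next
      case False
      then show ?thesis using h by (intro exI[of _ r] exI[of _ s]) (auto simp: A_def)
    qed
    have "A 3 = A 0" by (simp add: A_def)
    with int cov obtain x where x: "x \<in> {a..b}" "(f ^^ (\<Sum>l<3::nat. 1)) x = x"
        "\<And>l::nat. l \<le> 3 \<Longrightarrow> (f ^^ (\<Sum>i<l. 1)) x \<in> A l"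
      by (rule loop_itinerary[of 3 A "\<lambda>_. 1"]) (rule that)
    have x3: "(f ^^ 3) x = x" using x(2) by simp
    then obtain d where d: "min_period f x d" "d dvd 3" using min_period_exists[of 3 f x] by auto
    have "d \<noteq> 1"
    proof
      assume "d = 1"
      then have "f x = x" using d by (simp add: min_period_def)
      moreover have "x \<in> A 0" "f x \<in> A 1" using x(3)[of 0] x(3)[of 1] by simp_all
      ultimately have "x = s" by (auto simp: A_def)
      then show False using h \<open>f x = x\<close> by simp
    qed
    moreover have "d = 1 \<or> d = 3" using d(2) prime_nat_iff[of 3] by simp
    ultimately show ?thesis using d x by (auto simp: cycle_periods_iff)
  qed
  have seg: "{min u v..max u v} \<subseteq> f ` {s..t}"
    if "{s..t} \<subseteq> {a..b}" "y \<in> {s..t}" "y' \<in> {s..t}" "f y \<le> min u v" "max u v \<le> f y'" for s t y y' u v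
    using image_interval_covers[of s t y y' 1 "min u v" "max u v"] that by simp
  obtain p m q where pmq: "p \<in> {a..b}" "m \<in> {a..b}" "q \<in> {a..b}"
    "(p < m \<and> m < q \<and> f p \<le> p \<and> f q \<le> p \<and> q \<le> f m) \<or>
     (q < m \<and> m < p \<and> p \<le> f p \<and> p \<le> f q \<and> f m \<le> q)"
    using assms unfolding horseshoe_def by blast
  from pmq(4) show ?thesis
  proof
    assume "p < m \<and> m < q \<and> f p \<le> p \<and> f q \<le> p \<and> q \<le> f m"
    then show ?thesis
      using pmq(1-3) seg[of p m p m p q] seg[of m q q m p q] by (intro *[of p m q]) (auto simp del: image_subset_iff)
  next
    assume "q < m \<and> m < p \<and> p \<le> f p \<and> p \<le> f q \<and> f m \<le> q"
    then show ?thesis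
      using pmq(1-3) seg[of q m m q q p] seg[of m p m p q p] by (intro *[of q m p]) (auto simp del: image_subset_iff)
  qed
qed

section \<open>Sharkovskii's theorem\<close>

lemma finite_adjacent:
  fixes P :: "real set"
  assumes "finite P" "x \<in> P" "y \<in> P" "x < y"
  obtains x' where "x' \<in> P" "x < x'" "x' \<le> y" "\<And>t. t \<in> P \<Longrightarrow> x < t \<Longrightarrow> x' \<le> t"
proof -
  have "finite {t \<in> P. x < t}" "{t \<in> P. x < t} \<noteq> {}" using assms by auto
  then have "Min {t \<in> P. x < t} \<in> {t \<in> P. x < t}" "\<And>t. t \<in> {t \<in> P. x < t} \<Longrightarrow> Min {t \<in> P. x < t} \<le> t"
    by (rule Min_in, simp)
  with that assms show thesis by (metis (no_types, lifting) mem_Collect_eq)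
qed

lemma horseshoe_reflect: "horseshoe (- b) (- a) (reflect f) = horseshoe a b f"
proof -
  have *: "horseshoe a b f" if hs: "horseshoe (- b) (- a) (reflect f)" for a b f
  proof -
    obtain p m q where h: "p \<in> {-b..-a}" "m \<in> {-b..-a}" "q \<in> {-b..-a}"
      "(p < m \<and> m < q \<and> reflect f p \<le> p \<and> reflect f q \<le> p \<and> q \<le> reflect f m) \<or>
       (q < m \<and> m < p \<and> p \<le> reflect f p \<and> p \<le> reflect f q \<and> reflect f m \<le> q)"
      using hs unfolding horseshoe_def by blast
    then show ?thesis unfolding horseshoe_def reflect_def
      by (intro bexI[of _ "-p"] bexI[of _ "-m"] bexI[of _ "-q"]) auto
  qed
  show ?thesis using *[of b a f] *[of "-a" "-b" "reflect f"] by auto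
qed

text \<open>\<open>P\<close> is the orbit of a point of least period \<open>m\<close>, and \<open>e < e'\<close> are neighbours in \<open>P\<close> that move
  towards each other.\<close>

locale periodic_cut = interval_map +
  fixes P :: "real set" and m :: nat and e e' :: real
  assumes P_sub: "P \<subseteq> {a..b}" and P_fin: "finite P" and P_card: "card P = m" and m2: "m \<ge> 2"
    and P_img: "f ` P = P"
    and P_trans: "\<And>s t. s \<in> P \<Longrightarrow> t \<in> P \<Longrightarrow> \<exists>j<m. (f ^^ j) s = t"
    and P_per: "\<And>s. s \<in> P \<Longrightarrow> min_period f s m"
    and eP: "e \<in> P" "e' \<in> P" "e < e'" and adj: "\<And>t. t \<in> P \<Longrightarrow> t \<le> e \<or> e' \<le> t"
    and fe: "e' \<le> f e" "f e' \<le> e"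

text \<open>\<open>e\<close> is the largest orbit point moved to the right and \<open>e'\<close> its
  right neighbour in the orbit. So \<open>e'\<close> is moved to the left, as no point of the orbit
  is fixed when \<open>m \<ge> 2\<close>.\<close>

lemma (in interval_map) periodic_cut_exists:
  assumes "x \<in> {a..b}" "min_period f x m" "m \<ge> 2"
  shows "\<exists>P e e'. periodic_cut a b f P m e e'"
proof -
  define P where "P = (\<lambda>i. (f ^^ i) x) ` {..<m}"
  note P = min_period_orbit[OF assms(2), folded P_def]
  have sub: "P \<subseteq> {a..b}" using funpow_in[OF assms(1)] unfolding P_def by auto
  have nofix: "f t \<noteq> t" if "t \<in> P" for t
    using P(7)[OF that] assms(3) unfolding min_period_def by (auto dest!: spec[of _ 1])
  have fP: "f t \<in> P" if "t \<in> P" for t using that P(4) by blast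
  have ne: "P \<noteq> {}" using P(3) by auto
  define Q where "Q = {t \<in> P. t < f t}"
  have "Min P \<in> Q"
    using P(1) ne nofix[of "Min P"] fP[of "Min P"] unfolding Q_def
    by (metis (mono_tags, lifting) Min_in Min_le mem_Collect_eq order_le_imp_less_or_eq)
  then have Q: "finite Q" "Q \<noteq> {}" using P(1) by (auto simp: Q_def)
  define e where "e = Max Q"
  have e: "e \<in> P" "e < f e" using Max_in[OF Q] by (auto simp: e_def Q_def)
  obtain e' where e': "e' \<in> P" "e < e'" "e' \<le> f e" "\<And>t. t \<in> P \<Longrightarrow> e < t \<Longrightarrow> e' \<le> t"
    using finite_adjacent[OF P(1) e(1) fP[OF e(1)] e(2)] by blast
  have "\<not> e' < f e'"
  proof
    assume "e' < f e'"
    then have "e' \<le> e" using Q e'(1) unfolding e_def by (intro Max_ge) (auto simp: Q_def)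
    then show False using e' by simp
  qed
  then have "f e' < e'" using nofix[OF e'(1)] by simp
  then have "f e' \<le> e" using e'(4)[OF fP[OF e'(1)]] by linarith
  moreover have "t \<le> e \<or> e' \<le> t" if "t \<in> P" for t
    using e'(4)[OF that] by linarith
  ultimately have "periodic_cut a b f P m e e'"
    by (intro periodic_cut.intro interval_map_axioms periodic_cut_axioms.intro sub P assms(3) e(1) e'(1-3))
  then show ?thesis by blast
qed

section \<open>Orbits that stay on one side of the cut, and orbits that alternate\<close>

context periodic_cut
begin

lemma fP: "t \<in> P \<Longrightarrow> f t \<in> P"
  using P_img by blast

lemma reflect_cut: "periodic_cut (- b) (- a) (reflect f) (uminus ` P) m (- e') (- e)"
proof (intro periodic_cut.intro periodic_cut_axioms.intro)
  show "interval_map (- b) (- a) (reflect f)" by (rule interval_map_reflect) unfold_locales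
  show "uminus ` P \<subseteq> {- b..- a}" using P_sub by auto
  show "card (uminus ` P) = m" using P_card by (simp add: card_image)
  show "reflect f ` uminus ` P = uminus ` P" by (simp add: reflect_image P_img)
  show "\<exists>j<m. (reflect f ^^ j) s = t" if "s \<in> uminus ` P" "t \<in> uminus ` P" for s t
    using that P_trans[of "-s" "-t"] by (auto simp: reflect_funpow reflect_def)
  show "min_period (reflect f) s m" if "s \<in> uminus ` P" for s
    using that P_per min_period_reflect by auto
  show "t \<le> - e' \<or> - e \<le> t" if "t \<in> uminus ` P" for t
    using that adj[of "-t"] by auto
qed (use P_fin m2 eP fe in \<open>auto simp: reflect_def\<close>)

lemma fixed_between:
  obtains z where "z \<in> {a..b}" "e < z" "z < e'" "f z = z"
proof -
  have ab: "e \<in> {a..b}" "e' \<in> {a..b}" using eP P_sub by auto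
  then have sub: "{e..e'} \<subseteq> {a..b}" by auto
  have "{e..e'} \<subseteq> (f ^^ 1) ` {e..e'}"
    by (rule image_interval_covers[OF sub, of e' e]) (use fe eP in auto)
  then obtain z where z: "z \<in> {e..e'}" "f z = z"
    using fixed_point_covering[of e e' 1] sub eP by auto
  then have "z \<noteq> e" "z \<noteq> e'" using fe eP by auto
  then show thesis using that[of z] z sub by auto
qed

text \<open>Some \<open>u\<close> in \<open>[t, z]\<close> maps to \<open>q\<close>, so
  \<open>f ^^ 2\<close> sends it to \<open>f q \<le> y\<close>; some \<open>w\<close> in
  \<open>[y, u]\<close> maps to the fixed point \<open>z\<close>. So \<open>w < u < z\<close> carry
  a horseshoe with \<open>p = z\<close>. The last such \<open>w\<close> is taken: then
  \<open>f > z\<close> on the rest up to \<open>u\<close>, and the fixed point of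
  \<open>f ^^ 2\<close> found there is not fixed by \<open>f\<close>.\<close>

lemma horseshoe_left:
  assumes y: "y \<in> P" "f y \<le> e" and t: "t \<in> P" "y < t" "t \<le> e"
    and q: "q \<in> P" "e' \<le> q" "q \<le> f t" "f q \<le> y"
  shows "horseshoe a b (f ^^ 2) \<and> 2 \<in> cycle_periods {a..b} f"
proof -
  obtain z where z: "z \<in> {a..b}" "e < z" "z < e'" "f z = z"
    using fixed_between by blast
  have ab: "y \<in> {a..b}" "t \<in> {a..b}" using y t P_sub by auto
  have cont': "continuous_on {u..v} f" if "a \<le> u" "v \<le> b" for u v
    by (rule continuous_on_subset[OF cont]) (use that in auto)
  obtain u where u: "t \<le> u" "u \<le> z" "f u = q"
    using IVT2'[of f z q t] cont'[of t z] z q t ab by auto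
  have uz: "u < z" using u z q by (cases "u = z") auto
  define W where "W = {x \<in> {y..u}. f x = z}"
  have c: "continuous_on {y..u} f" using cont' ab u z by simp
  have "\<exists>x\<ge>y. x \<le> u \<and> f x = z" by (rule IVT') (use y z u t q c in auto)
  then have ne: "W \<noteq> {}" by (auto simp: W_def)
  have cl: "closed W" unfolding W_def by (rule continuous_closed_preimage_constant[OF c]) simp
  have bd: "bdd_above W" by (auto simp: W_def)
  define w where "w = Sup W"
  have wW: "w \<in> W" unfolding w_def by (rule closed_contains_Sup[OF ne bd cl])
  then have w: "f w = z" "y \<le> w" "w \<le> u" by (auto simp: W_def)
  have wu: "w < u" using w u q z by (cases "w = u") auto
  have wab: "w \<in> {a..b}" "u \<in> {a..b}" using w ab u z by auto
  have above: "z < f x" if x: "w < x" "x \<le> u" for x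
  proof (rule ccontr)
    assume n: "\<not> z < f x"
    obtain s where s: "x \<le> s" "s \<le> u" "f s = z"
    proof -
      have "\<exists>s\<ge>x. s \<le> u \<and> f s = z"
        by (rule IVT') (use n x u z q cont'[of x u] w wab in auto)
      then show thesis using that by blast
    qed
    then have "s \<in> W" using that w by (auto simp: W_def)
    then have "s \<le> w" unfolding w_def using bd by (rule cSup_upper)
    then show False using s that by simp
  qed
  have F: "(f ^^ 2) w = z" "(f ^^ 2) z = z" "(f ^^ 2) u \<le> w"
    using w z u q by (auto simp: numeral_2_eq_2)
  have "horseshoe a b (f ^^ 2)"
    unfolding horseshoe_def using wab z wu uz F
    by (intro bexI[of _ z] bexI[of _ u] bexI[of _ w]) auto
  moreover have "2 \<in> cycle_periods {a..b} f"
  proof -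
    have sub: "{w..u} \<subseteq> {a..b}" using wab by auto
    have "{w..u} \<subseteq> (f ^^ 2) ` {w..u}"
      by (rule image_interval_covers[OF sub, of u w]) (use F wu uz in auto)
    then obtain x where x: "x \<in> {w..u}" "(f ^^ 2) x = x"
      using fixed_point_covering[of w u 2] sub wu by auto
    have "x \<noteq> w" using x F wu uz by auto
    then have "x < f x" using above[of x] x uz by auto
    then have "min_period f x 2" using x by (auto simp: min_period_def less_2_cases_iff)
    then show ?thesis using x sub by (auto simp: cycle_periods_iff)
  qed
  ultimately show ?thesis ..
qed

lemma horseshoe_right:
  assumes y: "y \<in> P" "e' \<le> f y" and t: "t \<in> P" "t < y" "e' \<le> t"
    and q: "q \<in> P" "q \<le> e" "f t \<le> q" "y \<le> f q"
  shows "horseshoe a b (f ^^ 2) \<and> 2 \<in> cycle_periods {a..b} f"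
proof -
  interpret r: periodic_cut "- b" "- a" "reflect f" "uminus ` P" m "- e'" "- e" by (rule reflect_cut)
  have "horseshoe (- b) (- a) (reflect f ^^ 2) \<and> 2 \<in> cycle_periods {- b..- a} (reflect f)"
    by (rule r.horseshoe_left[of "-y" "-t" "-q"]) (use assms in \<open>auto simp: reflect_def\<close>)
  then show ?thesis by (simp add: cycle_periods_reflect reflect_funpow horseshoe_reflect)
qed

lemma invariant_part:
  assumes "Q \<subseteq> P" "f ` Q \<subseteq> Q" "Q \<noteq> {}"
  shows "Q = P"
proof -
  obtain s where s: "s \<in> Q" using assms by auto
  have "(f ^^ n) s \<in> Q" for n using s assms(2) by (induction n) auto
  then show ?thesis using P_trans[of s] s assms(1) by blast
qed

text \<open>\<open>yL\<close> is the largest left point that stays left, and \<open>t0\<close> the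
  point of \<open>(yL, e]\<close> with the highest image. Without a \<open>q\<close> for
  \<open>horseshoe_left\<close>, no point of \<open>P\<close> in \<open>(yL, f t0]\<close> falls
  back to \<open>yL\<close> or below. Some point there stays right, as otherwise this part of
  \<open>P\<close> is invariant. The same argument from the right, with \<open>yR\<close> and
  \<open>s0\<close>, ends in \<open>horseshoe_right\<close> or in the invariant part
  \<open>[f s0, yR)\<close>. Neither part contains \<open>yL\<close>, against transitivity of the
  orbit.\<close>

lemma left_stays_horseshoe:
  assumes y: "y \<in> P" "y \<le> e" "f y \<le> e"
  shows "horseshoe a b (f ^^ 2) \<and> 2 \<in> cycle_periods {a..b} f"
proof -
  define Y where "Y = {t \<in> P. t \<le> e \<and> f t \<le> e}"
  define yL where "yL = Max Y"
  have Y: "finite Y" "Y \<noteq> {}" using y P_fin by (auto simp: Y_def)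
  have "yL \<in> Y" unfolding yL_def by (rule Max_in[OF Y])
  then have yL: "yL \<in> P" "yL \<le> e" "f yL \<le> e" by (auto simp: Y_def)
  have yLe: "yL < e" using yL fe eP by (cases "yL = e") auto
  have L: "e' \<le> f t" if "t \<in> P" "yL < t" "t \<le> e" for t
  proof -
    have "t \<notin> Y" using Max_ge[OF Y(1), of t] that by (auto simp: yL_def)
    then show ?thesis using that adj[OF fP] by (auto simp: Y_def)
  qed
  define S where "S = f ` {t \<in> P. yL < t \<and> t \<le> e}"
  have S: "finite S" "S \<noteq> {}" using P_fin yLe eP by (auto simp: S_def)
  obtain t0 where t0: "t0 \<in> P" "yL < t0" "t0 \<le> e" "f t0 = Max S"
    using Max_in[OF S] by (auto simp: S_def)
  have t0_max: "f t \<le> f t0" if "t \<in> P" "yL < t" "t \<le> e" for t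
    using that S t0(4) by (auto simp: S_def)
  show ?thesis
  proof (cases "\<exists>q\<in>P. e' \<le> q \<and> q \<le> f t0 \<and> f q \<le> yL")
    case True
    then show ?thesis using horseshoe_left yL t0 by blast
  next
    case False
    then have noq: "yL < f q" if "q \<in> P" "e' \<le> q" "q \<le> f t0" for q using that by force
    have "\<exists>s\<in>P. e' \<le> s \<and> s \<le> f t0 \<and> e' \<le> f s"
    proof (rule ccontr)
      assume no: "\<not> ?thesis"
      define Q where "Q = {t \<in> P. yL < t \<and> t \<le> f t0}"
      have "f t \<in> Q" if "t \<in> Q" for t
      proof (cases "t \<le> e")
        case True
        then have "e' \<le> f t" "f t \<le> f t0" using that L t0_max by (auto simp: Q_def)
        then show ?thesis using that fP yLe eP by (auto simp: Q_def)
      next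
        case False
        then have t: "t \<in> P" "e' \<le> t" "t \<le> f t0" using that adj[of t] by (auto simp: Q_def)
        then have "f t \<le> e" using no adj[OF fP[OF t(1)]] by auto
        then show ?thesis using t noq[OF t] fP L[OF t0(1-3)] eP by (auto simp: Q_def)
      qed
      moreover have "e \<in> Q" using eP yLe L[OF t0(1-3)] by (auto simp: Q_def)
      ultimately have "Q = P" by (intro invariant_part) (auto simp: Q_def)
      then have "yL \<in> Q" using yL(1) by simp
      then show False unfolding Q_def by simp
    qed
    then obtain s1 where s1: "s1 \<in> P" "e' \<le> s1" "s1 \<le> f t0" "e' \<le> f s1" by blast
    define Z where "Z = {t \<in> P. e' \<le> t \<and> e' \<le> f t}"
    define yR where "yR = Min Z"
    have Z: "finite Z" "Z \<noteq> {}" using s1 P_fin by (auto simp: Z_def)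
    have "yR \<in> Z" unfolding yR_def by (rule Min_in[OF Z])
    then have yR: "yR \<in> P" "e' \<le> yR" "e' \<le> f yR" by (auto simp: Z_def)
    have yRs: "yR \<le> f t0" using Min_le[OF Z(1), of s1] s1 by (auto simp: yR_def Z_def)
    have yRe: "e' < yR" using yR fe eP by (cases "yR = e'") auto
    have R: "f t \<le> e" if "t \<in> P" "t < yR" "e' \<le> t" for t
    proof -
      have "t \<notin> Z" using Min_le[OF Z(1), of t] that by (auto simp: yR_def)
      then show ?thesis using that adj[OF fP] by (auto simp: Z_def)
    qed
    define S' where "S' = f ` {t \<in> P. t < yR \<and> e' \<le> t}"
    have S': "finite S'" "S' \<noteq> {}" using P_fin yRe eP by (auto simp: S'_def)
    obtain s0 where s0: "s0 \<in> P" "s0 < yR" "e' \<le> s0" "f s0 = Min S'"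
      using Min_in[OF S'] by (auto simp: S'_def)
    have s0_min: "f s0 \<le> f t" if "t \<in> P" "t < yR" "e' \<le> t" for t
      using that S' s0(4) by (auto simp: S'_def)
    have low: "yL < f s0" using noq[of s0] s0 yRs by simp
    show ?thesis
    proof (cases "\<exists>q\<in>P. q \<le> e \<and> f s0 \<le> q \<and> yR \<le> f q")
      case True
      then show ?thesis using horseshoe_right yR s0 by blast
    next
      case False
      then have noq': "f q < yR" if "q \<in> P" "q \<le> e" "f s0 \<le> q" for q using that by force
      define Q where "Q = {t \<in> P. f s0 \<le> t \<and> t < yR}"
      have "f t \<in> Q" if "t \<in> Q" for t
      proof (cases "t \<le> e")
        case True
        then have "f t < yR" "e' \<le> f t" using that noq' L low by (auto simp: Q_def)
        then show ?thesis using that fP R[OF s0(1-3)] eP by (auto simp: Q_def)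
      next
        case False
        then have t: "t \<in> P" "t < yR" "e' \<le> t" using that adj[of t] by (auto simp: Q_def)
        then have "f t \<in> P" "f s0 \<le> f t" "f t \<le> e" using fP[OF t(1)] s0_min[OF t] R[OF t] by blast+
        then show ?thesis using yRe eP by (simp add: Q_def)
      qed
      moreover have "e' \<in> Q" using eP yRe R[OF s0(1-3)] by (auto simp: Q_def)
      ultimately have "Q = P" by (intro invariant_part) (auto simp: Q_def)
      then have "yL \<in> Q" using yL(1) by simp
      then show ?thesis using low unfolding Q_def by simp
    qed
  qed
qed

text \<open>The loop stays in \<open>[e, e']\<close> for \<open>n - j\<close> steps, where \<open>j < m\<close> is the time the orbit needs to get
  from \<open>e\<close> to \<open>y\<close>, and passes once through the interval right of \<open>y\<close>.\<close>

lemma left_stays_loop: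
  assumes y: "y \<in> P" "y \<le> e" "f y \<le> e" and m3: "m \<ge> 3" and n: "n > m"
  shows "\<exists>d. d dvd n \<and> d \<in> cycle_periods {a..b} f \<and> d > n - m + 1"
proof -
  define Y where "Y = {t \<in> P. t \<le> e \<and> f t \<le> e}"
  define y' where "y' = Max Y"
  have Y: "finite Y" "Y \<noteq> {}" using y P_fin by (auto simp: Y_def)
  have "y' \<in> Y" unfolding y'_def by (rule Max_in[OF Y])
  then have y': "y' \<in> P" "y' \<le> e" "f y' \<le> e" by (auto simp: Y_def)
  have y'e: "y' < e" using y' fe eP by (cases "y' = e") auto
  have L: "e' \<le> f t" if "t \<in> P" "y' < t" "t \<le> e" for t
  proof -
    have "t \<notin> Y" using Max_ge[OF Y(1), of t] that by (auto simp: y'_def)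
    then show ?thesis using that adj[OF fP] by (auto simp: Y_def)
  qed
  obtain p where p: "p \<in> P" "y' < p" "p \<le> e" using finite_adjacent[OF P_fin y'(1) eP(1) y'e] by blast
  obtain z where z: "z \<in> {a..b}" "e < z" "z < e'" "f z = z"
    using fixed_between by blast
  obtain j where j: "j < m" "(f ^^ j) e = y'" using P_trans[OF eP(1) y'(1)] by blast
  have j0: "j \<ge> 1" using j y'e by (cases j) auto
  define i where "i = n - 1 - j"
  have i: "i + j + 1 = n" "i \<ge> 1" using n j by (auto simp: i_def)
  have ab: "e \<in> {a..b}" "e' \<in> {a..b}" "y' \<in> {a..b}" "p \<in> {a..b}" using eP y' p P_sub by auto
  \<comment> \<open>\<open>A\<close> is \<open>[e, e']\<close> up to index \<open>i\<close>, then
    \<open>[y', p]\<close>, then \<open>[e, e']\<close> again. Only the step leaving index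
    \<open>i\<close> takes time \<open>j\<close>, so the total time is
    \<open>i + j + 1 = n\<close>.\<close>
  define A where "A l = (if l = Suc i then {y'..p} else {e..e'})" for l
  define k where "k l = (if l = i then j else 1)" for l
  have sub: "{e..e'} \<subseteq> {a..b}" "{y'..p} \<subseteq> {a..b}" using ab by auto
  have int: "\<exists>c d. c \<le> d \<and> A l = {c..d} \<and> {c..d} \<subseteq> {a..b}" for l
  proof (cases "l = Suc i")
    case True
    then show ?thesis using sub p by (intro exI[of _ y'] exI[of _ p]) (auto simp: A_def)
  next
    case False
    then show ?thesis using sub eP by (intro exI[of _ e] exI[of _ e']) (auto simp: A_def)
  qed
  have zfix: "(f ^^ l) z = z" for l using z by (induction l) auto
  have cov1: "{e..e'} \<subseteq> (f ^^ 1) ` {e..e'}"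
    by (rule image_interval_covers[OF sub(1), of e' e]) (use fe eP in auto)
  \<comment> \<open>\<open>f ^^ j\<close> sends \<open>e\<close> to \<open>y'\<close> and fixes
    \<open>z\<close>, which lies right of \<open>p\<close>.\<close>
  have cov2: "{y'..p} \<subseteq> (f ^^ j) ` {e..e'}"
    by (rule image_interval_covers[OF sub(1), of e z]) (use z zfix j eP p in auto)
  have cov3: "{e..e'} \<subseteq> (f ^^ 1) ` {y'..p}"
    by (rule image_interval_covers[OF sub(2), of y' p]) (use y' p L in auto)
  have cov: "covers f (k l) (A l) (A (Suc l))" for l
    using cov1 cov2 cov3 by (auto simp: covers_def k_def A_def simp del: image_subset_iff)
  have "A (i + 2) = A 0" by (simp add: A_def)
  with int cov obtain x where x: "x \<in> {a..b}" "(f ^^ (\<Sum>l<i+2. k l)) x = x"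
      "\<And>l. l \<le> i + 2 \<Longrightarrow> (f ^^ (\<Sum>i<l. k i)) x \<in> A l"
    by (rule loop_itinerary[of "i + 2" A k]) (rule that)
  have sum1: "(\<Sum>s<l. k s) = l" if "l \<le> i" for l
    using that by (induction l) (auto simp: k_def)
  have sum2: "(\<Sum>s<Suc i. k s) = i + j" using sum1[of i] by (simp add: k_def)
  have sum3: "(\<Sum>s<i+2. k s) = n" using sum2 i by (simp add: k_def)
  have xn: "(f ^^ n) x = x" using x(2) sum3 by simp
  have xJ: "(f ^^ l) x \<in> {e..e'}" if "l \<le> i" for l
    using x(3)[of l] sum1[OF that] that by (simp add: A_def)
  have xB: "(f ^^ (i + j)) x \<in> {y'..p}"
    using x(3)[of "Suc i"] sum2 by (simp add: A_def)
  obtain d where d: "min_period f x d" "d dvd n"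
    using min_period_exists[OF xn] n by auto
  have d1: "d \<ge> 1" "(f ^^ d) x = x" using d by (auto simp: min_period_def)
  \<comment> \<open>If \<open>d \<le> i + 1\<close>, the times \<open>0..i\<close> spent in
    \<open>[e, e']\<close> exhaust the cycle of \<open>x\<close>. At time \<open>i + j\<close> the
    point is also in \<open>[y', p]\<close> with \<open>p \<le> e\<close>, so it is
    \<open>e\<close>; then \<open>P\<close> lies in \<open>{e, e'}\<close>, against
    \<open>m \<ge> 3\<close>.\<close>
  have "d > i + 1"
  proof (rule ccontr)
    assume "\<not> d > i + 1"
    then have small: "(f ^^ l) x \<in> {e..e'}" for l
    proof -
      have "l mod d < d" using d1 by simp
      then have "l mod d \<le> i" using \<open>\<not> d > i + 1\<close> by linarith
      then show ?thesis using xJ[of "l mod d"] funpow_mod_eq[OF d1(2), of l] by simp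
    qed
    then have "(f ^^ (i + j)) x = e" using xB p(3) small[of "i + j"] unfolding atLeastAtMost_iff by linarith
    then have P: "(f ^^ l) e \<in> {e..e'}" for l
      using small[of "l + (i + j)"] by (simp add: funpow_add)
    then have "P \<subseteq> {e..e'}" using P_trans[OF eP(1)] by blast
    then have "P \<subseteq> {e, e'}" using adj by force
    then have "card P \<le> card {e, e'}" by (intro card_mono) auto
    then show False using P_card m3 eP by simp
  qed
  then have "d > n - m + 1" using i j by linarith
  then show ?thesis using d x(1) unfolding cycle_periods_iff by blast
qed

lemma right_stays:
  assumes y: "y \<in> P" "e' \<le> y" "e' \<le> f y"
  shows "horseshoe a b (f ^^ 2) \<and> 2 \<in> cycle_periods {a..b} f"
    "m \<ge> 3 \<Longrightarrow> n > m \<Longrightarrow> \<exists>d. d dvd n \<and> d \<in> cycle_periods {a..b} f \<and> d > n - m + 1"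
proof -
  interpret r: periodic_cut "- b" "- a" "reflect f" "uminus ` P" m "- e'" "- e" by (rule reflect_cut)
  have "horseshoe (- b) (- a) (reflect f ^^ 2) \<and> 2 \<in> cycle_periods {- b..- a} (reflect f)"
    by (rule r.left_stays_horseshoe[of "-y"]) (use assms in \<open>auto simp: reflect_def\<close>)
  then show "horseshoe a b (f ^^ 2) \<and> 2 \<in> cycle_periods {a..b} f"
    by (simp add: cycle_periods_reflect reflect_funpow horseshoe_reflect)
  assume "m \<ge> 3" "n > m"
  then have "\<exists>d. d dvd n \<and> d \<in> cycle_periods {- b..- a} (reflect f) \<and> d > n - m + 1"
    by (intro r.left_stays_loop[of "-y"]) (use assms in \<open>auto simp: reflect_def\<close>)
  then show "\<exists>d. d dvd n \<and> d \<in> cycle_periods {a..b} f \<and> d > n - m + 1"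
    by (simp add: cycle_periods_reflect)
qed

text \<open>\<open>f\<close> exchanges the parts of \<open>P\<close> left and right of the cut, so
  they have equally many points. The hulls of the two parts cover each other and are disjoint, so
  the loop of length 2 carries no fixed point.\<close>

lemma swap_even:
  assumes l: "\<And>t. t \<in> P \<Longrightarrow> t \<le> e \<Longrightarrow> e' \<le> f t" and r: "\<And>t. t \<in> P \<Longrightarrow> e' \<le> t \<Longrightarrow> f t \<le> e"
  shows "even m" "2 \<in> cycle_periods {a..b} f"
proof -
  define L where "L = {t \<in> P. t \<le> e}"
  define R where "R = {t \<in> P. e' \<le> t}"
  have LR: "P = L \<union> R" "L \<inter> R = {}" using adj eP by (auto simp: L_def R_def)
  have fin: "finite L" "finite R" using P_fin by (auto simp: L_def R_def)
  have fLR: "f ` L \<subseteq> R" "f ` R \<subseteq> L" using l r fP by (auto simp: L_def R_def)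
  have img: "f ` L \<union> f ` R = L \<union> R" using P_img LR by (metis image_Un)
  have onto: "f ` L = R" "f ` R = L" using img fLR LR(2) by blast+
  have "card L = card R" using card_image_le[OF fin(1), of f] card_image_le[OF fin(2), of f] onto by simp
  then have "m = 2 * card L" using P_card LR fin by (simp add: card_Un_disjoint)
  then show "even m" by simp
  define c where "c = Min P"
  define d where "d = Max P"
  have ne: "P \<noteq> {}" using eP by auto
  have cd: "c \<in> P" "d \<in> P" "\<And>t. t \<in> P \<Longrightarrow> c \<le> t \<and> t \<le> d"
    unfolding c_def d_def using Min_in[OF P_fin ne] Max_in[OF P_fin ne] Min_le[OF P_fin] Max_ge[OF P_fin] by auto
  have "c \<in> L" "e \<in> L" "d \<in> R" "e' \<in> R" using cd eP by (auto simp: L_def R_def)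
  then obtain p1 p2 p3 p4 where p: "p1 \<in> L" "f p1 = e'" "p2 \<in> L" "f p2 = d" "p3 \<in> R" "f p3 = c" "p4 \<in> R" "f p4 = e"
  proof -
    have "e' \<in> f ` L" "d \<in> f ` L" "c \<in> f ` R" "e \<in> f ` R" using \<open>c \<in> L\<close> \<open>e \<in> L\<close> \<open>d \<in> R\<close> \<open>e' \<in> R\<close> onto by simp_all
    then show thesis using that by (elim imageE) simp
  qed
  have sub: "{c..e} \<subseteq> {a..b}" "{e'..d} \<subseteq> {a..b}" using cd eP P_sub by auto
  have in': "t \<in> {c..e}" if "t \<in> L" for t using that cd by (auto simp: L_def)
  have in'': "t \<in> {e'..d}" if "t \<in> R" for t using that cd by (auto simp: R_def)
  have cov1: "{e'..d} \<subseteq> (f ^^ 1) ` {c..e}"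
    by (rule image_interval_covers[OF sub(1), of p1 p2]) (use in' p in auto)
  have cov2: "{c..e} \<subseteq> (f ^^ 1) ` {e'..d}"
    by (rule image_interval_covers[OF sub(2), of p3 p4]) (use in'' p in auto)
  define A where "A l = (if l = 1 then {e'..d} else {c..e})" for l :: nat
  have int: "\<exists>c d. c \<le> d \<and> A l = {c..d} \<and> {c..d} \<subseteq> {a..b}" for l
  proof (cases "l = 1")
    case True
    then show ?thesis using sub cd eP by (intro exI[of _ e'] exI[of _ d]) (auto simp: A_def)
  next
    case False
    then show ?thesis using sub cd eP by (intro exI[of _ c] exI[of _ e]) (auto simp: A_def)
  qed
  have cov: "covers f 1 (A l) (A (Suc l))" if "l < 2" for l
    using that cov1 cov2 by (auto simp: covers_def A_def less_2_cases_iff simp del: image_subset_iff)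
  have "A 2 = A 0" by (simp add: A_def)
  with int cov obtain x where x: "x \<in> {a..b}" "(f ^^ (\<Sum>l<2::nat. 1)) x = x"
      "\<And>l::nat. l \<le> 2 \<Longrightarrow> (f ^^ (\<Sum>i<l. 1)) x \<in> A l"
    by (rule loop_itinerary[of 2 A "\<lambda>_. 1"]) (assumption, rule that)
  have "x \<in> A 0" "f x \<in> A 1" using x(3)[of 0] x(3)[of 1] by simp_all
  then have "f x \<noteq> x" using eP by (auto simp: A_def)
  moreover have "(f ^^ 2) x = x" using x(2) by simp
  ultimately have "min_period f x 2" by (auto simp: min_period_def less_2_cases_iff)
  then show "2 \<in> cycle_periods {a..b} f" using x by (auto simp: cycle_periods_iff)
qed

end

section \<open>Periods forced by an odd period\<close>

context interval_map
begin

lemma period_2: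
  assumes "m \<in> cycle_periods {a..b} f" "m \<ge> 2"
  shows "2 \<in> cycle_periods {a..b} f"
proof -
  obtain x where "x \<in> {a..b}" "min_period f x m" using assms by (auto simp: cycle_periods_iff)
  then obtain P e e' where "periodic_cut a b f P m e e'" using periodic_cut_exists assms by blast
  then interpret periodic_cut a b f P m e e' .
  show ?thesis
  proof (cases "(\<exists>y\<in>P. y \<le> e \<and> f y \<le> e) \<or> (\<exists>y\<in>P. e' \<le> y \<and> e' \<le> f y)")
    case True
    then show ?thesis using left_stays_horseshoe right_stays(1) by blast
  next
    case False
    then show ?thesis using swap_even(2) adj[OF fP] by blast
  qed
qed

text \<open>An orbit of odd size cannot alternate between the two sides of the cut, so one of its
  points stays on its side.\<close>

lemma odd_period_loop:
  assumes "m \<in> cycle_periods {a..b} f" "odd m" "m \<ge> 3"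
  shows "horseshoe a b (f ^^ 2)"
    "n > m \<Longrightarrow> \<exists>d. d dvd n \<and> d \<in> cycle_periods {a..b} f \<and> d > n - m + 1"
proof -
  obtain x where "x \<in> {a..b}" "min_period f x m" using assms by (auto simp: cycle_periods_iff)
  moreover have "m \<ge> 2" using assms by simp
  ultimately obtain P e e' where "periodic_cut a b f P m e e'" using periodic_cut_exists by blast
  then interpret periodic_cut a b f P m e e' .
  have "(\<exists>y\<in>P. y \<le> e \<and> f y \<le> e) \<or> (\<exists>y\<in>P. e' \<le> y \<and> e' \<le> f y)"
    using swap_even(1) adj[OF fP] assms(2) by blast
  then show "horseshoe a b (f ^^ 2)"
    "n > m \<Longrightarrow> \<exists>d. d dvd n \<and> d \<in> cycle_periods {a..b} f \<and> d > n - m + 1"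
    using left_stays_horseshoe left_stays_loop right_stays assms(3) by blast+
qed

text \<open>The loop gives only a divisor \<open>d\<close> of \<open>n\<close>, with
  \<open>d > n - m0 + 1\<close> for the least odd period \<open>m0 \<ge> 3\<close>. If
  \<open>d \<noteq> n\<close>, then \<open>2 * d \<le> n\<close> and hence
  \<open>n < 2 * m0\<close>. So \<open>n\<close> is odd, \<open>d\<close> is an odd period,
  \<open>d \<ge> m0\<close>, and \<open>n \<ge> 3 * d \<ge> 3 * m0\<close> is absurd.\<close>

lemma odd_period_forces:
  assumes "m \<in> cycle_periods {a..b} f" "odd m" "m \<ge> 3" "n > m" "odd n \<or> n \<ge> 2 * m"
  shows "n \<in> cycle_periods {a..b} f"
proof -
  define Q where "Q r \<longleftrightarrow> r \<in> cycle_periods {a..b} f \<and> odd r \<and> r \<ge> 3" for r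
  define m0 where "m0 = (LEAST r. Q r)"
  have "Q m" using assms by (simp add: Q_def)
  then have m0: "Q m0" "m0 \<le> m" "\<And>r. Q r \<Longrightarrow> m0 \<le> r"
    unfolding m0_def by (auto intro: LeastI Least_le)
  then have "n > m0" using assms by simp
  with odd_period_loop(2)[of m0 n] m0(1) obtain d where
    d: "d dvd n" "d \<in> cycle_periods {a..b} f" "d > n - m0 + 1" by (auto simp: Q_def)
  obtain k where k: "n = d * k" using d by auto
  have "k \<noteq> 0" using k assms(4) by (cases "k = 0") simp_all
  show ?thesis
  proof (cases "k = 1")
    case True
    then show ?thesis using k d by simp
  next
    case False
    then have "k \<ge> 2" using \<open>k \<noteq> 0\<close> by simp
    then have "2 * d \<le> n" using k by simp
    then have "\<not> n \<ge> 2 * m0" using d \<open>n > m0\<close> by linarith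
    then have "odd n" using assms(5) m0(2) by linarith
    then have odd: "odd k" "odd d" using k by auto
    then have "k \<ge> 3" using \<open>k \<ge> 2\<close> by (cases "k = 2") auto
    then have "3 * d \<le> n" using k by simp
    moreover have "d \<ge> m0" using odd d \<open>n > m0\<close> by (intro m0(3)) (auto simp: Q_def)
    ultimately have False using \<open>\<not> n \<ge> 2 * m0\<close> m0(1) by (simp add: Q_def)
    then show ?thesis ..
  qed
qed

end

text \<open>\<open>f ^^ 2\<close> has a horseshoe, hence period 3, so the claim for
  \<open>f ^^ 2\<close> with one factor 2 less lifts to \<open>f\<close>. At the start,
  \<open>r \<ge> 3\<close> is a period of \<open>f ^^ 2\<close>; it may come from the period
  \<open>r\<close> of \<open>f\<close>, which then forces \<open>2 * r\<close>.\<close>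

lemma odd_period_forces_even:
  assumes "interval_map a b f" "m \<in> cycle_periods {a..b} f" "odd m" "m \<ge> 3" "odd r"
  shows "2 ^ Suc c * r \<in> cycle_periods {a..b} f"
  using assms
proof (induction c arbitrary: f m)
  case (0 f m)
  interpret interval_map a b f by fact
  interpret F: interval_map a b "f ^^ 2" by (rule interval_map_funpow)
  show ?case
  proof (cases "r = 1")
    case True
    then show ?thesis using period_2[of m] 0 by simp
  next
    case False
    then have r: "r \<ge> 3" using \<open>odd r\<close> by (cases "r = 2"; cases "r = 0") auto
    have 3: "3 \<in> cycle_periods {a..b} (f ^^ 2)" using 0 odd_period_loop(1) F.horseshoe_period_3 by blast
    have "r \<in> cycle_periods {a..b} (f ^^ 2)"
      using F.odd_period_forces[OF 3, of r] 3 r \<open>odd r\<close> by (cases "r = 3") auto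
    then have "r \<in> cycle_periods {a..b} (f ^^ (2 ^ 1))" by simp
    then obtain i where i: "i \<le> 1" "2 ^ i * r \<in> cycle_periods {a..b} f" by (rule cycle_periods_pow2)
    show ?thesis
    proof (cases "i = 0")
      case True
      then show ?thesis using odd_period_forces[of r "2 * r"] i r \<open>odd r\<close> by simp
    next
      case False
      then show ?thesis using i by (cases "i = 1") auto
    qed
  qed
next
  case (Suc c f m)
  interpret interval_map a b f by fact
  interpret F: interval_map a b "f ^^ 2" by (rule interval_map_funpow)
  have 3: "3 \<in> cycle_periods {a..b} (f ^^ 2)" using Suc.prems odd_period_loop(1) F.horseshoe_period_3 by blast
  have "2 ^ Suc c * r \<in> cycle_periods {a..b} (f ^^ (2 ^ 1))"
    using Suc.IH[OF F.interval_map_axioms 3] \<open>odd r\<close> by simp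
  then obtain i where "2 ^ i * (2 ^ Suc c * r) \<in> cycle_periods {a..b} f" "i = 1"
    by (rule cycle_periods_pow2) auto
  then show ?case by (simp add: mult.assoc)
qed

lemma (in interval_map) period_1:
  assumes "a \<le> b" shows "1 \<in> cycle_periods {a..b} f"
proof -
  have "\<exists>x\<ge>a. x \<le> b \<and> f x - x = 0"
    by (rule IVT2') (use assms in_range[of a] in_range[of b] in
      \<open>auto intro!: continuous_on_diff cont continuous_on_id\<close>)
  then obtain x where "x \<in> {a..b}" "f x = x" by auto
  then show ?thesis by (auto simp: cycle_periods_iff min_period_def)
qed

lemma div_gcd_pow2:
  assumes "odd (q::nat)" "i \<le> a"
  shows "(2 ^ a * q) div gcd (2 ^ a * q) (2 ^ i) = 2 ^ (a - i) * q"
proof -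
  have "(2::nat) ^ i dvd 2 ^ a * q" using assms(2) by (simp add: le_imp_power_dvd)
  then have "gcd (2 ^ a * q) (2 ^ i) = (2::nat) ^ i" by (simp add: gcd_nat.absorb2)
  moreover have "(2::nat) ^ a * q = 2 ^ i * (2 ^ (a - i) * q)"
    using assms(2) by (simp flip: power_add add: mult.assoc[symmetric])
  ultimately show ?thesis by (metis nonzero_mult_div_cancel_left power_not_zero zero_neq_numeral)
qed

text \<open>Passing to \<open>f ^^ (2 ^ i)\<close> with \<open>i \<le> \<alpha>\<close> strips
  factors 2 from \<open>m\<close>; the period forced there is lifted back to
  \<open>f\<close>.\<close>

theorem (in interval_map) sharkovskii:
  assumes m: "m \<in> cycle_periods {a..b} f" and mn: "m \<prec>\<^sub>S n"
  shows "n \<in> cycle_periods {a..b} f"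
proof -
  have ab: "a \<le> b" using m by (auto simp: cycle_periods_iff)
  have it: "interval_map a b (f ^^ (2 ^ i))" for i by (rule interval_map_funpow)
  obtain \<alpha> p \<beta> q where *: "m = 2 ^ \<alpha> * p" "odd p" "n = 2 ^ \<beta> * q" "odd q"
    "(p > 1 \<and> q > 1 \<and> (\<alpha> < \<beta> \<or> \<alpha> = \<beta> \<and> p < q)) \<or> (p > 1 \<and> q = 1) \<or> (p = 1 \<and> q = 1 \<and> \<beta> < \<alpha>)"
    using mn unfolding sharkovskii_less_def by blast
  have per: "2 ^ (\<alpha> - i) * p \<in> cycle_periods {a..b} (f ^^ (2 ^ i))" if "i \<le> \<alpha>" for i
    using cycle_periods_funpow[OF m, of "2 ^ i"] div_gcd_pow2[OF *(2) that] *(1) by simp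
  consider "p > 1" "\<alpha> < \<beta>" | "p > 1" "\<alpha> = \<beta>" "p < q" | "q = 1" "\<beta> \<le> \<alpha>" "p > 1 \<or> \<beta> < \<alpha>" using *(5) by linarith
  then show ?thesis
  proof cases
    case 1
    then have "p \<ge> 3" using *(2) by (cases "p = 2") auto
    have "2 ^ Suc (\<beta> - \<alpha> - 1) * q \<in> cycle_periods {a..b} (f ^^ (2 ^ \<alpha>))"
      using odd_period_forces_even[OF it _ *(2) \<open>p \<ge> 3\<close> *(4)] per[of \<alpha>] by simp
    then obtain i where "2 ^ i * (2 ^ Suc (\<beta> - \<alpha> - 1) * q) \<in> cycle_periods {a..b} f" "i = \<alpha>"
      by (rule cycle_periods_pow2) auto
    moreover have "\<alpha> + Suc (\<beta> - \<alpha> - 1) = \<beta>" using 1 by simp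
    ultimately show ?thesis using *(3) by (metis mult.assoc power_add)
  next
    case 2
    then have p3: "p \<ge> 3" using *(2) by (cases "p = 2") auto
    interpret F: interval_map a b "f ^^ (2 ^ \<alpha>)" by (rule it)
    have "q \<in> cycle_periods {a..b} (f ^^ (2 ^ \<alpha>))"
      using F.odd_period_forces[of p q] per[of \<alpha>] 2 p3 * by simp
    then obtain i where i: "i \<le> \<alpha>" "2 ^ i * q \<in> cycle_periods {a..b} f" by (rule cycle_periods_pow2)
    \<comment> \<open>The period \<open>q\<close> of \<open>f ^^ (2 ^ \<alpha>)\<close> may come
      from \<open>2 ^ i * q\<close> with \<open>i < \<alpha>\<close>. Then \<open>q\<close> is an
      odd period of \<open>f ^^ (2 ^ i)\<close> and forces the missing factor
      \<open>2 ^ (\<alpha> - i)\<close>.\<close>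
    show ?thesis
    proof (cases "i = \<alpha>")
      case True
      then show ?thesis using i 2 * by simp
    next
      case False
      then have "i < \<alpha>" using i by simp
      have "q \<in> cycle_periods {a..b} (f ^^ (2 ^ i))"
        using cycle_periods_funpow[OF i(2), of "2 ^ i"] div_gcd_pow2[OF *(4), of i i] by simp
      then have "2 ^ Suc (\<alpha> - i - 1) * q \<in> cycle_periods {a..b} (f ^^ (2 ^ i))"
        using odd_period_forces_even[OF it _ *(4) _ *(4)] 2 p3 by simp
      then obtain j where "2 ^ j * (2 ^ Suc (\<alpha> - i - 1) * q) \<in> cycle_periods {a..b} f" "j = i"
        by (rule cycle_periods_pow2) auto
      moreover have "i + Suc (\<alpha> - i - 1) = \<alpha>" using \<open>i < \<alpha>\<close> by simp
      ultimately show ?thesis using *(3) 2 by (metis mult.assoc power_add)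
    qed
  next
    case 3
    show ?thesis
    proof (cases "\<beta> = 0")
      case True
      then show ?thesis using 3 * period_1[OF ab] by simp
    next
      case False
      \<comment> \<open>One factor 2 is kept, so that the forced period of this power is 2; being
        even, it lifts with the full factor \<open>2 ^ i\<close>.\<close>
      define i where "i = \<beta> - 1"
      interpret F: interval_map a b "f ^^ (2 ^ i)" by (rule it)
      have i: "i < \<alpha>" "Suc i = \<beta>" using False 3 by (auto simp: i_def)
      have "(2::nat) ^ 1 \<le> 2 ^ (\<alpha> - i)" using i by (intro power_increasing) auto
      moreover have "p \<ge> 1" using *(2) by (cases p) auto
      ultimately have "2 ^ (\<alpha> - i) * p \<ge> 2 * 1" by (intro mult_le_mono) auto
      then have "2 \<in> cycle_periods {a..b} (f ^^ (2 ^ i))"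
        using F.period_2[OF per] i by simp
      then obtain j where "2 ^ j * 2 \<in> cycle_periods {a..b} f" "j = i"
        by (rule cycle_periods_pow2) auto
      then show ?thesis using * 3 i by (metis mult.right_neutral power_Suc2)
    qed
  qed
qed

section \<open>Non-wandering points of powers\<close>

context interval_map
begin

definition nhd :: "real \<Rightarrow> real \<Rightarrow> real set" where
  "nhd x e = {a..b} \<inter> {x - e<..<x + e}"

lemma mem_nhd: "y \<in> nhd x e \<longleftrightarrow> y \<in> {a..b} \<and> \<bar>y - x\<bar> < e"
  by (auto simp: nhd_def)

lemma connected_nhd: "connected (nhd x e)"
  unfolding nhd_def by (intro convex_connected convex_Int) auto

lemma nhd_mono: "e \<le> e' \<Longrightarrow> nhd x e \<subseteq> nhd x e'"
  by (auto simp: nhd_def)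

lemma funpow_cont_at:
  assumes "x \<in> {a..b}" "d > 0"
  obtains e where "e > 0" "\<And>y. y \<in> nhd x e \<Longrightarrow> \<bar>(f ^^ n) y - (f ^^ n) x\<bar> < d"
proof -
  obtain e where "e > 0" "\<forall>y\<in>{a..b}. dist y x < e \<longrightarrow> dist ((f ^^ n) y) ((f ^^ n) x) < d"
    using cont_funpow[of n] assms unfolding continuous_on_iff by blast
  then show thesis using that[of e] by (auto simp: mem_nhd dist_real_def)
qed

lemma nonwandering_iff:
  "x \<in> nonwandering {a..b} f \<longleftrightarrow>
     x \<in> {a..b} \<and> (\<forall>e>0. \<exists>i\<ge>1. (f ^^ i) ` nhd x e \<inter> nhd x e \<noteq> {})"
proof (intro iffI conjI allI impI)
  assume x: "x \<in> nonwandering {a..b} f"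
  then show xab: "x \<in> {a..b}" by (simp add: nonwandering_def)
  fix e :: real assume "e > 0"
  then have "x \<in> nhd x e" using xab by (simp add: mem_nhd)
  moreover have "openin (top_of_set {a..b}) (nhd x e)" unfolding nhd_def by (simp add: openin_open_Int)
  ultimately show "\<exists>i\<ge>1. (f ^^ i) ` nhd x e \<inter> nhd x e \<noteq> {}"
    using x unfolding nonwandering_def by blast
next
  assume x: "x \<in> {a..b} \<and> (\<forall>e>0. \<exists>i\<ge>1. (f ^^ i) ` nhd x e \<inter> nhd x e \<noteq> {})"
  have "\<exists>i\<ge>1. (f ^^ i) ` U \<inter> U \<noteq> {}" if U: "openin (top_of_set {a..b}) U" "x \<in> U" for U
  proof -
    obtain e where e: "e > 0" "\<And>y. y \<in> {a..b} \<Longrightarrow> dist y x < e \<Longrightarrow> y \<in> U"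
      using U unfolding openin_euclidean_subtopology_iff by blast
    then have "nhd x e \<subseteq> U" by (auto simp: mem_nhd dist_real_def)
    then show ?thesis using x e(1) by blast
  qed
  then show "x \<in> nonwandering {a..b} f" using x by (simp add: nonwandering_def)
qed

lemma nonwandering_funpow_subset:
  assumes "r \<ge> 1" shows "nonwandering {a..b} (f ^^ r) \<subseteq> nonwandering {a..b} f"
proof
  fix x assume x: "x \<in> nonwandering {a..b} (f ^^ r)"
  interpret g: interval_map a b "f ^^ r" by (rule interval_map_funpow)
  show "x \<in> nonwandering {a..b} f"
    unfolding nonwandering_iff
  proof (intro conjI allI impI)
    show "x \<in> {a..b}" using x by (simp add: nonwandering_def)
    fix e :: real assume "e > 0"
    then obtain i where i: "i \<ge> 1" "((f ^^ r) ^^ i) ` nhd x e \<inter> nhd x e \<noteq> {}"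
      using x unfolding g.nonwandering_iff by blast
    then have "r * i \<ge> 1" "(f ^^ (r * i)) ` nhd x e \<inter> nhd x e \<noteq> {}"
      using assms by (auto simp: funpow_mult mult.commute Suc_le_eq)
    then show "\<exists>i\<ge>1. (f ^^ i) ` nhd x e \<inter> nhd x e \<noteq> {}" by blast
  qed
qed

text \<open>As \<open>x\<close> is not periodic, continuity gives a smaller neighbourhood without
  returns at the times \<open>1, ..., N - 1\<close>; its returns, which exist, are returns of the
  larger one.\<close>

lemma returns_unbounded:
  assumes x: "x \<in> nonwandering {a..b} f" and np: "\<And>d. d \<ge> 1 \<Longrightarrow> (f ^^ d) x \<noteq> x" and "e > 0"
  shows "\<exists>i\<ge>N. (f ^^ i) ` nhd x e \<inter> nhd x e \<noteq> {}"
proof -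
  have xab: "x \<in> {a..b}" using x by (simp add: nonwandering_def)
  have "\<exists>e'>0. e' \<le> e \<and> (\<forall>i. 1 \<le> i \<and> i < N \<longrightarrow> (f ^^ i) ` nhd x e' \<inter> nhd x e' = {})"
  proof (induction N)
    case 0
    then show ?case using \<open>e > 0\<close> by auto
  next
    case (Suc N)
    then obtain e' where e': "e' > 0" "e' \<le> e"
      "\<And>i. 1 \<le> i \<Longrightarrow> i < N \<Longrightarrow> (f ^^ i) ` nhd x e' \<inter> nhd x e' = {}" by blast
    show ?case
    proof (cases "N = 0")
      case True
      then show ?thesis using e' by auto
    next
      case False
      define d where "d = \<bar>(f ^^ N) x - x\<bar> / 2"
      have "d > 0" using np[of N] False by (auto simp: d_def)
      then obtain c where c: "c > 0" "\<And>y. y \<in> nhd x c \<Longrightarrow> \<bar>(f ^^ N) y - (f ^^ N) x\<bar> < d"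
        using funpow_cont_at xab by metis
      define e'' where "e'' = min e' (min c d)"
      have sub: "nhd x e'' \<subseteq> nhd x e'" "nhd x e'' \<subseteq> nhd x c" by (auto simp: e''_def intro!: nhd_mono)
      have "(f ^^ N) ` nhd x e'' \<inter> nhd x e'' = {}"
      proof (rule ccontr)
        assume "\<not> ?thesis"
        then obtain y where y: "y \<in> nhd x e''" "(f ^^ N) y \<in> nhd x e''" by blast
        then have "\<bar>(f ^^ N) y - x\<bar> < d" by (auto simp: mem_nhd e''_def)
        moreover have "\<bar>(f ^^ N) y - (f ^^ N) x\<bar> < d" using c(2) sub y by blast
        ultimately show False by (simp add: d_def abs_if split: if_splits)
      qed
      moreover have "(f ^^ i) ` nhd x e'' \<inter> nhd x e'' = {}" if "1 \<le> i" "i < N" for i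
        using e'(3)[OF that] sub(1) by blast
      moreover have "e'' > 0" "e'' \<le> e" using e' c \<open>d > 0\<close> by (auto simp: e''_def)
      ultimately show ?thesis by (metis less_Suc_eq)
    qed
  qed
  then obtain e' where e': "e' > 0" "e' \<le> e"
    "\<And>i. 1 \<le> i \<Longrightarrow> i < N \<Longrightarrow> (f ^^ i) ` nhd x e' \<inter> nhd x e' = {}" by blast
  obtain i where i: "i \<ge> 1" "(f ^^ i) ` nhd x e' \<inter> nhd x e' \<noteq> {}"
    using x e'(1) unfolding nonwandering_iff by blast
  then have "i \<ge> N" using e'(3) by (meson not_le_imp_less)
  moreover have "(f ^^ i) ` nhd x e \<inter> nhd x e \<noteq> {}" using i(2) nhd_mono[OF e'(2)] by blast
  ultimately show ?thesis by blast
qed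

lemma orb_subset: "U \<subseteq> {a..b} \<Longrightarrow> orb f U \<subseteq> {a..b}"
  using funpow_in by (force simp: orb_def)

lemma funpow_orb: "(f ^^ i) ` orb f U \<subseteq> orb f U"
proof
  fix y assume "y \<in> (f ^^ i) ` orb f U"
  then obtain j u where "u \<in> U" "y = (f ^^ i) ((f ^^ j) u)" by (auto simp: orb_def)
  then have "y = (f ^^ (i + j)) u" by (simp add: funpow_add)
  then show "y \<in> orb f U" using \<open>u \<in> U\<close> by (auto simp: orb_def)
qed

text \<open>\<open>W\<close> is the component of \<open>orb f U\<close> that contains
  \<open>U\<close>. Images of \<open>W\<close> are connected and stay in the orbit, so an image that
  meets \<open>W\<close> lies in \<open>W\<close>. Division with remainder then makes every return
  time a multiple of the least one.\<close>

lemma return_component: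
  assumes U: "connected U" "U \<subseteq> {a..b}" "x \<in> U" and ret: "i0 \<ge> 1" "(f ^^ i0) ` U \<inter> U \<noteq> {}"
  obtains p W where "p \<ge> 1" "connected W" "U \<subseteq> W" "W \<subseteq> orb f U" "(f ^^ p) ` W \<subseteq> W"
    "\<And>i. (f ^^ i) ` W \<inter> W \<noteq> {} \<Longrightarrow> p dvd i"
proof -
  define W where "W = connected_component_set (orb f U) x"
  have Uorb: "U \<subseteq> orb f U" unfolding orb_def using UN_upper[of 0 UNIV "\<lambda>i. (f ^^ i) ` U"] by simp
  have W: "connected W" "W \<subseteq> orb f U" unfolding W_def by (simp_all add: connected_component_subset)
  have max: "T \<subseteq> W" if "connected T" "x \<in> T" "T \<subseteq> orb f U" for T
    unfolding W_def using that by (intro connected_component_maximal)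
  have UW: "U \<subseteq> W" using max U Uorb by blast
  have Wab: "W \<subseteq> {a..b}" using W(2) orb_subset[OF U(2)] by blast
  have meet: "(f ^^ i) ` W \<subseteq> W" if "(f ^^ i) ` W \<inter> W \<noteq> {}" for i
  proof -
    have c: "connected ((f ^^ i) ` W)"
      by (rule connected_continuous_image[OF continuous_on_subset[OF cont_funpow Wab] W(1)])
    have "(f ^^ i) ` W \<subseteq> orb f U" using funpow_orb[of i U] W(2) by blast
    then have "(f ^^ i) ` W \<union> W \<subseteq> W"
      using UW U(3) W that c by (intro max connected_Un) auto
    then show ?thesis by blast
  qed
  define p where "p = (LEAST i. i \<ge> 1 \<and> (f ^^ i) ` W \<inter> W \<noteq> {})"
  have "i0 \<ge> 1 \<and> (f ^^ i0) ` W \<inter> W \<noteq> {}" using ret UW by blast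
  then have p: "p \<ge> 1 \<and> (f ^^ p) ` W \<inter> W \<noteq> {}" unfolding p_def by (rule LeastI)
  have p_min: "p \<le> i" if "i \<ge> 1" "(f ^^ i) ` W \<inter> W \<noteq> {}" for i
    unfolding p_def using that by (intro Least_le) auto
  have pW: "(f ^^ p) ` W \<subseteq> W" using meet p by blast
  have pqW: "(f ^^ (p * q)) w \<in> W" if "w \<in> W" for q w
    using that pW by (induction q) (auto simp: funpow_add)
  have "p dvd i" if i: "(f ^^ i) ` W \<inter> W \<noteq> {}" for i
  proof -
    have "(f ^^ i) x \<in> W" using meet[OF i] UW U(3) by blast
    then have "(f ^^ (i mod p)) ((f ^^ (p * (i div p))) x) \<in> W"
      using funpow_add[of "i mod p" "p * (i div p)" f] by simp
    moreover have "(f ^^ (p * (i div p))) x \<in> W" using pqW UW U(3) by blast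
    ultimately have "(f ^^ (i mod p)) ` W \<inter> W \<noteq> {}" by blast
    moreover have "i mod p < p" using p by simp
    ultimately have "i mod p = 0" using p_min[of "i mod p"] by (cases "i mod p") auto
    then show ?thesis by auto
  qed
  then show thesis using that[of p W] p W UW pW by blast
qed

text \<open>Without a fixed point in \<open>W\<close>, \<open>f ^^ p\<close> would move all points
  of the connected set \<open>W\<close> in the same direction. A point near \<open>x\<close> would
  be carried away by almost \<open>d\<close> at the first step and drift further, so it could not
  return. A fixed point \<open>z\<close> has least period \<open>p\<close> because \<open>W\<close>
  does not meet its images at shorter times. It lies in an image of the neighbourhood at a time
  divisible by \<open>p\<close>, and hence at all later such times.\<close>

lemma return_fixed:
  assumes x: "x \<in> nonwandering {a..b} f" and "e > 0"
    and W: "p \<ge> 1" "connected W" "nhd x e \<subseteq> W" "W \<subseteq> orb f (nhd x e)" "(f ^^ p) ` W \<subseteq> W"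
      "\<And>i. (f ^^ i) ` W \<inter> W \<noteq> {} \<Longrightarrow> p dvd i"
  obtains z i0 where "z \<in> {a..b}" "min_period f z p" "\<And>i. i \<ge> i0 \<Longrightarrow> z \<in> (f ^^ (p * i)) ` nhd x e"
proof -
  have xab: "x \<in> {a..b}" using x by (simp add: nonwandering_def)
  have xU: "x \<in> nhd x e" using xab \<open>e > 0\<close> by (simp add: mem_nhd)
  have Wab: "W \<subseteq> {a..b}" using W(4) orb_subset[of "nhd x e"] by (auto simp: nhd_def)
  have "\<exists>z\<in>W. (f ^^ p) z = z"
  proof (rule ccontr)
    assume no: "\<not> ?thesis"
    define h where "h t = (f ^^ p) t - t" for t
    have "continuous_on W h" unfolding h_def
      by (intro continuous_on_diff continuous_on_id continuous_on_subset[OF cont_funpow Wab])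
    then have con: "connected (h ` W)" using W(2) by (rule connected_continuous_image)
    have h0: "0 \<notin> h ` W" using no by (auto simp: h_def)
    \<comment> \<open>\<open>\<sigma>\<close> is the common sign of the displacement
      \<open>h\<close> on \<open>W\<close>.\<close>
    define \<sigma> :: real where "\<sigma> = (if h x > 0 then 1 else -1)"
    have \<sigma>: "\<sigma> * h t > 0" if "t \<in> W" for t
    proof (rule ccontr)
      have ne: "h t \<noteq> 0" "h x \<noteq> 0" using h0 that xU W(3) by force+
      assume "\<not> \<sigma> * h t > 0"
      with ne have "0 \<in> {h t..h x} \<or> 0 \<in> {h x..h t}" by (auto simp: \<sigma>_def split: if_splits)
      moreover have "h t \<in> h ` W" "h x \<in> h ` W" using that xU W(3) by auto
      ultimately show False using connected_contains_Icc[OF con] h0 by blast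
    qed
    define d where "d = \<sigma> * h x"
    have "d > 0" using \<sigma> xU W(3) by (auto simp: d_def)
    obtain c where c: "c > 0" "\<And>y. y \<in> nhd x c \<Longrightarrow> \<bar>(f ^^ p) y - (f ^^ p) x\<bar> < d / 2"
      using funpow_cont_at[OF xab, of "d / 2" p] \<open>d > 0\<close> by auto
    define e' where "e' = min e (min c (d / 2))"
    have "e' > 0" using \<open>e > 0\<close> c \<open>d > 0\<close> by (simp add: e'_def)
    then obtain j where j: "j \<ge> 1" "(f ^^ j) ` nhd x e' \<inter> nhd x e' \<noteq> {}"
      using x unfolding nonwandering_iff by blast
    then obtain y where y: "y \<in> nhd x e'" "(f ^^ j) y \<in> nhd x e'" by blast
    have sub: "nhd x e' \<subseteq> nhd x e" "nhd x e' \<subseteq> nhd x c" by (auto simp: e'_def intro!: nhd_mono)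
    have yW: "y \<in> W" "(f ^^ j) y \<in> W" using y sub(1) W(3) by blast+
    then have "p dvd j" using W(6)[of j] by blast
    then obtain i where i: "j = p * i" by auto
    with j obtain i' where i': "i = Suc i'" by (cases i) auto
    have in': "(f ^^ (p * k)) y \<in> W" for k using yW W(5) by (induction k) (auto simp: funpow_add)
    have "\<sigma> * (f ^^ p) y \<le> \<sigma> * (f ^^ (p * Suc k)) y" for k
    proof (induction k)
      case (Suc k)
      have "(f ^^ (p * Suc (Suc k))) y = (f ^^ p) ((f ^^ (p * Suc k)) y)"
        by (simp only: mult_Suc_right[of p "Suc k"] funpow_add comp_apply)
      then have "\<sigma> * (f ^^ (p * Suc k)) y \<le> \<sigma> * (f ^^ (p * Suc (Suc k))) y"
        using \<sigma>[OF in'[of "Suc k"]] unfolding h_def by (simp add: right_diff_distrib)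
      then show ?case using Suc by linarith
    qed simp
    then have "\<sigma> * (f ^^ p) y \<le> \<sigma> * (f ^^ j) y" using i i' by simp
    moreover have "\<bar>(f ^^ p) y - (f ^^ p) x\<bar> < d / 2" using c(2) sub(2) y(1) by blast
    moreover have "\<bar>(f ^^ j) y - x\<bar> < d / 2" using y(2) by (auto simp: mem_nhd e'_def)
    ultimately show False by (auto simp: d_def h_def \<sigma>_def abs_if split: if_splits)
  qed
  then obtain z where z: "z \<in> W" "(f ^^ p) z = z" by blast
  have per: "min_period f z p"
    unfolding min_period_def
  proof (intro conjI allI impI)
    fix i assume i: "1 \<le> i \<and> i < p"
    show "(f ^^ i) z \<noteq> z"
    proof
      assume "(f ^^ i) z = z"
      then have "p dvd i" using W(6)[of i] z(1) by (metis IntI empty_iff imageI)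
      then show False using i by (auto dest: dvd_imp_le)
    qed
  qed (use z W(1) in auto)
  obtain i u where iu: "u \<in> nhd x e" "z = (f ^^ i) u" using z(1) W(4) by (auto simp: orb_def)
  then have "p dvd i" using W(3) W(6)[of i] z(1) by blast
  then obtain i0 where i0: "i = p * i0" by auto
  have "z \<in> (f ^^ (p * k)) ` nhd x e" if "k \<ge> i0" for k
  proof -
    have "p * k = p * (k - i0) + i" using that i0 by (simp flip: distrib_left)
    then have "(f ^^ (p * k)) u = z"
      using iu(2) funpow_fix_mult[OF z(2), of "k - i0"] by (simp add: funpow_add)
    then show ?thesis using iu(1) by blast
  qed
  then show thesis using that[of z i0] per z(1) Wab by blast
qed

text \<open>The limit set of a whole set: the points approached by the images of \<open>S\<close> at
  arbitrarily late times \<open>r * i\<close>. Starting from a set rather than a point makes it an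
  interval when \<open>S\<close> is connected and the late images share a point.\<close>

definition omega :: "nat \<Rightarrow> real set \<Rightarrow> real set" where
  "omega r S = (\<Inter>N. closure (\<Union>i\<in>{N..}. (f ^^ (r * i)) ` S))"

text \<open>The inclusion from right to left is compactness: the fibres of \<open>y\<close> in the
  decreasing closures are nonempty, compact and nested, so they share a point.\<close>

lemma image_Inter_closure:
  fixes g :: "real \<Rightarrow> real"
  assumes g: "continuous_on {a..b} g" and A: "\<And>N. A N \<subseteq> {a..b}" "\<And>N. A (Suc N) \<subseteq> A N"
  shows "g ` (\<Inter>N::nat. closure (A N)) = (\<Inter>N. closure (g ` A N))"
proof
  have cl: "closure (A N) \<subseteq> {a..b}" for N using A(1) by (simp add: closure_minimal)
  have gcl: "closure (g ` A N) = g ` closure (A N)" for N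
  proof
    have *: "compact (g ` closure (A N))"
      by (rule compact_continuous_image[OF continuous_on_subset[OF g cl]])
        (metis cl bounded_closed_interval bounded_subset closed_closure compact_eq_bounded_closed)
    then show "closure (g ` A N) \<subseteq> g ` closure (A N)"
      using compact_imp_closed[OF *] by (intro closure_minimal image_mono closure_subset)
    show "g ` closure (A N) \<subseteq> closure (g ` A N)"
      by (rule image_closure_subset[OF continuous_on_subset[OF g cl]]) (auto simp: closure_subset)
  qed
  show "g ` (\<Inter>N. closure (A N)) \<subseteq> (\<Inter>N. closure (g ` A N))" using gcl by blast
  show "(\<Inter>N. closure (g ` A N)) \<subseteq> g ` (\<Inter>N. closure (A N))"
  proof
    fix y assume y: "y \<in> (\<Inter>N. closure (g ` A N))"
    define C where "C N = {t \<in> closure (A N). g t = y}" for N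
    have "closed (C N)" for N unfolding C_def
      by (rule continuous_closed_preimage_constant[OF continuous_on_subset[OF g cl]]) simp
    moreover have "C N \<subseteq> {a..b}" for N using cl by (auto simp: C_def)
    ultimately have comp: "compact (C N)" for N
      by (metis bounded_closed_interval bounded_subset compact_eq_bounded_closed)
    have ne: "C N \<noteq> {}" for N
    proof -
      have "y \<in> g ` closure (A N)" using y gcl by blast
      then show ?thesis by (auto simp: C_def)
    qed
    have dec: "C N \<subseteq> C M" if "M \<le> N" for M N
    proof -
      have "A N \<subseteq> A M" using that by (induction rule: dec_induct) (use A(2) in auto)
      then show ?thesis using closure_mono by (auto simp: C_def)
    qed
    have "(\<Inter>N. C N) \<noteq> {}" by (rule compact_nest[OF comp ne dec])
    then show "y \<in> g ` (\<Inter>N. closure (A N))" by (auto simp: C_def)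
  qed
qed

lemma omega_image:
  assumes "S \<subseteq> {a..b}" shows "(f ^^ c) ` omega r S = omega r ((f ^^ c) ` S)"
proof -
  have *: "(f ^^ c) ` (\<Union>i\<in>{N..}. (f ^^ (r * i)) ` S) = (\<Union>i\<in>{N..}. (f ^^ (r * i)) ` (f ^^ c) ` S)" for N
    unfolding image_UN image_comp funpow_add[symmetric] by (simp add: add.commute)
  have "(f ^^ c) ` omega r S = (\<Inter>N. closure ((f ^^ c) ` (\<Union>i\<in>{N..}. (f ^^ (r * i)) ` S)))"
    unfolding omega_def
  proof (rule image_Inter_closure[OF cont_funpow])
    show "(\<Union>i\<in>{N..}. (f ^^ (r * i)) ` S) \<subseteq> {a..b}" for N using assms funpow_in by blast
    show "(\<Union>i\<in>{Suc N..}. (f ^^ (r * i)) ` S) \<subseteq> (\<Union>i\<in>{N..}. (f ^^ (r * i)) ` S)" for N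
      by (rule UN_mono) auto
  qed
  then show ?thesis unfolding * omega_def .
qed

lemma omega_shift:
  assumes "S \<subseteq> {a..b}" shows "(f ^^ r) ` omega r S = omega r S"
proof -
  have *: "(f ^^ (r * i)) ` (f ^^ r) ` S = (f ^^ (r * Suc i)) ` S" for i
    unfolding image_comp funpow_add[symmetric] by (simp add: add.commute)
  have "(\<Union>i\<in>{N..}. (f ^^ (r * i)) ` (f ^^ r) ` S) = (\<Union>i\<in>{Suc N..}. (f ^^ (r * i)) ` S)" for N
  proof -
    have "y \<in> Suc ` {N..}" if "Suc N \<le> y" for y
      using that by (intro image_eqI[of _ _ "y - 1"]) auto
    then have "{Suc N..} = Suc ` {N..}" by auto
    then show ?thesis by (simp only: UN_simps(10) *)
  qed
  then have "omega r ((f ^^ r) ` S) = (\<Inter>N. closure (\<Union>i\<in>{Suc N..}. (f ^^ (r * i)) ` S))"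
    by (simp add: omega_def)
  also have "\<dots> = omega r S"
  proof
    show "omega r S \<subseteq> (\<Inter>N. closure (\<Union>i\<in>{Suc N..}. (f ^^ (r * i)) ` S))" unfolding omega_def by blast
    have "closure (\<Union>i\<in>{Suc N..}. (f ^^ (r * i)) ` S) \<subseteq> closure (\<Union>i\<in>{N..}. (f ^^ (r * i)) ` S)" for N
      by (intro closure_mono UN_mono) auto
    then show "(\<Inter>N. closure (\<Union>i\<in>{Suc N..}. (f ^^ (r * i)) ` S)) \<subseteq> omega r S" unfolding omega_def by blast
  qed
  finally show ?thesis using omega_image[OF assms] by simp
qed

lemma omega_subset:
  assumes "S \<subseteq> {a..b}" shows "omega r S \<subseteq> {a..b}"
proof -
  have "closure (\<Union>i\<in>{0..}. (f ^^ (r * i)) ` S) \<subseteq> {a..b}"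
    by (rule closure_minimal) (use assms funpow_in in auto)
  then show ?thesis unfolding omega_def by blast
qed

lemma omega_closed: "closed (omega r S)"
  by (auto simp: omega_def)

text \<open>All late images contain \<open>z\<close>, so the union over each tail from
  \<open>i0\<close> on is connected, and these tails determine the decreasing intersection.\<close>

lemma omega_interval:
  assumes S: "connected S" "S \<subseteq> {a..b}" and z: "\<And>i. i \<ge> i0 \<Longrightarrow> z \<in> (f ^^ (r * i)) ` S"
  shows "z \<in> omega r S" "is_interval (omega r S)"
proof -
  have zin: "z \<in> (\<Union>i\<in>{N..}. (f ^^ (r * i)) ` S)" for N
    using z[of "max i0 N"] by (auto intro!: bexI[of _ "max i0 N"])
  then show "z \<in> omega r S" unfolding omega_def using closure_subset by blast
  have con: "connected (\<Union>i\<in>{N..}. (f ^^ (r * i)) ` S)" if "N \<ge> i0" for N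
  proof (rule connected_Union)
    show "connected T" if "T \<in> (\<lambda>i. (f ^^ (r * i)) ` S) ` {N..}" for T
      using that S by (auto intro!: connected_continuous_image continuous_on_subset[OF cont_funpow])
    have "z \<in> \<Inter> ((\<lambda>i. (f ^^ (r * i)) ` S) ` {N..})" using z that by (intro INT_I) simp
    then show "\<Inter> ((\<lambda>i. (f ^^ (r * i)) ` S) ` {N..}) \<noteq> {}" by blast
  qed
  show "is_interval (omega r S)"
    unfolding is_interval_1
  proof (intro ballI allI impI)
    fix s t u assume st: "s \<in> omega r S" "t \<in> omega r S" "s \<le> u \<and> u \<le> t"
    have "u \<in> closure (\<Union>i\<in>{N..}. (f ^^ (r * i)) ` S)" for N
    proof -
      let ?C = "closure (\<Union>i\<in>{max i0 N..}. (f ^^ (r * i)) ` S)"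
      have "s \<in> ?C" "t \<in> ?C" using st by (auto simp: omega_def)
      moreover have "connected ?C" by (intro connected_imp_connected_closure con) simp
      ultimately have "u \<in> ?C" using connected_contains_Icc[of ?C s t] st(3) by auto
      moreover have "?C \<subseteq> closure (\<Union>i\<in>{N..}. (f ^^ (r * i)) ` S)"
        by (intro closure_mono UN_mono) auto
      ultimately show ?thesis by blast
    qed
    then show "u \<in> omega r S" by (simp add: omega_def)
  qed
qed

text \<open>Times fall into \<open>r\<close> residue classes. If \<open>x\<close> missed all
  \<open>r\<close> limit sets, a common radius \<open>e'\<close> and a common time bound would
  exclude late visits near \<open>x\<close> in every class.\<close>

lemma omega_cover:
  assumes "r \<ge> 1" and ret: "\<And>e' N. e' > 0 \<Longrightarrow> \<exists>i\<ge>N. (f ^^ i) ` S \<inter> nhd x e' \<noteq> {}"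
  shows "\<exists>c<r. x \<in> omega r ((f ^^ c) ` S)"
proof (rule ccontr)
  assume no: "\<not> ?thesis"
  have "\<exists>N e. e > 0 \<and> (\<forall>i\<ge>N. (f ^^ (r * i)) ` (f ^^ c) ` S \<inter> nhd x e = {})" if "c < r" for c
  proof -
    define D where "D N = (\<Union>i\<in>{N..}. (f ^^ (r * i)) ` (f ^^ c) ` S)" for N
    obtain N where N: "x \<notin> closure (D N)"
    proof -
      have "x \<notin> omega r ((f ^^ c) ` S)" using no \<open>c < r\<close> by metis
      then have "x \<notin> (\<Inter>N. closure (D N))" unfolding omega_def D_def .
      then show thesis using that by (metis INT_I)
    qed
    then obtain e where e: "e > 0" "\<And>y. y \<in> D N \<Longrightarrow> \<not> dist y x < e"
      unfolding closure_approachable by metis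
    have "(f ^^ (r * i)) ` (f ^^ c) ` S \<inter> nhd x e = {}" if "i \<ge> N" for i
    proof (rule ccontr)
      assume "\<not> ?thesis"
      then obtain y where y: "y \<in> (f ^^ (r * i)) ` (f ^^ c) ` S" "y \<in> nhd x e" by blast
      then have "y \<in> D N" unfolding D_def using \<open>i \<ge> N\<close> by blast
      then show False using e(2) y(2) by (simp add: mem_nhd dist_real_def)
    qed
    then show ?thesis using e(1) by blast
  qed
  then obtain N e where Ne: "\<And>c. c < r \<Longrightarrow> e c > 0"
    "\<And>c i. c < r \<Longrightarrow> i \<ge> N c \<Longrightarrow> (f ^^ (r * i)) ` (f ^^ c) ` S \<inter> nhd x (e c) = {}"
    by metis
  define e' where "e' = Min (e ` {..<r})"
  have "e ` {..<r} \<noteq> {}" using assms(1) by (auto simp: lessThan_empty_iff)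
  then have e': "e' > 0" "\<And>c. c < r \<Longrightarrow> e' \<le> e c" using Ne(1) by (auto simp: e'_def)
  \<comment> \<open>The sum dominates every \<open>N c\<close>, and the factor \<open>r\<close>
    makes \<open>i div r\<close> at least as large, whichever class \<open>i\<close> falls
    into.\<close>
  obtain i where i: "i \<ge> r * (\<Sum>c<r. N c)" "(f ^^ i) ` S \<inter> nhd x e' \<noteq> {}" using ret[OF e'(1)] by blast
  define c where "c = i mod r"
  have c: "c < r" using assms(1) by (simp add: c_def)
  have "N c \<le> (\<Sum>c<r. N c)" using c by (intro member_le_sum) auto
  also have "\<dots> \<le> i div r" using i(1) assms(1) by (simp add: less_eq_div_iff_mult_less_eq mult.commute)
  finally have "(f ^^ (r * (i div r))) ` (f ^^ c) ` S \<inter> nhd x (e c) = {}" by (rule Ne(2)[OF c])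
  also have "(f ^^ (r * (i div r))) ` (f ^^ c) ` S = (f ^^ i) ` S"
    unfolding image_comp funpow_add[symmetric] by (simp add: c_def)
  finally have "(f ^^ i) ` S \<inter> nhd x (e c) = {}" .
  then show False using i(2) nhd_mono[OF e'(2)[OF c], of x] by (metis Int_mono order_refl subset_empty)
qed

lemma omega_return:
  assumes x: "x \<in> omega r S" "S \<subseteq> {a..b}" and "e > 0"
  shows "\<exists>i\<ge>1. (f ^^ (r * i)) ` S \<inter> nhd x e \<noteq> {}"
proof -
  define D where "D = (\<Union>i\<in>{1..}. (f ^^ (r * i)) ` S)"
  have "x \<in> closure D" using x(1) unfolding omega_def D_def by (rule INT_D) simp
  then obtain y where y: "y \<in> D" "dist y x < e"
    using \<open>e > 0\<close> unfolding closure_approachable by metis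
  then obtain i where i: "i \<ge> 1" "y \<in> (f ^^ (r * i)) ` S" unfolding D_def by (metis UN_E atLeast_iff)
  then have "y \<in> {a..b}" using x(2) funpow_in by blast
  then have "y \<in> nhd x e" using y(2) by (simp add: mem_nhd dist_real_def)
  then show ?thesis using i by blast
qed

end

text \<open>The maximum \<open>u\<close> is followed two steps back, \<open>v2\<close> to
  \<open>v1\<close> to \<open>u\<close>, from a place where \<open>u\<close> lies in one interval
  but not in its predecessor. Each interval contains whatever lies between \<open>z\<close> and its
  points. If \<open>v1\<close> is not left of \<open>z\<close>, or if
  \<open>v1 \<le> v2 \<le> z\<close>, membership propagates one step at a time; if
  \<open>v2 < v1\<close>, the predecessor already contains \<open>u\<close>. In the remaining case
  \<open>v2\<close> lies right of \<open>z\<close>, membership of \<open>u\<close> propagates two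
  steps at a time, and for odd \<open>r\<close> this too reaches the predecessor.\<close>

lemma odd_cycle_top:
  fixes K :: "nat \<Rightarrow> real set" and f :: "real \<Rightarrow> real"
  assumes K: "\<And>c. is_interval (K c)" "\<And>c. z \<in> K c" "\<And>c. f ` K c = K (Suc c)" "\<And>c. K (c + r) = K c"
    and "odd r" and u: "u \<in> K c0" "\<And>c t. t \<in> K c \<Longrightarrow> t \<le> u"
  shows "u \<in> K c"
proof (rule ccontr)
  assume not_c: "u \<notin> K c"
  have zu: "z \<le> u" using K(2) u(2) by blast
  have r: "r \<ge> 1" using \<open>odd r\<close> by (cases r) auto
  have per: "K (c + r * n) = K c" for c n
  proof (induction n)
    case (Suc n)
    have "c + r * Suc n = (c + r * n) + r" by simp
    then show ?case using K(4) Suc by metis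
  qed simp
  have btw: "v \<in> K b" if "s \<in> K b" "t \<in> K b" "s \<le> v" "v \<le> t" for s t v b
    using K(1)[of b] that unfolding is_interval_1 by blast
  have "\<exists>c. u \<in> K (Suc c) \<and> u \<notin> K c"
  proof (rule ccontr)
    assume no: "\<not> ?thesis"
    have down: "u \<in> K (c + n) \<Longrightarrow> u \<in> K c" for n
      by (induction n) (use no in auto)
    have "u \<in> K (c0 + r * c)" using per u(1) by simp
    moreover have "c0 + r * c = c + (c0 + (r - 1) * c)" using r by (cases r) auto
    ultimately show False using down not_c by metis
  qed
  then obtain c1 where "u \<in> K (Suc c1)" "u \<notin> K c1" by blast
  \<comment> \<open>The index is shifted by one period to bring it into the form
    \<open>Suc (Suc d)\<close>, so that two preimages can be taken.\<close>
  then have "u \<in> K (Suc c1 + r)" "u \<notin> K (c1 + r)" by (simp_all only: K(4) not_False_eq_True)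
  moreover obtain r' where "r = Suc r'" using r by (cases r) auto
  ultimately obtain d where d: "u \<in> K (Suc (Suc d))" "u \<notin> K (Suc d)"
    by (metis add_Suc add_Suc_right)
  have up: False if "\<And>n. u \<in> K (Suc (Suc d) + n)"
    using that[of "r - 1"] r d(2) K(4)[of "Suc d"] by simp
  obtain v1 where v1: "v1 \<in> K (Suc d)" "f v1 = u" using d(1) K(3)[of "Suc d"] by (metis imageE)
  obtain v2 where v2: "v2 \<in> K d" "f v2 = v1" using v1(1) K(3)[of d] by (metis imageE)
  have bounds: "v1 \<le> u" "v2 \<le> u" using u(2) v1 v2 by blast+
  have B: "u \<in> K (Suc b)" if "v1 \<in> K b" for b using that K(3)[of b] v1(2) by blast
  have B2: "v1 \<in> K (Suc b)" if "v2 \<in> K b" for b using that K(3)[of b] v2(2) by blast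
  have "v1 < z"
  proof (rule ccontr)
    assume "\<not> v1 < z"
    then have "u \<in> K b \<Longrightarrow> u \<in> K (Suc b)" for b
      using B btw[OF K(2)[of b]] bounds by simp
    then have "u \<in> K (Suc (Suc d) + n)" for n using d(1) by (induction n) auto
    then show False by (rule up)
  qed
  have "\<not> (v1 \<le> v2 \<and> v2 \<le> z)"
  proof
    assume v: "v1 \<le> v2 \<and> v2 \<le> z"
    have "v1 \<in> K b \<Longrightarrow> v1 \<in> K (Suc b)" for b
      using B2 btw[OF _ K(2)[of b]] v by blast
    then have "v1 \<in> K (Suc d + n)" for n using v1(1) by (induction n) auto
    then have "u \<in> K (Suc (Suc d) + n)" for n using B[of "Suc d + n"] by simp
    then show False by (rule up)
  qed
  moreover have "\<not> v2 < v1"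
  proof
    assume "v2 < v1"
    then have "v1 \<in> K d" using btw[OF v2(1) K(2)] \<open>v1 < z\<close> by simp
    then show False using B d(2) by blast
  qed
  ultimately have "z < v2" by linarith
  then have step: "u \<in> K b \<Longrightarrow> u \<in> K (Suc (Suc b))" for b
    using B B2 btw[OF K(2)[of b], of u v2] bounds by simp
  have "u \<in> K (Suc (Suc d) + 2 * n)" for n
    using d(1) step by (induction n) auto
  moreover obtain j where "r = 2 * j + 1" using \<open>odd r\<close> by (rule oddE)
  ultimately have "u \<in> K (Suc d + r)" by (metis add_Suc add_Suc_right add.right_neutral Suc_eq_plus1)
  then show False using K(4) d(2) by blast
qed

section \<open>Non-wandering points of odd powers and of the square\<close>

context interval_map
begin

text \<open>The images \<open>L c\<close> of \<open>K\<close> form a cycle of odd length of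
  intervals through \<open>z\<close>. The topmost and, by reflection, the lowest point of their
  union lie in every \<open>L c\<close>, so all \<open>L c\<close> are the same interval.\<close>

lemma odd_power_invariant:
  assumes K: "closed K" "is_interval K" "K \<subseteq> {a..b}" "z \<in> K" "f z = z" and inv: "(f ^^ r) ` K = K" and "odd r"
  shows "f ` K = K"
proof -
  define L where "L c = (f ^^ c) ` K" for c
  have comp: "compact (L c)" for c
    unfolding L_def
    by (rule compact_continuous_image[OF continuous_on_subset[OF cont_funpow K(3)]])
      (metis K(1,3) bounded_closed_interval bounded_subset compact_eq_bounded_closed)
  have int: "is_interval (L c)" for c
    unfolding L_def is_interval_connected_1
    by (rule connected_continuous_image[OF continuous_on_subset[OF cont_funpow K(3)]])
      (simp add: K(2) flip: is_interval_connected_1)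
  have "(f ^^ c) z = z" for c using K(5) by (induction c) auto
  then have zL: "z \<in> L c" for c using K(4) unfolding L_def by (metis imageI)
  have step: "f ` L c = L (Suc c)" for c unfolding L_def by (simp add: image_comp)
  have per: "L (c + r) = L c" for c
    unfolding L_def funpow_add image_comp[symmetric] inv ..
  have r: "r \<ge> 1" using \<open>odd r\<close> by (cases r) auto
  have modr: "L c = L (c mod r)" for c
  proof (induction c rule: less_induct)
    case (less c)
    show ?case
    proof (cases "c < r")
      case False
      then have "L c = L (c - r)" using per[of "c - r"] by simp
      also have "\<dots> = L ((c - r) mod r)" using less[of "c - r"] False r by simp
      also have "(c - r) mod r = c mod r" using False by (simp add: le_mod_geq)
      finally show ?thesis .
    qed simp
  qed
  define S where "S = (\<Union>c<r. L c)"
  have inS: "L c \<subseteq> S" for c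
  proof -
    have "c mod r < r" using r by simp
    then show ?thesis unfolding S_def modr[of c] by blast
  qed
  have S: "compact S" using comp by (auto simp: S_def intro!: compact_UN)
  have ne: "S \<noteq> {}" using zL[of 0] inS[of 0] by blast
  obtain u where u: "u \<in> S" "\<And>t. t \<in> S \<Longrightarrow> t \<le> u" using compact_attains_sup[OF S ne] by blast
  obtain l where l: "l \<in> S" "\<And>t. t \<in> S \<Longrightarrow> l \<le> t" using compact_attains_inf[OF S ne] by blast
  obtain cu where cu: "u \<in> L cu" using u(1) by (auto simp: S_def)
  have top: "u \<in> L c" for c
    by (rule odd_cycle_top[of L z f r u cu]) (use int zL step per \<open>odd r\<close> u(2) inS cu in blast)+
  obtain cl where "l \<in> L cl" using l(1) by (auto simp: S_def)
  have "- l \<in> uminus ` L c" for c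
  proof (rule odd_cycle_top[of "\<lambda>c. uminus ` L c" "- z" "reflect f" r "- l" cl])
    show "is_interval (uminus ` L c)" for c using int by simp
    show "reflect f ` uminus ` L c = uminus ` L (Suc c)" for c by (simp add: reflect_image step)
    show "t \<le> - l" if "t \<in> uminus ` L c" for c t using that l(2) inS[of c] by force
  qed (use zL per \<open>odd r\<close> \<open>l \<in> L cl\<close> in auto)
  then have bot: "l \<in> L c" for c by force
  have "L c = {l..u}" for c
  proof
    show "L c \<subseteq> {l..u}" using inS[of c] u(2) l(2) by (meson atLeastAtMost_iff subsetD subsetI)
    show "{l..u} \<subseteq> L c" using int[of c] top[of c] bot[of c] unfolding is_interval_1 by (meson atLeastAtMost_iff subsetI)
  qed
  then have "L 1 = L 0" by metis
  then show ?thesis by (simp add: L_def)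
qed

text \<open>Returns happen only at multiples of \<open>p\<close>, and arbitrarily late because
  \<open>x\<close> is not periodic. So \<open>f ^^ p\<close> sees all of them, and it fixes
  \<open>z\<close>.\<close>

lemma return_structure:
  assumes x: "x \<in> nonwandering {a..b} f" and np: "\<And>d. d \<ge> 1 \<Longrightarrow> (f ^^ d) x \<noteq> x" and "e > 0"
  obtains p z i0 where "p \<ge> 1" "z \<in> {a..b}" "min_period f z p"
    "\<And>i. i \<ge> i0 \<Longrightarrow> z \<in> (f ^^ (p * i)) ` nhd x e"
    "\<And>i. (f ^^ i) ` nhd x e \<inter> nhd x e \<noteq> {} \<Longrightarrow> p dvd i"
    "\<And>e' N. e' > 0 \<Longrightarrow> \<exists>i\<ge>N. (f ^^ (p * i)) ` nhd x e \<inter> nhd x e' \<noteq> {}"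
proof -
  have xab: "x \<in> {a..b}" using x by (simp add: nonwandering_def)
  have xU: "x \<in> nhd x e" "nhd x e \<subseteq> {a..b}" using xab \<open>e > 0\<close> by (auto simp: mem_nhd)
  obtain i0 where i0: "i0 \<ge> 1" "(f ^^ i0) ` nhd x e \<inter> nhd x e \<noteq> {}"
    using x \<open>e > 0\<close> unfolding nonwandering_iff by blast
  obtain p W where W: "p \<ge> 1" "connected W" "nhd x e \<subseteq> W" "W \<subseteq> orb f (nhd x e)" "(f ^^ p) ` W \<subseteq> W"
      "\<And>i. (f ^^ i) ` W \<inter> W \<noteq> {} \<Longrightarrow> p dvd i"
    using return_component[OF connected_nhd xU(2,1) i0] by metis
  obtain z i1 where z: "z \<in> {a..b}" "min_period f z p" "\<And>i. i \<ge> i1 \<Longrightarrow> z \<in> (f ^^ (p * i)) ` nhd x e"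
    using return_fixed[OF x \<open>e > 0\<close> W] by blast
  have dv: "p dvd i" if "(f ^^ i) ` nhd x e \<inter> nhd x e \<noteq> {}" for i
    using W(3) W(6)[of i] that by blast
  have "\<exists>i\<ge>N. (f ^^ (p * i)) ` nhd x e \<inter> nhd x e' \<noteq> {}" if "e' > 0" for e' N
  proof -
    define e'' where "e'' = min e e'"
    have e'': "e'' > 0" "nhd x e'' \<subseteq> nhd x e" "nhd x e'' \<subseteq> nhd x e'"
      using that \<open>e > 0\<close> by (auto simp: e''_def intro!: nhd_mono)
    obtain j where j: "j \<ge> p * N" "(f ^^ j) ` nhd x e'' \<inter> nhd x e'' \<noteq> {}"
      using returns_unbounded[OF x np e''(1)] by blast
    then have "(f ^^ j) ` nhd x e \<inter> nhd x e \<noteq> {}" using e''(2) by blast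
    then obtain i where i: "j = p * i" using dv by blast
    then have "i \<ge> N" using j(1) W(1) by simp
    moreover have "(f ^^ (p * i)) ` nhd x e \<inter> nhd x e' \<noteq> {}" using j(2) e''(2,3) i by blast
    ultimately show ?thesis by blast
  qed
  with that[of p z i1] W(1) z dv show thesis by blast
qed

lemma wandering_power:
  assumes "x \<in> {a..b}" "x \<notin> nonwandering {a..b} (f ^^ r)" "r \<ge> 1"
  obtains e where "e > 0" "\<And>i. i \<ge> 1 \<Longrightarrow> (f ^^ (r * i)) ` nhd x e \<inter> nhd x e = {}"
    "\<And>d. d \<ge> 1 \<Longrightarrow> (f ^^ d) x \<noteq> x"
proof -
  interpret g: interval_map a b "f ^^ r" by (rule interval_map_funpow)
  obtain e where e: "e > 0" "\<And>i. i \<ge> 1 \<Longrightarrow> ((f ^^ r) ^^ i) ` nhd x e \<inter> nhd x e = {}"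
    using assms(1,2) unfolding g.nonwandering_iff by blast
  then have e': "(f ^^ (r * i)) ` nhd x e \<inter> nhd x e = {}" if "i \<ge> 1" for i
    using that by (simp add: funpow_mult mult.commute)
  have "(f ^^ d) x \<noteq> x" if "d \<ge> 1" for d
  proof
    assume "(f ^^ d) x = x"
    then have "(f ^^ (r * d)) x = x" using funpow_fix_mult by (metis mult.commute)
    moreover have "x \<in> nhd x e" using assms(1) e(1) by (simp add: mem_nhd)
    ultimately show False using e'[OF that] by (metis IntI empty_iff imageI)
  qed
  then show thesis using that[OF e(1)] e' by blast
qed

lemma nonwandering_odd_power:
  assumes "odd r"
  shows "nonwandering {a..b} f = nonwandering {a..b} (f ^^ r)"
proof
  have r: "r \<ge> 1" using \<open>odd r\<close> by (cases r) auto
  show "nonwandering {a..b} (f ^^ r) \<subseteq> nonwandering {a..b} f"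
    by (rule nonwandering_funpow_subset[OF r])
  show "nonwandering {a..b} f \<subseteq> nonwandering {a..b} (f ^^ r)"
  proof (rule subsetI, rule ccontr)
    fix x assume x: "x \<in> nonwandering {a..b} f" "x \<notin> nonwandering {a..b} (f ^^ r)"
    have xab: "x \<in> {a..b}" using x(1) by (simp add: nonwandering_def)
    obtain e where e: "e > 0" "\<And>i. i \<ge> 1 \<Longrightarrow> (f ^^ (r * i)) ` nhd x e \<inter> nhd x e = {}"
      "\<And>d. d \<ge> 1 \<Longrightarrow> (f ^^ d) x \<noteq> x"
      using wandering_power[OF xab x(2) r] by blast
    obtain p z i0 where p: "p \<ge> 1" "z \<in> {a..b}" "min_period f z p"
      "\<And>i. i \<ge> i0 \<Longrightarrow> z \<in> (f ^^ (p * i)) ` nhd x e"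
      "\<And>i. (f ^^ i) ` nhd x e \<inter> nhd x e \<noteq> {} \<Longrightarrow> p dvd i"
      "\<And>e' N. e' > 0 \<Longrightarrow> \<exists>i\<ge>N. (f ^^ (p * i)) ` nhd x e \<inter> nhd x e' \<noteq> {}"
      using return_structure[OF x(1) e(3,1)] by blast
    interpret g: interval_map a b "f ^^ p" by (rule interval_map_funpow)
    have gi: "(f ^^ p) ^^ i = f ^^ (p * i)" for i by (simp add: funpow_mult mult.commute)
    have Uab: "nhd x e \<subseteq> {a..b}" by (auto simp: mem_nhd)
    define K where "K = g.omega r (nhd x e)"
    have z: "z \<in> ((f ^^ p) ^^ (r * i)) ` nhd x e" if "i \<ge> i0" for i
    proof -
      have "i0 \<le> r * i" using that r by (metis le_trans mult_le_mono1 mult_1)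
      then show ?thesis using p(4) by (simp add: gi)
    qed
    note K = g.omega_interval[OF connected_nhd Uab z, folded K_def]
    have fz: "(f ^^ p) z = z" using p(3) by (simp add: min_period_def)
    \<comment> \<open>Oddness of \<open>r\<close> makes \<open>K\<close> invariant under
      \<open>f ^^ p\<close> itself. So the limit sets of all images of the neighbourhood under
      powers of \<open>f ^^ p\<close> coincide with \<open>K\<close>, and \<open>x\<close> lies in
      \<open>K\<close>.\<close>
    have inv: "(f ^^ p) ` K = K"
      by (rule g.odd_power_invariant[OF _ K(2) _ K(1) fz _ \<open>odd r\<close>])
        (simp_all add: K_def g.omega_closed g.omega_subset Uab g.omega_shift)
    have invc: "((f ^^ p) ^^ c) ` K = K" for c
    proof (induction c)
      case (Suc c)
      then show ?case using inv by (metis funpow.simps(2) image_comp)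
    qed simp
    obtain c where "x \<in> g.omega r (((f ^^ p) ^^ c) ` nhd x e)"
      using g.omega_cover[OF r, of "nhd x e" x] p(6) unfolding gi by blast
    then have "x \<in> K" using invc g.omega_image[OF Uab, of c r] unfolding K_def by simp
    then obtain i where i: "i \<ge> 1" "((f ^^ p) ^^ (r * i)) ` nhd x e \<inter> nhd x e \<noteq> {}"
      using g.omega_return[OF _ Uab e(1)] unfolding K_def by blast
    note i(2)
    moreover have "p * (r * i) = r * (p * i)" by simp
    moreover have "1 \<le> p * i" using p(1) \<open>i \<ge> 1\<close> by simp
    ultimately show False using e(2)[of "p * i"] unfolding gi by simp
  qed
qed

text \<open>With \<open>m\<close> a second preimage of \<open>x = max K1\<close>, either some point left of \<open>m\<close> completes a
  horseshoe for \<open>f ^^ 2\<close>, or an interval \<open>{c'..x}\<close> traps the orbits of a neighbourhood of \<open>x\<close> and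
  keeps them away from the fixed points.\<close>

lemma swap_horseshoe_left:
  assumes K: "is_interval K0" "is_interval K1" "closed K0" "K0 \<subseteq> {a..b}" "K1 \<subseteq> {a..b}" "f ` K0 = K1" "f ` K1 = K0"
    and x: "x \<in> K1" "x \<notin> K0" and z: "z \<in> K0" "z \<in> K1" "f z = z" "z < x"
    and e: "e > 0" "\<And>i. i \<ge> 1 \<Longrightarrow> (f ^^ (2 * i)) ` nhd x e \<inter> nhd x e = {}"
    and ret: "\<And>e'. e' > 0 \<Longrightarrow> \<exists>i\<ge>1. (f ^^ i) ` nhd x e' \<inter> nhd x e' \<noteq> {}"
    and fix': "\<And>e'. e' > 0 \<Longrightarrow> e' \<le> e \<Longrightarrow> \<exists>z'. z' \<in> K0 \<and> z' \<in> K1 \<and> f z' = z' \<and> (\<exists>i. z' \<in> (f ^^ (2 * i)) ` nhd x e')"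
  shows "horseshoe a b (f ^^ 2)"
proof (rule ccontr)
  assume noh: "\<not> horseshoe a b (f ^^ 2)"
  define F where "F = f ^^ 2"
  interpret F: interval_map a b F unfolding F_def by (rule interval_map_funpow)
  have F2: "F t = f (f t)" for t by (simp add: F_def numeral_2_eq_2)
  have Fi: "f ^^ (2 * i) = F ^^ i" for i by (simp add: F_def funpow_mult mult.commute)
  have btw0: "v \<in> K0" if "s \<in> K0" "t \<in> K0" "s \<le> v" "v \<le> t" for s t v
    using K(1) that unfolding is_interval_1 by blast
  have btw1: "v \<in> K1" if "s \<in> K1" "t \<in> K1" "s \<le> v" "v \<le> t" for s t v
    using K(2) that unfolding is_interval_1 by blast
  have f0: "f t \<in> K1" if "t \<in> K0" for t using that K(6) by blast
  have f1: "f t \<in> K0" if "t \<in> K1" for t using that K(7) by blast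
  have xab: "x \<in> {a..b}" using x K by blast
  have xU: "x \<in> nhd x c" if "c > 0" for c using xab that by (simp add: mem_nhd)
  have Fx: "F x \<noteq> x" using e(2)[of 1] xU[OF e(1)] by (auto simp: F_def)
  have K0x: "t < x" if "t \<in> K0" for t
    using btw0[OF z(1) that, of x] z(4) x(2) by force
  \<comment> \<open>If \<open>K1\<close> extended beyond \<open>x\<close>, a small neighbourhood of
    \<open>x\<close> would lie in \<open>K1\<close> and miss \<open>K0\<close>. Its returns at odd
    times would land in \<open>K0\<close>, and returns at even times are excluded.\<close>
  have K1x: "s \<le> x" if s: "s \<in> K1" for s
  proof (rule ccontr)
    assume sx: "\<not> s \<le> x"
    obtain c where c: "c > 0" "\<And>t. \<bar>t - x\<bar> < c \<Longrightarrow> t \<notin> K0"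
    proof -
      have "open (- K0)" using K(3) by (rule open_Compl)
      then obtain c where "c > 0" "\<forall>t. dist t x < c \<longrightarrow> t \<in> - K0" using x(2) unfolding open_dist by blast
      then show thesis using that[of c] by (auto simp: dist_real_def)
    qed
    define e' where "e' = min (min e c) (min (s - x) (x - z))"
    have e': "e' > 0" "e' \<le> e" "e' \<le> c" "e' \<le> s - x" "e' \<le> x - z" using e(1) c(1) sx z(4) by (auto simp: e'_def)
    obtain i where i: "i \<ge> 1" "(f ^^ i) ` nhd x e' \<inter> nhd x e' \<noteq> {}" using ret[OF e'(1)] by blast
    then obtain y where y: "y \<in> nhd x e'" "(f ^^ i) y \<in> nhd x e'" by blast
    have "y \<in> K1" by (rule btw1[OF z(2) s]) (use y(1) e' in \<open>auto simp: mem_nhd\<close>)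
    have odd': "(f ^^ Suc (2 * j)) y \<in> K0" for j
      using \<open>y \<in> K1\<close> f0 f1 by (induction j) auto
    show False
    proof (cases "even i")
      case True
      then obtain j where "i = 2 * j" by auto
      then show False using e(2)[of j] i nhd_mono[OF e'(2), of x] by fastforce
    next
      case False
      then obtain j where "i = Suc (2 * j)" by (auto elim: oddE)
      then have "(f ^^ i) y \<in> K0" using odd' by simp
      then show False using c(2) y(2) e'(3) by (force simp: mem_nhd)
    qed
  qed
  obtain v1 where v1: "v1 \<in> K0" "f v1 = x" using x(1) K(6) by (metis imageE)
  obtain m where m: "m \<in> K1" "f m = v1" using v1(1) K(7) by (metis imageE)
  have Fm: "F m = x" using m v1 by (simp add: F2)
  \<comment> \<open>A common point \<open>\<zeta>\<close> at or right of \<open>m\<close> would put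
    \<open>v1\<close> into \<open>K1\<close>, and then \<open>x = f v1\<close> into
    \<open>K0\<close>.\<close>
  have m_gt: "\<zeta> < m" if \<zeta>: "\<zeta> \<in> K0" "\<zeta> \<in> K1" for \<zeta>
  proof -
    have "v1 < \<zeta>"
      using btw1[OF \<zeta>(2) x(1), of v1] K0x[OF v1(1)] f1[of v1] v1(2) x(2) by force
    show ?thesis
    proof (rule ccontr)
      assume n: "\<not> \<zeta> < m"
      show False
      proof (cases "v1 \<le> m")
        case True
        then have "m \<in> K0" using btw0[OF v1(1) \<zeta>(1)] n by simp
        then show False using f0 f1 m v1 x(2) by metis
      next
        case False
        then have "v1 \<in> K1" using btw1[OF m(1) \<zeta>(2)] \<open>v1 < \<zeta>\<close> by simp
        then show False using f1 v1 x(2) by metis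
      qed
    qed
  qed
  have zm: "z < m" using m_gt z by blast
  have mx: "m < x" using K1x[OF m(1)] Fx Fm by (cases "m = x") auto
  have ab: "m \<in> {a..b}" "z \<in> {a..b}" using m z K by blast+
  have cF: "continuous_on {s..t} F" if "a \<le> s" "t \<le> b" for s t
    by (rule continuous_on_subset[OF F.cont]) (use that in auto)
  \<comment> \<open>\<open>q\<close> minimises \<open>F\<close> on \<open>[m, x]\<close>. A point
    \<open>p < m\<close> with \<open>c \<le> p\<close> and \<open>F p \<le> p\<close> would complete
    a horseshoe \<open>p < m < q\<close>, so \<open>F\<close> moves all such points to the
    right.\<close>
  have "\<exists>q\<in>{m..x}. \<forall>t\<in>{m..x}. F q \<le> F t"
    by (rule continuous_attains_inf) (use mx cF ab xab in auto)
  then obtain q where q: "q \<in> {m..x}" "\<And>t. t \<in> {m..x} \<Longrightarrow> F q \<le> F t" by blast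
  define c where "c = F q"
  have nop: "p < F p" if "c \<le> p" "p < m" "p \<in> {a..b}" for p
  proof (rule ccontr)
    assume "\<not> p < F p"
    moreover have "m < q" using q(1) Fm that mx by (cases "q = m") (auto simp: c_def)
    ultimately have "horseshoe a b F"
      unfolding horseshoe_def using that q(1) ab xab Fm
      by (intro bexI[of _ p] bexI[of _ m] bexI[of _ q]) (auto simp: c_def)
    then show False using noh by (simp add: F_def)
  qed
  have zc: "z < c" using nop[of z] zm ab z(3) by (force simp: F2)
  define c0 where "c0 = min c m"
  have c0: "z < c0" "c0 \<le> m" "c0 \<le> c" using zc zm by (auto simp: c0_def)
  have nop': "p < F p" if "c0 \<le> p" "p \<le> m" for p
    using nop[of p] that Fm mx c0 ab by (cases "p = m") (auto simp: c0_def min_def split: if_splits)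
  have c0ab: "c0 \<in> {a..b}" using c0 ab by auto
  obtain \<delta> where \<delta>: "\<delta> > 0" "\<And>t. t \<in> nhd c0 \<delta> \<Longrightarrow> \<bar>F t - F c0\<bar> < F c0 - c0"
  proof -
    have "F c0 - c0 > 0" using nop'[of c0] c0 by simp
    then show thesis using F.funpow_cont_at[OF c0ab, of "F c0 - c0" 1] that by auto
  qed
  \<comment> \<open>Strictness at \<open>c0\<close> leaves room to go slightly below it. Then
    \<open>F\<close> maps \<open>[c', x]\<close> into itself with values above \<open>c'\<close>,
    and by continuity points near \<open>x\<close> also land above \<open>c'\<close>.\<close>
  define c' where "c' = max z (c0 - \<delta> / 2)"
  have c': "z \<le> c'" "c' < c0" using c0 \<delta>(1) by (auto simp: c'_def)
  have below: "t < F t" if "c' \<le> t" "t \<le> m" for t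
  proof (cases "c0 \<le> t")
    case False
    then have "t \<in> nhd c0 \<delta>" using that c0ab ab \<delta>(1) by (auto simp: mem_nhd c'_def)
    then show ?thesis using \<delta>(2) False by fastforce
  qed (use nop' that in auto)
  have trap: "c' < F t \<and> F t \<le> x" if "t \<in> {c'..x}" for t
  proof
    show "c' < F t"
    proof (cases "t \<le> m")
      case True
      then show ?thesis using below[of t] that by simp
    next
      case False
      then show ?thesis using q(2)[of t] that c' c0 by (simp add: c_def)
    qed
    have "t \<in> K1" using btw1[OF z(2) x(1)] that c' by simp
    then show "F t \<le> x" using K1x f0 f1 by (simp add: F2)
  qed
  have xc': "c' < x" using c' c0 mx by simp
  have "F x - c' > 0" using trap[of x] xc' by simp
  then obtain \<epsilon> where \<epsilon>: "\<epsilon> > 0" "\<And>t. t \<in> nhd x \<epsilon> \<Longrightarrow> \<bar>F t - F x\<bar> < F x - c'"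
    using F.funpow_cont_at[OF xab, of "F x - c'" 1] by auto
  define e' where "e' = min (min e \<epsilon>) (x - c')"
  have e': "e' > 0" "e' \<le> e" "e' \<le> \<epsilon>" "e' \<le> x - c'" using e(1) \<epsilon>(1) xc' by (auto simp: e'_def)
  have FE: "F y \<in> {c'..x}" if y: "y \<in> nhd x e'" for y
  proof -
    have "y \<in> nhd x \<epsilon>" using y nhd_mono[OF e'(3)] by blast
    then have "c' < F y" using \<epsilon>(2) by fastforce
    \<comment> \<open>A value \<open>F y \<ge> x\<close> would make \<open>x\<close> itself a value
      of \<open>F\<close> near \<open>x\<close>, which is a return at the even time 2.\<close>
    moreover have "F y < x"
    proof (rule ccontr)
      assume n: "\<not> F y < x"
      have "connected (F ` nhd x e')"
        by (rule connected_continuous_image[OF continuous_on_subset[OF F.cont] connected_nhd]) (auto simp: nhd_def)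
      moreover have "F x \<in> F ` nhd x e'" "F y \<in> F ` nhd x e'" using xU[OF e'(1)] y by blast+
      ultimately have "{F x..F y} \<subseteq> F ` nhd x e'" by (rule connected_contains_Icc)
      moreover have "x \<in> {F x..F y}" using n trap[of x] xc' by simp
      ultimately have "x \<in> F ` nhd x e" using nhd_mono[OF e'(2), of x] by blast
      then show False using e(2)[of 1] xU[OF e(1)] unfolding F_def by (metis IntI empty_iff mult_1_right order_refl)
    qed
    ultimately show ?thesis by simp
  qed
  \<comment> \<open>The trapped images contain a fixed point \<open>z'\<close>. It is left of
    \<open>m\<close> and not left of \<open>c'\<close>, but \<open>F\<close> moves every point of
    \<open>[c', m]\<close> to the right.\<close>
  obtain z' i where z': "z' \<in> K0" "z' \<in> K1" "f z' = z'" "z' \<in> (F ^^ i) ` nhd x e'"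
    using fix'[OF e'(1,2)] unfolding Fi by blast
  then obtain y where y: "y \<in> nhd x e'" "z' = (F ^^ i) y" by blast
  have "z' > c' \<or> z' \<in> {c'..x}"
  proof (cases i)
    case 0
    then show ?thesis using y e'(4) by (auto simp: mem_nhd)
  next
    case (Suc j)
    have "(F ^^ Suc j) y \<in> {c'..x}"
    proof (induction j)
      case (Suc j)
      then show ?case using trap[of "(F ^^ Suc j) y"] by simp
    qed (use FE y in simp)
    then show ?thesis using y Suc by simp
  qed
  then have "z' < F z'" using below[of z'] m_gt[OF z'(1,2)] by auto
  then show False using z'(3) by (simp add: F2)
qed

lemma nonwandering_square:
  assumes nodd: "\<And>q. q \<in> cycle_periods {a..b} f \<Longrightarrow> odd q \<Longrightarrow> q = 1"
    and n3: "3 \<notin> cycle_periods {a..b} (f ^^ 2)"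
  shows "nonwandering {a..b} f = nonwandering {a..b} (f ^^ 2)"
proof
  show "nonwandering {a..b} (f ^^ 2) \<subseteq> nonwandering {a..b} f"
    by (rule nonwandering_funpow_subset) simp
  show "nonwandering {a..b} f \<subseteq> nonwandering {a..b} (f ^^ 2)"
  proof (rule subsetI, rule ccontr)
    fix x assume x: "x \<in> nonwandering {a..b} f" "x \<notin> nonwandering {a..b} (f ^^ 2)"
    have xab: "x \<in> {a..b}" using x(1) by (simp add: nonwandering_def)
    obtain e where e: "e > 0" "\<And>i. i \<ge> 1 \<Longrightarrow> (f ^^ (2 * i)) ` nhd x e \<inter> nhd x e = {}"
      "\<And>d. d \<ge> 1 \<Longrightarrow> (f ^^ d) x \<noteq> x"
      using wandering_power[OF xab x(2)] by auto
    have ret: "\<exists>i\<ge>1. (f ^^ i) ` nhd x e' \<inter> nhd x e' \<noteq> {}" if "e' > 0" for e'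
      using x(1) that unfolding nonwandering_iff by blast
    have struct: "\<exists>z i0. z \<in> {a..b} \<and> f z = z \<and> (\<forall>i\<ge>i0. z \<in> (f ^^ i) ` nhd x e') \<and>
        (\<forall>\<epsilon>>0. \<forall>N. \<exists>i\<ge>N. (f ^^ i) ` nhd x e' \<inter> nhd x \<epsilon> \<noteq> {})"
      if e': "e' > 0" "e' \<le> e" for e'
    proof -
      obtain p z i0 where p: "p \<ge> 1" "z \<in> {a..b}" "min_period f z p"
        "\<And>i. i \<ge> i0 \<Longrightarrow> z \<in> (f ^^ (p * i)) ` nhd x e'"
        "\<And>i. (f ^^ i) ` nhd x e' \<inter> nhd x e' \<noteq> {} \<Longrightarrow> p dvd i"
        "\<And>\<epsilon> N. \<epsilon> > 0 \<Longrightarrow> \<exists>i\<ge>N. (f ^^ (p * i)) ` nhd x e' \<inter> nhd x \<epsilon> \<noteq> {}"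
        using return_structure[OF x(1) e(3) e'(1)] by blast
      \<comment> \<open>All return times of this neighbourhood are multiples of \<open>p\<close> and
        none is even, so \<open>p\<close> is odd; being a period of \<open>f\<close>, it is
        1.\<close>
      have "odd p"
      proof
        assume "even p"
        obtain i where i: "i \<ge> 1" "(f ^^ i) ` nhd x e' \<inter> nhd x e' \<noteq> {}" using ret[OF e'(1)] by blast
        then have "even i" using p(5) \<open>even p\<close> dvd_trans by blast
        then obtain j where "i = 2 * j" by auto
        then show False using e(2)[of j] i nhd_mono[OF e'(2), of x] by fastforce
      qed
      moreover have "p \<in> cycle_periods {a..b} f" using p(2,3) unfolding cycle_periods_iff by blast
      ultimately have "p = 1" using nodd by blast
      then have "z \<in> {a..b} \<and> f z = z \<and> (\<forall>i\<ge>i0. z \<in> (f ^^ i) ` nhd x e') \<and>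
        (\<forall>\<epsilon>>0. \<forall>N. \<exists>i\<ge>N. (f ^^ i) ` nhd x e' \<inter> nhd x \<epsilon> \<noteq> {})"
        using p(2,4,6) p(3) by (simp add: min_period_def)
      then show ?thesis by blast
    qed
    have Uab: "nhd x e \<subseteq> {a..b}" "f ` nhd x e \<subseteq> {a..b}" using maps by (auto simp: mem_nhd)
    have conf: "connected (f ` nhd x e)"
      by (rule connected_continuous_image[OF continuous_on_subset[OF cont Uab(1)] connected_nhd])
    \<comment> \<open>\<open>K0\<close> collects the even times and \<open>K1\<close> the odd times.
      \<open>x\<close> lies in \<open>K1\<close> only, since a limit at even times would give an
      even return.\<close>
    define K0 where "K0 = omega 2 (nhd x e)"
    define K1 where "K1 = omega 2 (f ` nhd x e)"
    have K01: "f ` K0 = K1" using omega_image[OF Uab(1), of 1 2] by (simp add: K0_def K1_def)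
    have "f ` K1 = (f ^^ 2) ` K0" unfolding K01[symmetric] by (simp add: numeral_2_eq_2 image_comp comp_def)
    then have K10: "f ` K1 = K0" using omega_shift[OF Uab(1), of 2] by (simp add: K0_def)
    have zK: "\<zeta> \<in> K0" "\<zeta> \<in> K1" "is_interval K0" "is_interval K1"
      if "\<And>i. i \<ge> i0 \<Longrightarrow> \<zeta> \<in> (f ^^ i) ` nhd x e" for \<zeta> i0
    proof -
      have 0: "\<zeta> \<in> (f ^^ (2 * i)) ` nhd x e" if "i \<ge> i0" for i
        using \<open>\<And>i. i \<ge> i0 \<Longrightarrow> \<zeta> \<in> (f ^^ i) ` nhd x e\<close>[of "2 * i"] that by simp
      have 1: "\<zeta> \<in> (f ^^ (2 * i)) ` f ` nhd x e" if "i \<ge> i0" for i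
        using \<open>\<And>i. i \<ge> i0 \<Longrightarrow> \<zeta> \<in> (f ^^ i) ` nhd x e\<close>[of "Suc (2 * i)"] that
        by (simp add: image_comp funpow_Suc_right del: funpow.simps(2))
      show "\<zeta> \<in> K0" "\<zeta> \<in> K1" "is_interval K0" "is_interval K1"
        using omega_interval[OF connected_nhd Uab(1) 0] omega_interval[OF conf Uab(2) 1]
        by (simp_all add: K0_def K1_def)
    qed
    obtain z i0 where z: "z \<in> {a..b}" "f z = z" "\<And>i. i \<ge> i0 \<Longrightarrow> z \<in> (f ^^ i) ` nhd x e"
      "\<And>\<epsilon> N. \<epsilon> > 0 \<Longrightarrow> \<exists>i\<ge>N. (f ^^ i) ` nhd x e \<inter> nhd x \<epsilon> \<noteq> {}"
      using struct[OF e(1)] by blast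
    have xK0: "x \<notin> K0" using omega_return[OF _ Uab(1) e(1), of x 2] e(2) unfolding K0_def by blast
    have xK1: "x \<in> K1"
    proof -
      obtain c where c: "c < 2" "x \<in> omega 2 ((f ^^ c) ` nhd x e)"
        using omega_cover[of 2 "nhd x e" x] z(4) by auto
      then show ?thesis using xK0 by (cases c) (auto simp: K0_def K1_def less_2_cases_iff)
    qed
    \<comment> \<open>Each smaller neighbourhood has a fixed point \<open>z'\<close> of its own. Its
      images lie in those of the large neighbourhood, so \<open>z'\<close> is in the same
      \<open>K0\<close> and \<open>K1\<close>.\<close>
    have fix': "\<exists>z'. z' \<in> K0 \<and> z' \<in> K1 \<and> f z' = z' \<and> (\<exists>i. z' \<in> (f ^^ (2 * i)) ` nhd x e')"
      if e': "e' > 0" "e' \<le> e" for e'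
    proof -
      obtain z' j where z': "f z' = z'" "\<And>i. i \<ge> j \<Longrightarrow> z' \<in> (f ^^ i) ` nhd x e'"
        using struct[OF e'] by blast
      then have "z' \<in> (f ^^ i) ` nhd x e" if "i \<ge> j" for i using that nhd_mono[OF e'(2)] by blast
      moreover have "z' \<in> (f ^^ (2 * j)) ` nhd x e'" using z'(2) by simp
      ultimately show ?thesis using zK(1,2) z'(1) by blast
    qed
    have cl: "closed K0" and sub: "K0 \<subseteq> {a..b}" "K1 \<subseteq> {a..b}"
      using omega_closed omega_subset Uab by (auto simp: K0_def K1_def)
    have int: "is_interval K0" "is_interval K1" "z \<in> K0" "z \<in> K1" using zK z(3) by blast+
    have "horseshoe a b (f ^^ 2)"
    proof (cases "z < x")
      case True
      show ?thesis
        by (rule swap_horseshoe_left[OF int(1,2) cl sub K01 K10 xK1 xK0 int(3,4) z(2) True e(1,2) ret fix'])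
    next
      case False
      have "z \<noteq> x" using e(3)[of 1] z(2) by auto
      then have "- z < - x" using False by simp
      interpret r: interval_map "- b" "- a" "reflect f" by (rule interval_map_reflect) unfold_locales
      have nhd: "r.nhd (- x) c = uminus ` nhd x c" for c
        by (force simp: r.mem_nhd mem_nhd image_iff intro!: bexI[of _ "- _"])
      have img: "(reflect f ^^ i) ` uminus ` S = uminus ` (f ^^ i) ` S" for i S
        by (simp add: reflect_funpow reflect_image)
      have meet: "uminus ` A \<inter> uminus ` B = {} \<longleftrightarrow> A \<inter> B = {}" for A B :: "real set" by auto
      have "horseshoe (- b) (- a) (reflect f ^^ 2)"
      proof (rule r.swap_horseshoe_left[of "uminus ` K0" "uminus ` K1" "- x" "- z" e])
        show "\<exists>z'. z' \<in> uminus ` K0 \<and> z' \<in> uminus ` K1 \<and> reflect f z' = z' \<and>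
            (\<exists>i. z' \<in> (reflect f ^^ (2 * i)) ` r.nhd (- x) e')" if e': "e' > 0" "e' \<le> e" for e'
        proof -
          obtain z' i where "z' \<in> K0" "z' \<in> K1" "f z' = z'" "z' \<in> (f ^^ (2 * i)) ` nhd x e'"
            using fix'[OF e'] by blast
          then show ?thesis unfolding nhd img
            by (intro exI[of _ "- z'"] conjI exI[of _ i]) (auto simp: reflect_def)
        qed
        show "(reflect f ^^ (2 * i)) ` r.nhd (- x) e \<inter> r.nhd (- x) e = {}" if "i \<ge> 1" for i
          unfolding nhd img meet by (rule e(2)[OF that])
        show "\<exists>i\<ge>1. (reflect f ^^ i) ` r.nhd (- x) e' \<inter> r.nhd (- x) e' \<noteq> {}" if "e' > 0" for e'
          unfolding nhd img meet by (rule ret[OF that])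
        show "uminus ` K0 \<subseteq> {- b..- a}" "uminus ` K1 \<subseteq> {- b..- a}" using sub by auto
        show "closed (uminus ` K0)" using cl by (rule closed_negations)
        show "reflect f ` uminus ` K0 = uminus ` K1" "reflect f ` uminus ` K1 = uminus ` K0"
          by (simp_all only: reflect_image K01 K10)
        show "reflect f (- z) = - z" using z(2) by (simp add: reflect_def)
      qed (use int xK0 xK1 \<open>- z < - x\<close> e(1) in auto)
      then show ?thesis by (simp add: reflect_funpow horseshoe_reflect)
    qed
    then show False
      using interval_map.horseshoe_period_3[OF interval_map_funpow] n3 by blast
  qed
qed

end

section \<open>Basic sets\<close>

text \<open>\<open>A\<close> and \<open>B\<close> say that neither \<open>[\<alpha>, d]\<close> nor
  \<open>[c, b]\<close> is a trap. They yield a peak \<open>m1\<close> and a point \<open>q\<close>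
  with \<open>h q < m \<le> m1 < q \<le> h m1\<close>. If the peak is lower than \<open>b\<close>,
  \<open>A\<close> at the height \<open>h m1\<close> gives the third point of a mirrored horseshoe,
  right of \<open>q\<close>. If it reaches \<open>b\<close>, the third point lies left of
  \<open>m1\<close>: it is \<open>\<alpha>\<close>, or it comes from \<open>B\<close> at the least
  value of \<open>h\<close> on \<open>[m1, b]\<close>.\<close>

lemma horseshoe_from_expansion:
  fixes h :: "real \<Rightarrow> real"
  assumes cont: "continuous_on {\<alpha>..b} h" and \<alpha>: "h \<alpha> \<le> \<alpha>" and le_b: "\<And>t. t \<in> {\<alpha>..b} \<Longrightarrow> h t \<le> b"
    and A: "\<And>d. x1 < d \<Longrightarrow> d < b \<Longrightarrow> \<exists>t\<in>{\<alpha>..d}. d < h t"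
    and B: "\<And>c. \<alpha> < c \<Longrightarrow> c < x2 \<Longrightarrow> \<exists>t\<in>{c..b}. h t < c"
    and top: "\<exists>t\<in>{\<alpha>..b}. h t = b" and x: "\<alpha> < x1" "x1 < x2" "x2 < b"
  shows "horseshoe \<alpha> b h"
proof (rule ccontr)
  assume noh: "\<not> horseshoe \<alpha> b h"
  have cont': "continuous_on {s..t} h" if "\<alpha> \<le> s" "t \<le> b" for s t
    by (rule continuous_on_subset[OF cont]) (use that in auto)
  have argmax: "\<exists>m\<in>{\<alpha>..d}. \<forall>t\<in>{\<alpha>..d}. h t \<le> h m" if "\<alpha> \<le> d" "d \<le> b" for d
    by (rule continuous_attains_sup) (use that cont' in auto)
  \<comment> \<open>\<open>d\<close> lies between \<open>x1\<close> and \<open>x2\<close> so that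
    \<open>A\<close> can be used from \<open>d\<close> on and \<open>B\<close> up to
    \<open>d\<close>.\<close>
  obtain d where d: "x1 < d" "d < x2" using dense[OF x(2)] by blast
  obtain m where m: "m \<in> {\<alpha>..d}" "\<And>t. t \<in> {\<alpha>..d} \<Longrightarrow> h t \<le> h m" using argmax[of d] d x by auto
  have hm: "d < h m" using A[of d] m(2) d x by force
  have \<alpha>m: "\<alpha> < m" using m(1) hm \<alpha> d x by (cases "m = \<alpha>") auto
  obtain q where q: "q \<in> {m..b}" "h q < m" using B[of m] \<alpha>m m(1) d by auto
  have mq: "m < q" using q hm m(1) by (cases "q = m") auto
  define q' where "q' = max d q"
  have q': "d \<le> q'" "q \<le> q'" "q' \<le> b" using q d x by (auto simp: q'_def)
  obtain s where s: "s \<in> {\<alpha>..q'}" "\<And>t. t \<in> {\<alpha>..q'} \<Longrightarrow> h t \<le> h s" using argmax[of q'] q' d x by auto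
  \<comment> \<open>Among equal maxima \<open>m\<close> is preferred, which keeps the peak left of
    \<open>q\<close> when \<open>q' = d\<close>.\<close>
  define m1 where "m1 = (if h s = h m then m else s)"
  have hm1: "h t \<le> h m1" if "t \<in> {\<alpha>..q'}" for t using s(2)[OF that] by (auto simp: m1_def)
  have m1: "m1 \<in> {\<alpha>..q'}" using s m q' by (auto simp: m1_def)
  have mm1: "m \<le> m1"
  proof (rule ccontr)
    assume "\<not> m \<le> m1"
    then have "s \<in> {\<alpha>..d}" "h s \<noteq> h m" using s(1) m(1) by (auto simp: m1_def split: if_splits)
    then show False using m(2)[of s] s(2)[of m] m(1) q' by force
  qed
  have h_ge: "q' \<le> h m1"
  proof (cases "q' < b")
    case True
    then show ?thesis using A[of q'] hm1 d q' by force
  next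
    case False
    then show ?thesis using top hm1 q' by force
  qed
  have m1q: "m1 < q"
  proof (cases "q \<le> d")
    case True
    then have "q' = d" by (simp add: q'_def)
    then have "h s = h m" using m s by (metis antisym)
    then show ?thesis using mq by (simp add: m1_def)
  next
    case False
    then have "q' = q" by (simp add: q'_def)
    moreover have "m1 \<noteq> q" using h_ge q mq q' by auto
    ultimately show ?thesis using m1 by auto
  qed
  have in': "m1 \<in> {\<alpha>..b}" "q \<in> {\<alpha>..b}" using m1 q q' \<alpha>m by auto
  show False
  proof (cases "h m1 = b")
    case False
    have lt: "h m1 < b" using le_b[OF in'(1)] False by simp
    have below: "h t < t" if "q < t" "t \<le> h m1" for t
    proof (rule ccontr)
      assume "\<not> h t < t"
      then have "horseshoe \<alpha> b h"
        unfolding horseshoe_def using that in' lt m1q mm1 q(2)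
        by (intro bexI[of _ t] bexI[of _ q] bexI[of _ m1]) auto
      then show False using noh by simp
    qed
    obtain t where t: "t \<in> {\<alpha>..h m1}" "h m1 < h t" using A[of "h m1"] lt h_ge q' d by force
    show False
    proof (cases "t \<le> q")
      case True
      then show ?thesis using hm1[of t] t q' by auto
    next
      case False
      then show ?thesis using below[of t] t by auto
    qed
  next
    case True
    have "\<exists>r\<in>{m1..b}. \<forall>t\<in>{m1..b}. h r \<le> h t"
      by (rule continuous_attains_inf) (use in' cont' in auto)
    then obtain r where r: "r \<in> {m1..b}" "\<And>t. t \<in> {m1..b} \<Longrightarrow> h r \<le> h t" by blast
    have hr: "h r < m" using r(2)[of q] q m1q by force
    have m1r: "m1 < r" using r(1) True hr mm1 in' by (cases "r = m1") auto
    have above: "p < h p" if "\<alpha> \<le> p" "h r \<le> p" "p < m1" for p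
    proof (rule ccontr)
      assume "\<not> p < h p"
      then have "horseshoe \<alpha> b h"
        unfolding horseshoe_def using that in' m1r r(1) True
        by (intro bexI[of _ p] bexI[of _ m1] bexI[of _ r]) auto
      then show False using noh by simp
    qed
    have "\<alpha> < h r" using above[of \<alpha>] \<alpha> \<alpha>m mm1 by force
    then obtain t where t: "t \<in> {h r..b}" "h t < h r" using B[of "h r"] hr m(1) d by auto
    show False
    proof (cases "t < m1")
      case True
      then show ?thesis using above[of t] t \<open>\<alpha> < h r\<close> by auto
    next
      case False
      then show ?thesis using r(2)[of t] t by auto
    qed
  qed
qed

lemma horseshoe_mono:
  assumes "horseshoe c d h" "{c..d} \<subseteq> {a..b}" shows "horseshoe a b h"
  using assms unfolding horseshoe_def by (meson subsetD)

text \<open>For \<open>f ^^ m\<close> on a component of \<open>orb I\<close>, these are the points of the basic set in that component.\<close>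

definition (in interval_map) spreading :: "real \<Rightarrow> bool" where
  "spreading x \<longleftrightarrow> x \<in> {a..b} \<and> (\<forall>e>0. {a..b} \<subseteq> closure (orb f (nhd x e)))"

section \<open>Spreading points of a surjective interval map\<close>

locale onto_interval_map = interval_map +
  assumes onto: "f ` {a..b} = {a..b}" and ab: "a < b"
begin

text \<open>A closed invariant set with a spreading point in its interior contains the closure of
  the orbit of a neighbourhood, which is all of \<open>[a, b]\<close>.\<close>

lemma spreading_not_invariant:
  assumes "spreading x" "T \<subseteq> {a..b}" "f ` T \<subseteq> T" "closed T" "T \<noteq> {a..b}" "{c<..<d} \<subseteq> T" "x \<in> {c<..<d}"
  shows False
proof -
  define e where "e = min (x - c) (d - x)"
  have e: "e > 0" using assms(7) by (simp add: e_def)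
  have "nhd x e \<subseteq> {c<..<d}" by (auto simp: e_def mem_nhd)
  then have eT: "nhd x e \<subseteq> T" using assms(6) by blast
  have "(f ^^ i) ` nhd x e \<subseteq> T" for i
  proof (induction i)
    case (Suc i)
    then show ?case using assms(3) by (simp add: image_comp[symmetric]) blast
  qed (use eT in simp)
  then have "orb f (nhd x e) \<subseteq> T" unfolding orb_def by blast
  then have "closure (orb f (nhd x e)) \<subseteq> T" using assms(4) by (rule closure_minimal)
  then show False using assms(1,2,5) e unfolding spreading_def by blast
qed

text \<open>A closed \<open>F\<close>-invariant subset \<open>T\<close> of \<open>[l, b]\<close>,
  together with its image under \<open>f\<close>, is closed and \<open>f\<close>-invariant, and the
  image adds nothing right of \<open>u\<close>. So spreading points forbid the traps
  \<open>[l, d]\<close> and \<open>[c, b]\<close> of \<open>F\<close>; this is the expansion that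
  yields a horseshoe on \<open>[u, b]\<close>.\<close>

lemma swap_spreading_right:
  assumes S: "a < l" "l \<le> u" "u < b" "f ` {a..u} \<subseteq> {l..b}" "f ` {l..b} \<subseteq> {a..u}"
    and x: "spreading x1" "spreading x2" "u < x1" "x1 < x2" "x2 < b"
  shows "horseshoe a b (f ^^ 2)"
proof -
  define F where "F = f ^^ 2"
  interpret F: interval_map a b F unfolding F_def by (rule interval_map_funpow)
  have F2: "F t = f (f t)" for t by (simp add: F_def numeral_2_eq_2)
  have FR: "F t \<in> {l..b}" if "t \<in> {l..b}" for t using S(4,5) that unfolding F2 by blast
  have FL: "F t \<in> {a..u}" if "t \<in> {a..u}" for t using S(4,5) that unfolding F2 by blast
  have dense: False
    if T: "T \<subseteq> {l..b}" "F ` T \<subseteq> T" "closed T" "w \<in> {u<..b}" "w \<notin> T"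
      and sp: "spreading y" "{c<..<d} \<subseteq> T" "y \<in> {c<..<d}" for T w y c d
  proof -
    show False
    proof (rule spreading_not_invariant[OF sp(1), of "T \<union> f ` T" c d])
      show "f ` (T \<union> f ` T) \<subseteq> T \<union> f ` T" using T(2) by (auto simp: F2)
      show "T \<union> f ` T \<subseteq> {a..b}" using T(1) S by force
      have "compact T" using T(1,3) by (metis bounded_closed_interval bounded_subset compact_eq_bounded_closed)
      moreover have "continuous_on T f" by (rule continuous_on_subset[OF cont]) (use T(1) S in auto)
      ultimately show "closed (T \<union> f ` T)" using T(3) by (intro closed_Un compact_imp_closed compact_continuous_image)
      show "T \<union> f ` T \<noteq> {a..b}"
      proof
        assume eq: "T \<union> f ` T = {a..b}"
        have "f ` T \<subseteq> {a..u}" using T(1) S(5) by blast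
        moreover have "w \<in> T \<union> f ` T" using T(4) eq S by auto
        ultimately show False using T(4,5) by auto
      qed
    qed (use sp in auto)
  qed
  have "horseshoe u b F"
  proof (rule horseshoe_from_expansion[of u b F x1 x2])
    show "continuous_on {u..b} F" by (rule continuous_on_subset[OF F.cont]) (use S in auto)
    show "F u \<le> u" using FL[of u] S by simp
    show "F t \<le> b" if "t \<in> {u..b}" for t using FR[of t] that S by simp
    show "\<exists>t\<in>{u..d}. d < F t" if d: "x1 < d" "d < b" for d
    proof (rule ccontr)
      assume no: "\<not> ?thesis"
      \<comment> \<open>The candidate trap starts at \<open>l\<close> rather than \<open>u\<close>:
        \<open>F\<close> may move points of \<open>[u, d]\<close> below \<open>u\<close>, but then
        it keeps them in \<open>[l, u]\<close>.\<close>
      have "F t \<in> {l..d}" if "t \<in> {l..d}" for t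
      proof (cases "t \<le> u")
        case True
        then have "F t \<in> {l..b} \<inter> {a..u}" using FR[of t] FL[of t] that d x S by auto
        then show ?thesis using d x by auto
      next
        case False
        then have "t \<in> {u..d}" using that by simp
        then have "F t \<le> d" using no by (meson not_le)
        then show ?thesis using FR[of t] that d by simp
      qed
      then show False
        by (intro dense[of "{l..d}" b x1 u d]) (use d x S in auto)
    qed
    show "\<exists>t\<in>{c..b}. F t < c" if c: "u < c" "c < x2" for c
    proof (rule ccontr)
      assume no: "\<not> ?thesis"
      have "F t \<in> {c..b}" if "t \<in> {c..b}" for t
      proof -
        have "c \<le> F t" using no that by (meson not_le)
        then show ?thesis using FR[of t] that c S by simp
      qed
      then show False
        by (intro dense[of "{c..b}" "(u + c) / 2" x2 c b]) (use c x S in auto)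
    qed
    show "\<exists>t\<in>{u..b}. F t = b"
    proof -
      obtain v where v: "v \<in> {a..b}" "f v = b" using onto ab by (metis atLeastAtMost_iff imageE less_imp_le order_refl)
      obtain w where w: "w \<in> {a..b}" "f w = v" using onto v(1) by (metis imageE)
      have "b \<notin> {a..u}" using S(3) by simp
      then have "v \<notin> {l..b}" using v(2) S(5) by blast
      then have "w \<notin> {a..u}" using w(2) S(4) by blast
      then have "w \<in> {u..b}" using w(1) by simp
      moreover have "F w = b" using w(2) v(2) by (simp add: F2)
      ultimately show ?thesis by blast
    qed
  qed (use x in auto)
  then show ?thesis unfolding F_def by (rule horseshoe_mono) (use S in auto)
qed

text \<open>Since \<open>f ^^ N\<close> is onto, it maps the dense orbit of the neighbourhood to a
  dense set, so the late images alone are dense.\<close>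

lemma spreading_dense:
  assumes "spreading y" "e > 0" "a \<le> s" "s < t" "t \<le> b"
  shows "\<exists>i\<ge>N. (f ^^ i) ` nhd y e \<inter> {s<..<t} \<noteq> {}"
proof -
  define D where "D = orb f (nhd y e)"
  have D: "closure D \<subseteq> {a..b}" unfolding D_def
    by (intro closure_minimal orb_subset) (auto simp: nhd_def)
  have img: "(f ^^ N) ` {a..b} = {a..b}"
    using onto by (induction N) (auto simp flip: image_image)
  have "{a..b} \<subseteq> (f ^^ N) ` closure D"
    using assms(1,2) img unfolding spreading_def D_def by (metis image_mono)
  also have "\<dots> \<subseteq> closure ((f ^^ N) ` D)"
    by (rule image_closure_subset[OF continuous_on_subset[OF cont_funpow D]]) (auto simp: closure_subset)
  finally have "(s + t) / 2 \<in> closure ((f ^^ N) ` D)" using assms by auto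
  then obtain y' where y': "y' \<in> (f ^^ N) ` D" "dist y' ((s + t) / 2) < (t - s) / 2"
    using assms(4) unfolding closure_approachable by (metis diff_gt_0_iff_gt half_gt_zero)
  then obtain i v where v: "v \<in> nhd y e" "y' = (f ^^ N) ((f ^^ i) v)" by (auto simp: D_def orb_def)
  then have "y' \<in> (f ^^ (N + i)) ` nhd y e" by (simp add: funpow_add)
  moreover have "y' \<in> {s<..<t}" using y'(2) by (auto simp: dist_real_def abs_if field_simps split: if_splits)
  ultimately show ?thesis by (intro exI[of _ "N + i"]) auto
qed

lemma spreading_nonwandering:
  assumes "spreading x" shows "x \<in> nonwandering {a..b} f"
  unfolding nonwandering_iff
proof (intro conjI allI impI)
  show x: "x \<in> {a..b}" using assms by (simp add: spreading_def)
  fix e :: real assume "e > 0"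
  then obtain i where "i \<ge> 1" "(f ^^ i) ` nhd x e \<inter> {max a (x - e)<..<min b (x + e)} \<noteq> {}"
    using spreading_dense[OF assms, of e "max a (x - e)" "min b (x + e)" 1] x ab by auto
  moreover have "{max a (x - e)<..<min b (x + e)} \<subseteq> nhd x e" by (auto simp: nhd_def)
  ultimately show "\<exists>i\<ge>1. (f ^^ i) ` nhd x e \<inter> nhd x e \<noteq> {}" by blast
qed

text \<open>All images of the neighbourhood contain the fixed point \<open>y\<close>, so its orbit
  is connected. Being dense, it contains the interior point \<open>t\<close>, and a fixed
  \<open>t\<close>, once reached, lies in all later images.\<close>

lemma fixed_spreading_reaches:
  assumes y: "spreading y" "f y = y" and t: "a < t" "t < b" "f t = t" and "e > 0"
  shows "\<exists>N. \<forall>i\<ge>N. t \<in> (f ^^ i) ` nhd y e"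
proof -
  have yU: "y \<in> nhd y e" using y(1) \<open>e > 0\<close> by (simp add: spreading_def mem_nhd)
  have fix_n: "(f ^^ i) s = s" if "f s = s" for i s using that by (induction i) auto
  have "connected (orb f (nhd y e))"
    unfolding orb_def
  proof (rule connected_Union)
    show "connected T" if "T \<in> range (\<lambda>i. (f ^^ i) ` nhd y e)" for T
    proof -
      obtain i where "T = (f ^^ i) ` nhd y e" using \<open>T \<in> range (\<lambda>i. (f ^^ i) ` nhd y e)\<close> by blast
      moreover have "nhd y e \<subseteq> {a..b}" by (auto simp: nhd_def)
      ultimately show ?thesis
        using connected_continuous_image[OF continuous_on_subset[OF cont_funpow] connected_nhd] by blast
    qed
    have "y \<in> \<Inter> (range (\<lambda>i. (f ^^ i) ` nhd y e))" using yU fix_n[OF y(2)] by (metis INT_I imageI)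
    then show "\<Inter> (range (\<lambda>i. (f ^^ i) ` nhd y e)) \<noteq> {}" by blast
  qed
  moreover obtain i s where "s \<in> (f ^^ i) ` nhd y e" "s < t"
    using spreading_dense[OF y(1) \<open>e > 0\<close>, of a t 0] t(1,2) by fastforce
  moreover obtain j r where "r \<in> (f ^^ j) ` nhd y e" "t < r"
    using spreading_dense[OF y(1) \<open>e > 0\<close>, of t b 0] t(1,2) by fastforce
  moreover have "(f ^^ i) ` nhd y e \<subseteq> orb f (nhd y e)" for i unfolding orb_def by blast
  ultimately have "{s..r} \<subseteq> orb f (nhd y e)" "t \<in> {s..r}"
    by (meson connected_contains_Icc subsetD, simp)
  then have "t \<in> orb f (nhd y e)" by blast
  then obtain N u where u: "u \<in> nhd y e" "(f ^^ N) u = t" by (auto simp: orb_def)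
  have "t \<in> (f ^^ i) ` nhd y e" if "i \<ge> N" for i
  proof -
    have "(f ^^ i) u = (f ^^ (i - N)) ((f ^^ N) u)" using that funpow_add[of "i - N" N f] by simp
    then have "(f ^^ i) u = t" using u(2) fix_n[OF t(3)] by simp
    then show ?thesis using u(1) by blast
  qed
  then show ?thesis by blast
qed

text \<open>Late images of small intervals around \<open>x 1\<close> and \<open>x 2\<close> reach
  the outer points \<open>x 0\<close> and \<open>x 3\<close>, hence cover both small intervals. A
  loop between the two takes \<open>N\<close> steps one way and \<open>N + 1\<close> back, an odd
  total, and their disjointness excludes a fixed point.\<close>

lemma fixed_spreading_odd_period:
  assumes x: "\<And>i. i < 4 \<Longrightarrow> spreading (x i) \<and> a < x i \<and> x i < b \<and> f (x i) = x i"
    and lt: "x 0 < x 1" "x 1 < x 2" "x 2 < x (3::nat)"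
  shows "\<exists>q. q \<in> cycle_periods {a..b} f \<and> odd q \<and> q \<noteq> 1"
proof -
  \<comment> \<open>A third of the smallest gap keeps the two intervals disjoint and inside
    \<open>[x 0, x 3]\<close>.\<close>
  define e where "e = Min {x 1 - x 0, x 2 - x 1, x 3 - x 2} / 3"
  have e: "e > 0" "3 * e \<le> x 1 - x 0" "3 * e \<le> x 2 - x 1" "3 * e \<le> x 3 - x 2" using lt by (auto simp: e_def)
  have "\<exists>N. \<forall>i\<ge>N. {x 0..x 3} \<subseteq> (f ^^ i) ` {x k - e..x k + e}" if k: "k < 4" for k
  proof -
    obtain N0 where N0: "\<And>i. i \<ge> N0 \<Longrightarrow> x 0 \<in> (f ^^ i) ` nhd (x k) e"
      using fixed_spreading_reaches[of "x k" "x 0" e] x[OF k] x[of 0] e(1) by auto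
    obtain N3 where N3: "\<And>i. i \<ge> N3 \<Longrightarrow> x 3 \<in> (f ^^ i) ` nhd (x k) e"
      using fixed_spreading_reaches[of "x k" "x 3" e] x[OF k] x[of 3] e(1) by auto
    have "{x 0..x 3} \<subseteq> (f ^^ i) ` {x k - e..x k + e}" if "i \<ge> max N0 N3" for i
    proof -
      have "connected ((f ^^ i) ` nhd (x k) e)"
        by (rule connected_continuous_image[OF continuous_on_subset[OF cont_funpow] connected_nhd]) (auto simp: nhd_def)
      then have "{x 0..x 3} \<subseteq> (f ^^ i) ` nhd (x k) e"
        by (rule connected_contains_Icc) (use N0 N3 that in auto)
      also have "\<dots> \<subseteq> (f ^^ i) ` {x k - e..x k + e}" by (intro image_mono) (auto simp: nhd_def)
      finally show ?thesis .
    qed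
    then show ?thesis by blast
  qed
  then obtain Nf where Nf: "\<And>k i. k < 4 \<Longrightarrow> i \<ge> Nf k \<Longrightarrow> {x 0..x 3} \<subseteq> (f ^^ i) ` {x k - e..x k + e}"
    by metis
  define N where "N = max (Nf 1) (Nf 2)"
  define A where "A l = (if l = 1 then {x 2 - e..x 2 + e} else {x 1 - e..x 1 + e})" for l :: nat
  have sub: "A l \<subseteq> {x 0..x 3}" for l using e lt by (auto simp: A_def)
  have sub': "{x 0..x 3} \<subseteq> {a..b}" using x[of 0] x[of 3] by auto
  have int: "\<exists>c d. c \<le> d \<and> A l = {c..d} \<and> {c..d} \<subseteq> {a..b}" for l
  proof -
    have "x k - e \<le> x k + e" for k using e(1) by simp
    then have "\<exists>c d. c \<le> d \<and> A l = {c..d}" unfolding A_def by metis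
    then show ?thesis using sub[of l] sub' by (metis order_trans)
  qed
  have cov: "covers f (N + l) (A l) (A (Suc l))" for l
  proof -
    have "N + l \<ge> Nf 1" "N + l \<ge> Nf 2" by (auto simp: N_def)
    then have "{x 0..x 3} \<subseteq> (f ^^ (N + l)) ` {x 1 - e..x 1 + e}" "{x 0..x 3} \<subseteq> (f ^^ (N + l)) ` {x 2 - e..x 2 + e}"
      using Nf by simp_all
    moreover have "A l = {x 1 - e..x 1 + e} \<or> A l = {x 2 - e..x 2 + e}" by (simp add: A_def)
    ultimately have "{x 0..x 3} \<subseteq> (f ^^ (N + l)) ` A l" by metis
    then show ?thesis unfolding covers_def by (rule order_trans[OF sub[of "Suc l"]])
  qed
  have "A 2 = A 0" by (simp add: A_def)
  with int cov obtain y where y: "y \<in> {a..b}" "(f ^^ (\<Sum>l<2. N + l)) y = y"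
      "\<And>l. l \<le> 2 \<Longrightarrow> (f ^^ (\<Sum>i<l. N + i)) y \<in> A l"
    by (rule loop_itinerary[of 2 A "\<lambda>l. N + l"]) (rule that)
  have "(\<Sum>l<2. N + l) = 2 * N + 1" by (simp add: numeral_2_eq_2)
  then have yp: "(f ^^ (2 * N + 1)) y = y" using y(2) by simp
  then obtain d where d: "min_period f y d" "d dvd 2 * N + 1" by (rule min_period_exists) simp
  have "odd (2 * N + 1)" by simp
  then have "odd d" using d(2) dvd_trans by blast
  moreover have "d \<noteq> 1"
  proof
    assume "d = 1"
    then have "(f ^^ N) y = y" using min_period_dvd_iff[OF d(1)] by simp
    then have "y \<in> A 0" "y \<in> A 1" using y(3)[of 0] y(3)[of 1] by simp_all
    then show False using e by (auto simp: A_def)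
  qed
  ultimately show ?thesis using d(1) y(1) unfolding cycle_periods_iff by blast
qed

text \<open>Two proper subintervals that cover \<open>[a, b]\<close> contain one endpoint each; the
  one with \<open>a\<close> is \<open>[a, u]\<close>, the other \<open>[l, b]\<close>.\<close>

lemma interval_swap:
  assumes K: "closed K0" "closed K1" "is_interval K0" "is_interval K1" "K0 \<union> K1 = {a..b}" "z \<in> K0" "z \<in> K1"
    and f: "f ` K0 \<subseteq> K1" "f ` K1 \<subseteq> K0" and ne: "K0 \<noteq> {a..b}" "K1 \<noteq> {a..b}"
  shows "\<exists>l u. a < l \<and> l \<le> u \<and> u < b \<and> f ` {a..u} \<subseteq> {l..b} \<and> f ` {l..b} \<subseteq> {a..u}"
proof -
  have *: "\<exists>l u. a < l \<and> l \<le> u \<and> u < b \<and> f ` {a..u} \<subseteq> {l..b} \<and> f ` {l..b} \<subseteq> {a..u}"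
    if K: "closed K0" "closed K1" "is_interval K0" "is_interval K1" "K0 \<union> K1 = {a..b}" "z \<in> K0" "z \<in> K1"
      and f: "f ` K0 \<subseteq> K1" "f ` K1 \<subseteq> K0" and ne: "K0 \<noteq> {a..b}" "K1 \<noteq> {a..b}" and aK: "a \<in> K0" for K0 K1
  proof -
    have sub: "K0 \<subseteq> {a..b}" "K1 \<subseteq> {a..b}" using K(5) by auto
    have full: "T = {a..b}" if "is_interval T" "a \<in> T" "b \<in> T" "T \<subseteq> {a..b}" for T
    proof
      show "{a..b} \<subseteq> T" using mem_is_interval_1_I[OF that(1-3)] by auto
    qed (rule that)
    have b0: "b \<notin> K0" using full[of K0] K(3) aK sub ne by blast
    moreover have "b \<in> K0 \<union> K1" unfolding K(5) using ab by simp
    ultimately have b1: "b \<in> K1" by blast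
    have a1: "a \<notin> K1" using full[of K1] K(4) b1 sub ne by blast
    have bd: "bdd_above K0" "bdd_below K1" 
      using bdd_above_mono[OF bdd_above_Icc sub(1)] bdd_below_mono[OF bdd_below_Icc sub(2)] .
    define u where "u = Sup K0"
    define l where "l = Inf K1"
    have u: "u \<in> K0" unfolding u_def by (rule closed_contains_Sup) (use K bd in auto)
    have l: "l \<in> K1" unfolding l_def by (rule closed_contains_Inf) (use K bd in auto)
    have K0: "K0 = {a..u}"
    proof
      show "K0 \<subseteq> {a..u}" using sub cSup_upper[OF _ bd(1)] by (auto simp: u_def)
      show "{a..u} \<subseteq> K0" using K(3) aK u unfolding is_interval_1 by (meson atLeastAtMost_iff subsetI)
    qed
    have K1: "K1 = {l..b}"
    proof
      show "K1 \<subseteq> {l..b}" using sub cInf_lower[OF _ bd(2)] by (auto simp: l_def)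
      show "{l..b} \<subseteq> K1" using K(4) b1 l unfolding is_interval_1 by (meson atLeastAtMost_iff subsetI)
    qed
    have "a < l" using a1 l sub by (cases "a = l") auto
    moreover have "u < b" using b0 u sub by (cases "u = b") auto
    moreover have "l \<le> u" using K(6,7) K0 K1 by auto
    ultimately show ?thesis using f unfolding K0 K1 by blast
  qed
  have "a \<in> K0 \<union> K1" unfolding K(5) using ab by simp
  then show ?thesis
  proof
    assume "a \<in> K0"
    then show ?thesis using *[OF K f ne] by blast
  next
    assume "a \<in> K1"
    moreover have "K1 \<union> K0 = {a..b}" using K(5) by (simp add: Un_commute)
    ultimately show ?thesis using *[OF K(2,1,4,3) _ K(7,6) f(2,1) ne(2,1)] by blast
  qed
qed

end

section \<open>Disjoint connected subsets of the line\<close>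

lemma connected_closure_right:
  fixes A :: "real set"
  assumes "connected A" "\<zeta> \<in> closure A" "s \<in> A" "\<zeta> < v" "v \<le> s"
  shows "v \<in> A"
proof -
  have "v - \<zeta> > 0" using assms by simp
  then obtain t where "t \<in> A" "dist t \<zeta> < v - \<zeta>" using assms(2) unfolding closure_approachable by blast
  then have "t \<le> v" by (simp add: dist_real_def)
  then show ?thesis using connected_contains_Icc[OF assms(1) \<open>t \<in> A\<close> assms(3)] assms(5) by auto
qed

lemma connected_closure_left:
  fixes A :: "real set"
  assumes "connected A" "\<zeta> \<in> closure A" "s \<in> A" "v < \<zeta>" "s \<le> v"
  shows "v \<in> A"
proof -
  have "\<zeta> - v > 0" using assms by simp
  then obtain t where "t \<in> A" "dist t \<zeta> < \<zeta> - v" using assms(2) unfolding closure_approachable by blast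
  then have "v \<le> t" by (simp add: dist_real_def)
  then show ?thesis using connected_contains_Icc[OF assms(1) assms(3) \<open>t \<in> A\<close>] assms(5) by auto
qed

text \<open>Of three points other than \<open>\<zeta>\<close>, one from each set, two lie on the
  same side of \<open>\<zeta>\<close>, and connected sets that accumulate at \<open>\<zeta>\<close>
  overlap on that side.\<close>

lemma three_disjoint_connected:
  fixes A :: "nat \<Rightarrow> real set"
  assumes A: "\<And>i. i < 3 \<Longrightarrow> connected (A i) \<and> infinite (A i) \<and> \<zeta> \<in> closure (A i)"
    and disj: "\<And>i j. i < 3 \<Longrightarrow> j < 3 \<Longrightarrow> i \<noteq> j \<Longrightarrow> A i \<inter> A j = {}"
  shows False
proof -
  have "\<exists>s\<in>A i. s \<noteq> \<zeta>" if "i < 3" for i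
  proof (rule ccontr)
    assume "\<not> ?thesis"
    then have "A i \<subseteq> {\<zeta>}" by blast
    then show False using A[OF that] finite_subset by blast
  qed
  then obtain s where s: "\<And>i. i < 3 \<Longrightarrow> s i \<in> A i \<and> s i \<noteq> \<zeta>" by metis
  have same: False if ij: "i < 3" "j < 3" "i \<noteq> j" and side: "\<zeta> < s i \<and> \<zeta> < s j \<or> s i < \<zeta> \<and> s j < \<zeta>" for i j
    using side
  proof
    assume "\<zeta> < s i \<and> \<zeta> < s j"
    then have "min (s i) (s j) \<in> A i" "min (s i) (s j) \<in> A j"
      using connected_closure_right[of "A i" \<zeta> "s i"] connected_closure_right[of "A j" \<zeta> "s j"]
        A[OF ij(1)] A[OF ij(2)] s[OF ij(1)] s[OF ij(2)] by auto
    then show False using disj[OF ij] by blast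
  next
    assume "s i < \<zeta> \<and> s j < \<zeta>"
    then have "max (s i) (s j) \<in> A i" "max (s i) (s j) \<in> A j"
      using connected_closure_left[of "A i" \<zeta> "s i"] connected_closure_left[of "A j" \<zeta> "s j"]
        A[OF ij(1)] A[OF ij(2)] s[OF ij(1)] s[OF ij(2)] by auto
    then show False using disj[OF ij] by blast
  qed
  have "s 0 \<noteq> \<zeta>" "s 1 \<noteq> \<zeta>" "s 2 \<noteq> \<zeta>" using s by auto
  then show False using same[of 0 1] same[of 0 2] same[of 1 2] by (auto simp: neq_iff)
qed

lemma two_elements_of_infinite:
  fixes S :: "real set"
  assumes "infinite S" obtains x y where "x \<in> S" "y \<in> S" "x < y"
proof -
  obtain x where "x \<in> S" using assms by (metis ex_in_conv finite.emptyI)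
  moreover have "infinite (S - {x})" using assms by simp
  then obtain y where "y \<in> S" "y \<noteq> x" by (metis DiffE ex_in_conv finite.emptyI insertI1)
  ultimately show thesis using that[of x y] that[of y x] by (cases "x < y") auto
qed

lemma dense_disjoint_connected:
  fixes A B :: "real set"
  assumes "B \<subseteq> closure A" "connected B" "infinite B" "A \<inter> B = {}"
  shows False
proof -
  obtain l r where "l \<in> B" "r \<in> B" "l < r" using two_elements_of_infinite[OF assms(3)] by blast
  then have sub: "{l..r} \<subseteq> B" using assms(2) connected_contains_Icc by blast
  moreover have "(l + r) / 2 \<in> {l..r}" using \<open>l < r\<close> by simp
  ultimately have "(l + r) / 2 \<in> closure A" using assms(1) by blast
  then obtain y where y: "y \<in> A" "dist y ((l + r) / 2) < (r - l) / 2"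
    using \<open>l < r\<close> unfolding closure_approachable by (metis diff_gt_0_iff_gt half_gt_zero)
  then have "y \<in> {l..r}" by (auto simp: dist_real_def abs_if field_simps split: if_splits)
  then show False using sub y(1) assms(4) by blast
qed

section \<open>Two swapped intervals from infinitely many spreading points\<close>

context onto_interval_map
begin

text \<open>At an odd time \<open>i\<close> the image of the neighbourhood cannot cover
  \<open>[x - e, x + e]\<close>: a fixed point of \<open>f ^^ i\<close> there would have odd period,
  hence be fixed by \<open>f\<close>. At late times the image is also connected and contains
  \<open>z\<close>, so it does not pass the far end of this interval. Hence \<open>K1\<close> misses
  an endpoint of \<open>[a, b]\<close>, while density makes \<open>K0\<close> and \<open>K1\<close>
  cover \<open>[a, b]\<close>.\<close>

lemma swap_from_connected_return:
  assumes x: "spreading x" and e: "e > 0" "{x - e..x + e} \<subseteq> {a<..<b}" and nofix: "\<And>t. t \<in> {x - e..x + e} \<Longrightarrow> f t \<noteq> t"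
    and z: "f z = z" "\<And>i. i \<ge> i0 \<Longrightarrow> z \<in> (f ^^ i) ` nhd x e"
    and nodd: "\<And>q. q \<in> cycle_periods {a..b} f \<Longrightarrow> odd q \<Longrightarrow> q = 1"
  shows "\<exists>l u. a < l \<and> l \<le> u \<and> u < b \<and> f ` {a..u} \<subseteq> {l..b} \<and> f ` {l..b} \<subseteq> {a..u}"
proof -
  have ends: "a < x - e" "x + e < b"
    using subsetD[OF e(2), of "x - e"] subsetD[OF e(2), of "x + e"] e(1) by auto
  have Uab: "nhd x e \<subseteq> {a..b}" "f ` nhd x e \<subseteq> {a..b}" using maps by (auto simp: mem_nhd)
  have con: "connected ((f ^^ i) ` nhd x e)" for i
    by (rule connected_continuous_image[OF continuous_on_subset[OF cont_funpow Uab(1)] connected_nhd])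
  have conf: "connected (f ` nhd x e)" using con[of 1] by simp
  have not_cover: "\<not> {x - e..x + e} \<subseteq> (f ^^ i) ` nhd x e" if "odd i" for i
  proof
    assume "{x - e..x + e} \<subseteq> (f ^^ i) ` nhd x e"
    also have "\<dots> \<subseteq> (f ^^ i) ` {x - e..x + e}" by (intro image_mono) (auto simp: nhd_def)
    finally have cov: "{x - e..x + e} \<subseteq> (f ^^ i) ` {x - e..x + e}" .
    have "x - e \<le> x + e" "{x - e..x + e} \<subseteq> {a..b}" using e(1) ends by auto
    then obtain y where y: "y \<in> {x - e..x + e}" "(f ^^ i) y = y" "y \<in> {a..b}"
      using fixed_point_covering[OF _ _ cov] by blast
    have "i \<ge> 1" using that by (cases i) auto
    then obtain d where d: "min_period f y d" "d dvd i" using min_period_exists[OF y(2)] by blast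
    have "odd d" using d(2) that by (meson dvd_trans)
    moreover have "d \<in> cycle_periods {a..b} f" using d(1) y(3) unfolding cycle_periods_iff by blast
    ultimately have "d = 1" using nodd by blast
    then show False using d(1) nofix[OF y(1)] by (simp add: min_period_def)
  qed
  have zx: "z \<notin> {x - e..x + e}" using nofix z(1) by blast
  define K0 where "K0 = omega 2 (nhd x e)"
  define K1 where "K1 = omega 2 (f ` nhd x e)"
  have K01: "f ` K0 = K1" using omega_image[OF Uab(1), of 1 2] by (simp add: K0_def K1_def)
  have "f ` K1 = (f ^^ 2) ` K0" unfolding K01[symmetric] by (simp add: numeral_2_eq_2 image_comp comp_def)
  then have K10: "f ` K1 = K0" using omega_shift[OF Uab(1), of 2] by (simp add: K0_def)
  have z0: "z \<in> (f ^^ (2 * i)) ` nhd x e" if "i \<ge> i0" for i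
    using z(2)[of "2 * i"] that by simp
  have z1: "z \<in> (f ^^ (2 * i)) ` f ` nhd x e" if "i \<ge> i0" for i
    using z(2)[of "Suc (2 * i)"] that by (simp add: image_comp funpow_Suc_right del: funpow.simps(2))
  note int = omega_interval[OF connected_nhd Uab(1) z0, folded K0_def] omega_interval[OF conf Uab(2) z1, folded K1_def]
  have "t \<in> K0 \<union> K1" if t: "t \<in> {a..b}" for t
  proof -
    have "\<exists>i\<ge>N. (f ^^ i) ` nhd x e \<inter> nhd t e' \<noteq> {}" if "e' > 0" for e' N
    proof -
      have "max a (t - e') < min b (t + e')" using that t ab by auto
      then obtain i where "i \<ge> N" "(f ^^ i) ` nhd x e \<inter> {max a (t - e')<..<min b (t + e')} \<noteq> {}"
        using spreading_dense[OF x e(1), of "max a (t - e')" "min b (t + e')" N] by auto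
      moreover have "{max a (t - e')<..<min b (t + e')} \<subseteq> nhd t e'" by (auto simp: nhd_def)
      ultimately show ?thesis by blast
    qed
    then obtain c where "c < 2" "t \<in> omega 2 ((f ^^ c) ` nhd x e)" using omega_cover[of 2 "nhd x e" t] by auto
    then show ?thesis by (cases c) (auto simp: K0_def K1_def less_2_cases_iff)
  qed
  moreover have sub: "K0 \<subseteq> {a..b}" "K1 \<subseteq> {a..b}" using omega_subset Uab by (auto simp: K0_def K1_def)
  ultimately have un: "K0 \<union> K1 = {a..b}" by blast
  have cl: "closed K0" "closed K1" using omega_closed by (auto simp: K0_def K1_def)
  have K1_sub: "K1 \<subseteq> C" if C: "closed C" "\<And>i. i \<ge> i0 \<Longrightarrow> odd i \<Longrightarrow> (f ^^ i) ` nhd x e \<subseteq> C" for C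
  proof -
    have "(f ^^ (2 * i)) ` f ` nhd x e \<subseteq> C" if "i \<ge> i0" for i
      using C(2)[of "Suc (2 * i)"] that by (simp add: image_comp funpow_Suc_right del: funpow.simps(2))
    then have "closure (\<Union>i\<in>{i0..}. (f ^^ (2 * i)) ` f ` nhd x e) \<subseteq> C"
      using C(1) by (intro closure_minimal UN_least) auto
    then show ?thesis unfolding K1_def omega_def by blast
  qed
  have ne1: "K1 \<noteq> {a..b}"
  proof (cases "z < x - e")
    case True
    have "(f ^^ i) ` nhd x e \<subseteq> {..x + e}" if i: "i \<ge> i0" "odd i" for i
    proof
      fix s assume s: "s \<in> (f ^^ i) ` nhd x e"
      show "s \<in> {..x + e}"
      proof (rule ccontr)
        assume "s \<notin> {..x + e}"
        then have "{x - e..x + e} \<subseteq> {z..s}" using True by auto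
        also have "\<dots> \<subseteq> (f ^^ i) ` nhd x e" by (rule connected_contains_Icc[OF con z(2)[OF i(1)] s])
        finally show False using not_cover[OF i(2)] by simp
      qed
    qed
    then have "K1 \<subseteq> {..x + e}" by (intro K1_sub) auto
    moreover have "b \<notin> {..x + e}" using ends by simp
    ultimately show ?thesis using ab by (metis atLeastAtMost_iff less_imp_le order_refl subsetD)
  next
    case False
    then have zx': "z > x + e" using zx by auto
    have "(f ^^ i) ` nhd x e \<subseteq> {x - e..}" if i: "i \<ge> i0" "odd i" for i
    proof
      fix s assume s: "s \<in> (f ^^ i) ` nhd x e"
      show "s \<in> {x - e..}"
      proof (rule ccontr)
        assume "s \<notin> {x - e..}"
        then have "{x - e..x + e} \<subseteq> {s..z}" using zx' by auto
        also have "\<dots> \<subseteq> (f ^^ i) ` nhd x e" by (rule connected_contains_Icc[OF con s z(2)[OF i(1)]])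
        finally show False using not_cover[OF i(2)] by simp
      qed
    qed
    then have "K1 \<subseteq> {x - e..}" by (intro K1_sub) auto
    moreover have "a \<notin> {x - e..}" using ends by simp
    ultimately show ?thesis using ab by (metis atLeastAtMost_iff less_imp_le order_refl subsetD)
  qed
  \<comment> \<open>\<open>f\<close> is onto, so \<open>K0 = [a, b]\<close> would give
    \<open>K1 = [a, b]\<close>.\<close>
  have ne0: "K0 \<noteq> {a..b}" using ne1 K01 onto by metis
  show ?thesis
    by (rule interval_swap[OF cl int(2,4) un int(1,3) _ _ ne0 ne1]) (simp_all add: K01 K10)
qed

text \<open>The sets \<open>V 0, ..., V (p - 1)\<close> are disjoint and their closures cover
  \<open>[a, b]\<close>. A fixed point of \<open>f\<close> lies in one closure, hence in all, and
  the line has room for only two such sets around a point; so \<open>p = 2\<close> and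
  \<open>f\<close> swaps the two closures.\<close>

lemma swap_from_disjoint_return:
  assumes x: "spreading x" and "e > 0" and p: "p \<ge> 2"
    and W: "connected W" "nhd x e \<subseteq> W" "W \<subseteq> {a..b}" "(f ^^ p) ` W \<subseteq> W" "\<And>i. (f ^^ i) ` W \<inter> W \<noteq> {} \<Longrightarrow> p dvd i"
  shows "\<exists>l u. a < l \<and> l \<le> u \<and> u < b \<and> f ` {a..u} \<subseteq> {l..b} \<and> f ` {l..b} \<subseteq> {a..u}"
proof -
  define V where "V i = (f ^^ i) ` W" for i
  have VW: "V (p * q) \<subseteq> W" for q
  proof (induction q)
    case (Suc q)
    have "V (p * Suc q) = (f ^^ p) ` V (p * q)" by (simp add: V_def funpow_add image_comp)
    then show ?case using Suc W(4) by blast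
  qed (simp add: V_def)
  have Vadd: "V (i + j) = (f ^^ i) ` V j" for i j by (simp add: V_def funpow_add image_comp)
  have Vmod: "V i \<subseteq> V (i mod p)" for i
  proof -
    have "V i = (f ^^ (i mod p)) ` V (p * (i div p))" by (simp flip: Vadd)
    then show ?thesis using VW[of "i div p"] unfolding V_def by blast
  qed
  have Vab: "V i \<subseteq> {a..b}" for i unfolding V_def using W(3) funpow_in by blast
  have Vcon: "connected (V i)" for i unfolding V_def
    by (rule connected_continuous_image[OF continuous_on_subset[OF cont_funpow W(3)] W(1)])
  have disj: "V i \<inter> V (i + j) = {}" if "0 < j" "j < p" for i j
  proof (rule ccontr)
    assume "\<not> ?thesis"
    then obtain y where y: "y \<in> V i" "y \<in> V (i + j)" by blast
    \<comment> \<open>\<open>r\<close> further steps bring the index \<open>i\<close> to a multiple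
      of \<open>p\<close>, hence the set back into \<open>W\<close>.\<close>
    define r where "r = (p - i mod p)"
    have "(f ^^ r) y \<in> V (r + i)" "(f ^^ r) y \<in> V (r + (i + j))" using y by (simp_all only: Vadd[of r] imageI)
    moreover have "r + i = p * Suc (i div p)"
    proof -
      have "i mod p < p" using p by simp
      moreover have "i = p * (i div p) + i mod p" by simp
      ultimately show ?thesis unfolding r_def mult_Suc_right by linarith
    qed
    moreover from this have "r + (i + j) = p * Suc (i div p) + j" by simp
    moreover have "V (p * Suc (i div p)) \<subseteq> W" by (rule VW)
    ultimately have "V (p * Suc (i div p) + j) \<inter> W \<noteq> {}" by auto
    then have "p dvd p * Suc (i div p) + j" using W(5) unfolding V_def by blast
    then have "p dvd j" by (metis dvd_add_right_iff dvd_triv_left)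
    then show False using that by (auto dest: dvd_imp_le)
  qed
  have dense: "{a..b} \<subseteq> closure (\<Union>i\<in>{N..}. V i)" for N
  proof
    fix t assume t: "t \<in> {a..b}"
    show "t \<in> closure (\<Union>i\<in>{N..}. V i)"
      unfolding closure_approachable
    proof (intro allI impI)
      fix e' :: real assume "e' > 0"
      then have "max a (t - e') < min b (t + e')" using t ab by auto
      then have "\<exists>i\<ge>N. (f ^^ i) ` nhd x e \<inter> {max a (t - e')<..<min b (t + e')} \<noteq> {}"
        by (intro spreading_dense[OF x \<open>e > 0\<close>]) auto
      then obtain i y where "i \<ge> N" "y \<in> (f ^^ i) ` nhd x e" "y \<in> {max a (t - e')<..<min b (t + e')}"
        by blast
      moreover then have "y \<in> V i" "dist y t < e'" using W(2) by (auto simp: V_def dist_real_def)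
      ultimately show "\<exists>y\<in>\<Union>i\<in>{N..}. V i. dist y t < e'" by blast
    qed
  qed
  \<comment> \<open>A finite \<open>V c\<close> would confine all images from time \<open>c\<close>
    on to a finite set, against density at late times.\<close>
  have inf: "infinite (V c)" for c
  proof
    assume "finite (V c)"
    then have fin: "finite (V (c + i))" for i using Vadd[of i c] by (simp add: add.commute)
    define T where "T = (\<Union>i<p. V (c + i))"
    have "finite T" using fin by (simp add: T_def)
    have "V i \<subseteq> T" if "i \<ge> c" for i
    proof -
      have "V i = (f ^^ c) ` V (i - c)" using that by (simp flip: Vadd)
      also have "\<dots> \<subseteq> (f ^^ c) ` V ((i - c) mod p)" by (intro image_mono Vmod)
      also have "\<dots> = V (c + (i - c) mod p)" by (simp add: Vadd)
      also have "\<dots> \<subseteq> T" using p by (auto simp: T_def intro!: UN_upper)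
      finally show ?thesis .
    qed
    then have "(\<Union>i\<in>{c..}. V i) \<subseteq> T" by auto
    then have "closure (\<Union>i\<in>{c..}. V i) \<subseteq> T" using finite_imp_closed[OF \<open>finite T\<close>] by (rule closure_minimal)
    then have "{a..b} \<subseteq> T" using dense[of c] by simp
    then show False using \<open>finite T\<close> ab finite_subset infinite_Icc by blast
  qed
  have cover: "{a..b} \<subseteq> (\<Union>i<p. closure (V i))"
  proof -
    have "(\<Union>i\<in>{0..}. V i) \<subseteq> (\<Union>i<p. V i)"
      using Vmod p by (intro UN_least) (metis UN_upper lessThan_iff mod_less_divisor not_numeral_le_zero order_trans zero_less_iff_neq_zero)
    also have "\<dots> \<subseteq> (\<Union>i<p. closure (V i))" by (intro UN_mono closure_subset) auto
    finally have "closure (\<Union>i\<in>{0..}. V i) \<subseteq> (\<Union>i<p. closure (V i))" by (intro closure_minimal closed_UN) auto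
    then show ?thesis using dense[of 0] by simp
  qed
  have fcl: "f ` closure (V i) \<subseteq> closure (V (Suc i))" for i
  proof (rule image_closure_subset)
    have "closure (V i) \<subseteq> {a..b}" using Vab by (intro closure_minimal) auto
    then show "continuous_on (closure (V i)) f" by (rule continuous_on_subset[OF cont])
    show "f ` V i \<subseteq> closure (V (Suc i))" using Vadd[of 1 i] closure_subset[of "V (Suc i)"] by simp
  qed simp
  obtain \<zeta> where \<zeta>: "\<zeta> \<in> {a..b}" "f \<zeta> = \<zeta>"
    using period_1 ab by (auto simp: cycle_periods_iff min_period_def)
  obtain j where j: "j < p" "\<zeta> \<in> closure (V j)" using cover \<zeta>(1) by blast
  have zcl: "\<zeta> \<in> closure (V (j + i))" for i
  proof (induction i)
    case (Suc i)
    then show ?case using fcl[of "j + i"] \<zeta>(2) by (metis add_Suc_right imageI subsetD)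
  qed (use j in simp)
  have "p = 2"
  proof (rule ccontr)
    assume "p \<noteq> 2"
    then have p3: "p \<ge> 3" using p by simp
    have d: "V (j + i) \<inter> V (j + k) = {}" if "i < k" "k < 3" for i k
      using disj[of "k - i" "j + i"] that p3 by simp
    show False
    proof (rule three_disjoint_connected[of "\<lambda>i. V (j + i)" \<zeta>])
      show "V (j + i) \<inter> V (j + k) = {}" if "i < 3" "k < 3" "i \<noteq> k" for i k
        using d[of i k] d[of k i] that by (cases "i < k") auto
    qed (use Vcon inf zcl in auto)
  qed
  have V2: "V 2 \<subseteq> V 0" using Vmod[of 2] \<open>p = 2\<close> by simp
  have d01: "V 0 \<inter> V 1 = {}" using disj[of 1 0] p by simp
  have f10: "f ` closure (V 1) \<subseteq> closure (V 0)"
    using fcl[of 1] closure_mono[OF V2] by (simp add: numeral_2_eq_2)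
  have un: "closure (V 0) \<union> closure (V 1) = {a..b}"
  proof
    show "closure (V 0) \<union> closure (V 1) \<subseteq> {a..b}" using Vab by (intro Un_least closure_minimal) auto
    show "{a..b} \<subseteq> closure (V 0) \<union> closure (V 1)" using cover \<open>p = 2\<close> by (simp add: numeral_2_eq_2 lessThan_Suc Un_commute)
  qed
  have \<zeta>01: "\<zeta> \<in> closure (V 0)" "\<zeta> \<in> closure (V 1)"
    using j zcl[of 1] fcl[of 0] f10 \<zeta>(2) \<open>p = 2\<close> by (auto simp: less_2_cases_iff)
  have "closure (V 0) \<noteq> {a..b}"
    using dense_disjoint_connected[of "V 1" "V 0"] Vcon inf d01 Vab[of 1] by metis
  moreover have "closure (V 1) \<noteq> {a..b}"
    using dense_disjoint_connected[of "V 0" "V 1"] Vcon inf d01 Vab[of 0] by (metis Int_commute)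
  ultimately show ?thesis
    using Vcon f10 fcl[of 0] un \<zeta>01
    by (intro interval_swap[of "closure (V 0)" "closure (V 1)" \<zeta>])
      (auto simp: is_interval_connected_1 connected_imp_connected_closure)
qed

text \<open>If all spreading points other than \<open>a\<close> and \<open>b\<close> were fixed,
  four of them would give an odd period above 1. So some spreading \<open>x\<close> is moved, and a
  neighbourhood of it free of fixed points falls under one of the return patterns
  \<open>p = 1\<close> and \<open>p \<ge> 2\<close>.\<close>

lemma spreading_swap:
  assumes Y: "infinite {x. spreading x}" and nodd: "\<And>q. q \<in> cycle_periods {a..b} f \<Longrightarrow> odd q \<Longrightarrow> q = 1"
  shows "\<exists>l u. a < l \<and> l \<le> u \<and> u < b \<and> f ` {a..u} \<subseteq> {l..b} \<and> f ` {l..b} \<subseteq> {a..u}"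
proof -
  define Y' where "Y' = {x. spreading x} - {a, b}"
  have inf: "infinite Y'" using Y by (simp add: Y'_def)
  have Y': "spreading x \<and> a < x \<and> x < b" if "x \<in> Y'" for x
    using that by (auto simp: Y'_def spreading_def)
  have "\<exists>x\<in>Y'. f x \<noteq> x"
  proof (rule ccontr)
    assume allfix: "\<not> ?thesis"
    obtain T where T: "T \<subseteq> Y'" "finite T" "card T = 4" using infinite_arbitrarily_large[OF inf] by metis
    define xs where "xs = sorted_list_of_set T"
    have xs: "sorted_wrt (<) xs" "length xs = 4" "set xs = T" using T by (auto simp: xs_def)
    have "\<exists>q. q \<in> cycle_periods {a..b} f \<and> odd q \<and> q \<noteq> 1"
    proof (rule fixed_spreading_odd_period[of "\<lambda>i. xs ! i"])
      show "spreading (xs ! i) \<and> a < xs ! i \<and> xs ! i < b \<and> f (xs ! i) = xs ! i" if "i < 4" for i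
      proof -
        have "xs ! i \<in> set xs" using that xs(2) by simp
        then have "xs ! i \<in> Y'" using xs(3) T(1) by blast
        then show ?thesis using Y' allfix by blast
      qed
    qed (use xs in \<open>auto simp: sorted_wrt_iff_nth_less\<close>)
    then show False using nodd by blast
  qed
  then obtain x where x: "x \<in> Y'" "f x \<noteq> x" by blast
  have xab: "a < x" "x < b" and sp: "spreading x" using Y'[OF x(1)] by auto
  define d where "d = \<bar>f x - x\<bar>"
  have "d > 0" using x(2) by (simp add: d_def)
  obtain c where c: "c > 0" "\<And>y. y \<in> nhd x c \<Longrightarrow> \<bar>(f ^^ 1) y - (f ^^ 1) x\<bar> < d / 2"
    using funpow_cont_at[of x "d / 2" 1] xab \<open>d > 0\<close> by auto
  \<comment> \<open>On \<open>[x - e, x + e]\<close> the value of \<open>f\<close> changes by less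
    than \<open>d / 2\<close> and the point by at most \<open>d / 4\<close>, together less than the
    displacement \<open>d\<close> of \<open>x\<close>, so no point there is fixed. The last two
    bounds keep the interval inside \<open>(a, b)\<close>.\<close>
  define e where "e = min (min (c / 2) (d / 4)) (min ((x - a) / 2) ((b - x) / 2))"
  have e: "e > 0" "e < c" "e \<le> d / 4" "e < x - a" "e < b - x"
    using c(1) \<open>d > 0\<close> xab by (auto simp: e_def min_def)
  have sub: "{x - e..x + e} \<subseteq> {a<..<b}" using e by auto
  have nofix: "f t \<noteq> t" if t: "t \<in> {x - e..x + e}" for t
  proof
    assume "f t = t"
    have "t \<in> nhd x c" using t sub e(2) by (auto simp: mem_nhd)
    then have "\<bar>t - f x\<bar> < d / 2" using c(2)[of t] \<open>f t = t\<close> by simp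
    moreover have "\<bar>t - x\<bar> \<le> d / 4" using t e(3) unfolding atLeastAtMost_iff by linarith
    moreover have "d \<le> \<bar>t - f x\<bar> + \<bar>t - x\<bar>" unfolding d_def by linarith
    ultimately show False using \<open>d > 0\<close> by linarith
  qed
  have Uab: "nhd x e \<subseteq> {a..b}" "x \<in> nhd x e" using e(1) xab by (auto simp: mem_nhd)
  have nw: "x \<in> nonwandering {a..b} f" by (rule spreading_nonwandering[OF sp])
  obtain i1 where i1: "i1 \<ge> 1" "(f ^^ i1) ` nhd x e \<inter> nhd x e \<noteq> {}"
    using nw e(1) unfolding nonwandering_iff by blast
  obtain p W where W: "p \<ge> 1" "connected W" "nhd x e \<subseteq> W" "W \<subseteq> orb f (nhd x e)" "(f ^^ p) ` W \<subseteq> W"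
      "\<And>i. (f ^^ i) ` W \<inter> W \<noteq> {} \<Longrightarrow> p dvd i"
    using return_component[OF connected_nhd Uab i1] by metis
  obtain z i0 where z: "z \<in> {a..b}" "min_period f z p" "\<And>i. i \<ge> i0 \<Longrightarrow> z \<in> (f ^^ (p * i)) ` nhd x e"
    using return_fixed[OF nw e(1) W] by blast
  show ?thesis
  proof (cases "p = 1")
    case True
    show ?thesis
      by (rule swap_from_connected_return[OF sp e(1) sub nofix, of z i0])
        (use z True nodd in \<open>auto simp: min_period_def\<close>)
  next
    case False
    then have "p \<ge> 2" using W(1) by simp
    moreover have "W \<subseteq> {a..b}" using W(4) orb_subset[OF Uab(1)] by blast
    ultimately show ?thesis by (intro swap_from_disjoint_return[OF sp e(1) _ W(2,3) _ W(5,6)])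
  qed
qed

lemma reflect_onto: "onto_interval_map (- b) (- a) (reflect f)"
proof (intro onto_interval_map.intro onto_interval_map_axioms.intro)
  show "interval_map (- b) (- a) (reflect f)" by (rule interval_map_reflect) unfold_locales
  show "reflect f ` {- b..- a} = {- b..- a}" using reflect_image[of f "{a..b}"] onto by simp
  show "- b < - a" using ab by simp
qed

lemma spreading_reflect:
  assumes "spreading x" shows "interval_map.spreading (- b) (- a) (reflect f) (- x)"
proof -
  interpret r: onto_interval_map "- b" "- a" "reflect f" by (rule reflect_onto)
  have nhd: "r.nhd (- x) e = uminus ` nhd x e" for e
    by (force simp: r.mem_nhd mem_nhd image_iff intro!: bexI[of _ "- _"])
  have orb: "orb (reflect f) (uminus ` S) = uminus ` orb f S" for S
    unfolding orb_def by (simp add: reflect_funpow reflect_image image_UN)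
  have cl: "closure (uminus ` S) = uminus ` closure S" for S :: "real set"
    by (rule closure_injective_linear_image[symmetric]) (auto intro!: linearI)
  have "{- b..- a} \<subseteq> closure (orb (reflect f) (r.nhd (- x) e))" if "e > 0" for e
  proof -
    have "uminus ` {a..b} \<subseteq> uminus ` closure (orb f (nhd x e))"
      using assms that unfolding spreading_def by (intro image_mono) blast
    then show ?thesis unfolding nhd orb cl by simp
  qed
  then show ?thesis using assms by (auto simp: r.spreading_def spreading_def)
qed

text \<open>The overlap \<open>[l, u]\<close> of the swapped intervals is invariant, so its interior
  has no spreading point. Infinitely many therefore lie on one side, where two of them give a
  horseshoe of \<open>f ^^ 2\<close>; its period 3 is period 3 or 6 of \<open>f\<close>.\<close>

lemma spreading_period:
  assumes Y: "infinite {x. spreading x}"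
  shows "\<exists>q. q \<in> cycle_periods {a..b} f \<and> (q = 6 \<or> odd q \<and> q \<ge> 3)"
proof (cases "\<exists>q. q \<in> cycle_periods {a..b} f \<and> odd q \<and> q \<noteq> 1")
  case True
  then obtain q where q: "q \<in> cycle_periods {a..b} f" "odd q" "q \<noteq> 1" by blast
  then have "q \<ge> 3" by (cases "q = 2"; cases "q = 0") auto
  then show ?thesis using q by blast
next
  case False
  then have nodd: "q = 1" if "q \<in> cycle_periods {a..b} f" "odd q" for q using that by blast
  obtain l u where S: "a < l" "l \<le> u" "u < b" "f ` {a..u} \<subseteq> {l..b}" "f ` {l..b} \<subseteq> {a..u}"
    using spreading_swap[OF Y nodd] by blast
  have mid: "x \<notin> {l<..<u}" if "spreading x" for x
  proof
    assume x: "x \<in> {l<..<u}"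
    have "f ` {l..u} \<subseteq> {l..u}" using S by (force simp: image_subset_iff)
    then show False
      by (rule spreading_not_invariant[OF that _ _ _ _ _ x, of "{l..u}", rotated]) (use S in auto)
  qed
  have "{x. spreading x} \<subseteq> {x. spreading x \<and> x < l} \<union> {x. spreading x \<and> u < x} \<union> {l, u}"
    using mid by force
  then have "infinite ({x. spreading x \<and> x < l} \<union> {x. spreading x \<and> u < x} \<union> {l, u})"
    using Y finite_subset by blast
  then consider "infinite ({x. spreading x \<and> x < l} - {a})" | "infinite ({x. spreading x \<and> u < x} - {b})" by auto
  then have "horseshoe a b (f ^^ 2)"
  proof cases
    case 1
    interpret r: onto_interval_map "- b" "- a" "reflect f" by (rule reflect_onto)
    obtain x1 x2 where x: "x1 \<in> {x. spreading x \<and> x < l} - {a}" "x2 \<in> {x. spreading x \<and> x < l} - {a}" "x1 < x2"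
      using two_elements_of_infinite[OF 1] by blast
    then have "a < x1" by (auto simp: spreading_def)
    have "horseshoe (- b) (- a) (reflect f ^^ 2)"
    proof (rule r.swap_spreading_right[of "- u" "- l" "- x2" "- x1"])
      show "reflect f ` {- b..- l} \<subseteq> {- u..- a}"
        using reflect_image[of f "{l..b}"] image_mono[OF S(5), of uminus] by simp
      show "reflect f ` {- u..- a} \<subseteq> {- b..- l}"
        using reflect_image[of f "{a..u}"] image_mono[OF S(4), of uminus] by simp
    qed (use x S \<open>a < x1\<close> spreading_reflect in auto)
    then show ?thesis by (simp add: reflect_funpow horseshoe_reflect)
  next
    case 2
    obtain x1 x2 where x: "x1 \<in> {x. spreading x \<and> u < x} - {b}" "x2 \<in> {x. spreading x \<and> u < x} - {b}" "x1 < x2"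
      using two_elements_of_infinite[OF 2] by blast
    then have "x2 < b" by (auto simp: spreading_def)
    then show ?thesis using swap_spreading_right[OF S, of x1 x2] x by blast
  qed
  then have "3 \<in> cycle_periods {a..b} (f ^^ (2 ^ 1))"
    using interval_map.horseshoe_period_3[OF interval_map_funpow] by simp
  then obtain i where i: "i \<le> 1" "2 ^ i * 3 \<in> cycle_periods {a..b} f" by (rule cycle_periods_pow2)
  then show ?thesis by (cases "i = 0") (auto simp: le_Suc_eq)
qed

end

section \<open>Cycles forced by a basic set\<close>

context interval_map
begin

text \<open>The intervals of the orbit are disjoint and permuted cyclically, so period
  \<open>q\<close> of \<open>f ^^ m\<close> on one of them is period \<open>m * q\<close> of
  \<open>f\<close>; \<open>q = 1\<close> comes from a fixed point in \<open>I\<close>. One component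
  holds infinitely many points of \<open>B\<close>, and these are spreading for
  \<open>f ^^ m\<close> there.\<close>

lemma basic_set_period:
  assumes "is_basic_set {a..b} f m I B"
  shows "m \<in> cycle_periods {a..b} f"
    "\<exists>q. m * q \<in> cycle_periods {a..b} f \<and> (q = 6 \<or> odd q \<and> q \<ge> 3)"
proof -
  have m: "m \<ge> 1" and I: "\<exists>c d. c \<le> d \<and> I = {c..d}" "I \<subseteq> {a..b}"
    and disj: "\<And>i j. i < m \<Longrightarrow> j < m \<Longrightarrow> i \<noteq> j \<Longrightarrow> (f ^^ i) ` I \<inter> (f ^^ j) ` I = {}"
    and per: "(f ^^ m) ` I = I" and B: "B = basic_points f (interval_orb f m I)" "infinite B"
    using assms by (auto simp: is_basic_set_def periodic_interval_def)
  define J where "J i = (f ^^ i) ` I" for i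
  have Jadd: "J (i + j) = (f ^^ i) ` J j" for i j by (simp add: J_def funpow_add image_comp)
  have Jm: "J (i + m) = J i" for i using per by (simp add: Jadd) (simp add: J_def)
  have Jmod: "J i = J (i mod m)" for i
  proof (induction i rule: less_induct)
    case (less i)
    show ?case
    proof (cases "i < m")
      case False
      then have "J i = J (i - m)" using Jm[of "i - m"] by simp
      also have "\<dots> = J ((i - m) mod m)" using less[of "i - m"] False m by simp
      also have "(i - m) mod m = i mod m" using False by (simp add: le_mod_geq)
      finally show ?thesis .
    qed simp
  qed
  have Jdvd: "m dvd k" if "J (k + i) \<inter> J i \<noteq> {}" for k i
  proof -
    have "(k + i) mod m < m" "i mod m < m" using m by simp_all
    then have "(k + i) mod m = i mod m"
      using disj[of "(k + i) mod m" "i mod m"] that Jmod[of "k + i"] Jmod[of i] unfolding J_def by metis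
    then have "m dvd k + i - i" using mod_eq_dvd_iff_nat[of i "k + i" m] by simp
    then show ?thesis by simp
  qed
  obtain c0 d0 where cd0: "c0 \<le> d0" "I = {c0..d0}" using I(1) by blast
  have J0: "J 0 = I" by (simp add: J_def)
  have lift: "m * q \<in> cycle_periods {a..b} f" if q: "q \<in> cycle_periods (J i) (f ^^ m)" and i: "i < m" for i q
  proof -
    obtain x where x: "x \<in> J i" "min_period (f ^^ m) x q" using q by (auto simp: cycle_periods_iff)
    have "min_period f x (m * q)"
    proof (rule min_periodI)
      fix n
      show "(f ^^ n) x = x \<longleftrightarrow> m * q dvd n"
      proof
        assume n: "(f ^^ n) x = x"
        have "(f ^^ n) x \<in> J (n + i)" using x(1) by (simp add: Jadd)
        then have "m dvd n" using Jdvd[of n i] x(1) n by auto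
        then obtain k where k: "n = m * k" by auto
        then have "((f ^^ m) ^^ k) x = x" using n by (simp add: funpow_mult mult.commute)
        then have "q dvd k" using min_period_dvd_iff[OF x(2)] by blast
        then show "m * q dvd n" using k by simp
      next
        assume "m * q dvd n"
        moreover have "(f ^^ (m * q)) x = x" using x(2) by (simp add: min_period_def funpow_mult mult.commute)
        ultimately show "(f ^^ n) x = x" using funpow_fix_mult by (metis dvdE)
      qed
    next
      show "m * q \<ge> 1" using m x(2) by (simp add: min_period_def)
    qed
    moreover have "x \<in> {a..b}" using x(1) I(2) funpow_in by (auto simp: J_def)
    ultimately show ?thesis unfolding cycle_periods_iff by blast
  qed
  have J_int: "\<exists>c d. c \<le> d \<and> J i = {c..d} \<and> {c..d} \<subseteq> {a..b}" for i
  proof -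
    have "continuous_on I (f ^^ i)" by (rule continuous_on_subset[OF cont_funpow I(2)])
    then have "\<exists>c d. J i = {c..d} \<and> c \<le> d" unfolding J_def cd0(2) by (rule continuous_image_closed_interval[OF cd0(1)])
    moreover have "J i \<subseteq> {a..b}" unfolding J_def using I(2) funpow_in by blast
    ultimately show ?thesis by metis
  qed
  have sub_map: "interval_map c d (f ^^ m)" if "J i = {c..d}" "{c..d} \<subseteq> {a..b}" for i c d
  proof
    show "continuous_on {c..d} (f ^^ m)" by (rule continuous_on_subset[OF cont_funpow that(2)])
    show "(f ^^ m) ` {c..d} \<subseteq> {c..d}" using Jm[of i] Jadd[of m i] that by (simp add: add.commute)
  qed
  show "m \<in> cycle_periods {a..b} f"
  proof -
    interpret g: interval_map c0 d0 "f ^^ m" using sub_map[of 0] J0 cd0 I(2) by simp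
    show ?thesis using lift[of 1 0] g.period_1[OF cd0(1)] J0 cd0(2) m by simp
  qed
  have "B \<subseteq> (\<Union>i<m. J i)" unfolding B(1) by (auto simp: basic_points_def interval_orb_def J_def)
  then have "B = (\<Union>i<m. B \<inter> J i)" by blast
  then obtain i where i: "i < m" "infinite (B \<inter> J i)" using B(2) by (metis finite_UN finite_lessThan lessThan_iff)
  obtain c d where cd: "c \<le> d" "J i = {c..d}" "{c..d} \<subseteq> {a..b}" using J_int by blast
  have "c < d"
  proof (rule ccontr)
    assume "\<not> c < d"
    then have "J i \<subseteq> {c}" using cd by auto
    then show False using i(2) by (meson finite.emptyI finite_Int finite_insert finite_subset)
  qed
  moreover have "(f ^^ m) ` {c..d} = {c..d}" using Jm[of i] Jadd[of m i] cd(2) by (simp add: add.commute)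
  ultimately interpret g: onto_interval_map c d "f ^^ m"
    using sub_map[OF cd(2,3)] by (intro onto_interval_map.intro onto_interval_map_axioms.intro)
  \<comment> \<open>The other components form a closed set disjoint from \<open>J i\<close>. So
    relative neighbourhoods in \<open>J i\<close> are relative neighbourhoods in \<open>M\<close>,
    and orbit points that approximate \<open>t\<close> while avoiding \<open>R\<close> lie in
    \<open>J i\<close>, which happens only at multiples of \<open>m\<close>.\<close>
  define R where "R = (\<Union>j\<in>{..<m} - {i}. J j)"
  have "closed (J j)" for j using J_int[of j] by auto
  then have R: "closed R" unfolding R_def by (intro closed_UN) auto
  have RJ: "R \<inter> J i = {}" unfolding R_def J_def using disj i(1) by blast
  define M where "M = interval_orb f m I"
  have M: "M = J i \<union> R" unfolding M_def interval_orb_def R_def J_def using i(1) by blast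
  have "g.spreading x" if x: "x \<in> B \<inter> J i" for x
    unfolding g.spreading_def
  proof (intro conjI allI impI)
    show "x \<in> {c..d}" using x cd by simp
    fix e :: real assume "e > 0"
    define V where "V = g.nhd x e"
    have xV: "x \<in> V" using x cd \<open>e > 0\<close> by (simp add: V_def g.mem_nhd)
    have VJ: "V \<subseteq> J i" using cd by (auto simp: V_def g.nhd_def)
    have "V = M \<inter> ({x - e<..<x + e} - R)" using RJ cd unfolding V_def g.nhd_def M by blast
    moreover have "open ({x - e<..<x + e} - R)" using R by (intro open_Diff) auto
    ultimately have "openin (top_of_set M) V" by (auto simp: openin_open)
    moreover have "V \<subseteq> M" using VJ M by blast
    ultimately have clM: "closure (orb f V) = M"
      using x xV unfolding B(1) basic_points_def M_def[symmetric] by blast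
    show "{c..d} \<subseteq> closure (orb (f ^^ m) V)"
    proof
      fix t assume "t \<in> {c..d}"
      then have t: "t \<in> J i" using cd by simp
      show "t \<in> closure (orb (f ^^ m) V)"
        unfolding closure_approachable
      proof (intro allI impI)
        fix \<eta> :: real assume "\<eta> > 0"
        have "open (ball t \<eta> - R)" using R by (intro open_Diff) auto
        moreover have "t \<in> ball t \<eta> - R" using t RJ \<open>\<eta> > 0\<close> by auto
        moreover have "t \<in> closure (orb f V)" using t M clM by blast
        ultimately obtain y where y: "y \<in> orb f V" "y \<in> ball t \<eta> - R"
          unfolding closure_iff_nhds_not_empty by blast
        obtain k v where kv: "v \<in> V" "y = (f ^^ k) v" using y(1) by (auto simp: orb_def)
        then have "y \<in> J (k + i)" using VJ by (auto simp: Jadd)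
        moreover have "y \<in> M" using y(1) clM closure_subset by blast
        then have "y \<in> J i" using y(2) M by blast
        ultimately have "m dvd k" using Jdvd by blast
        then obtain k' where "k = m * k'" by auto
        then have "y = ((f ^^ m) ^^ k') v" using kv by (simp add: funpow_mult mult.commute)
        then have "y \<in> orb (f ^^ m) V" using kv(1) by (auto simp: orb_def)
        then show "\<exists>y\<in>orb (f ^^ m) V. dist y t < \<eta>" using y(2) by (auto simp: dist_commute)
      qed
    qed
  qed
  then have "infinite {x. g.spreading x}" using i(2) by (metis infinite_super mem_Collect_eq subsetI)
  then obtain q where "q \<in> cycle_periods {c..d} (f ^^ m)" "q = 6 \<or> odd q \<and> q \<ge> 3"
    using g.spreading_period by blast
  then show "\<exists>q. m * q \<in> cycle_periods {a..b} f \<and> (q = 6 \<or> odd q \<and> q \<ge> 3)"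
    using lift[of q i] i(1) cd(2) by metis
qed

end

section \<open>Arithmetic of the Sharkovskii ordering\<close>

lemma odd_part:
  assumes "(m::nat) \<ge> 1" obtains i r where "m = 2 ^ i * r" "odd r"
proof -
  have "\<exists>i r. m = 2 ^ i * r \<and> odd r"
    using assms
  proof (induction m rule: less_induct)
    case (less m)
    show ?case
    proof (cases "even m")
      case True
      then obtain k where k: "m = 2 * k" by auto
      then obtain i r where "k = 2 ^ i * r" "odd r" using less.IH[of k] less.prems by auto
      then show ?thesis using k by (intro exI[of _ "Suc i"] exI[of _ r]) simp
    qed (intro exI[of _ 0] exI[of _ m], simp)
  qed
  then show thesis using that by blast
qed

lemma pow2_odd_unique:
  assumes "(2::nat) ^ i * r = 2 ^ j * s" "odd r" "odd s"
  shows "i = j" "r = s"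
proof -
  have le: "i \<le> j" if "(2::nat) ^ i * r = 2 ^ j * s" "odd r" "odd s" for i j r s
  proof (rule ccontr)
    assume "\<not> i \<le> j"
    then obtain k where "i = j + Suc k" by (metis add_Suc_right less_imp_Suc_add not_le)
    then have "2 ^ j * (2 * (2 ^ k * r)) = 2 ^ j * s" using that(1) by (simp add: power_add mult.assoc)
    then have "s = 2 * (2 ^ k * r)" by simp
    then show False using that(3) by simp
  qed
  show "i = j" using le[OF assms] le[OF assms(1)[symmetric] assms(3,2)] by simp
  then show "r = s" using assms(1) by simp
qed

lemma sharkovskii_total:
  assumes "m \<ge> 1" "n \<ge> 1"
  shows "m \<prec>\<^sub>S n \<or> m = n \<or> n \<prec>\<^sub>S m"
proof -
  obtain \<alpha> p where m: "m = 2 ^ \<alpha> * p" "odd p" using odd_part[OF assms(1)] by blast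
  obtain \<beta> q where n: "n = 2 ^ \<beta> * q" "odd q" using odd_part[OF assms(2)] by blast
  have pq: "p = 1 \<or> p > 1" "q = 1 \<or> q > 1" using m(2) n(2) by (auto elim: oddE)
  have mn: "m \<prec>\<^sub>S n" if "p > 1 \<and> q > 1 \<and> (\<alpha> < \<beta> \<or> \<alpha> = \<beta> \<and> p < q) \<or> p > 1 \<and> q = 1 \<or> p = 1 \<and> q = 1 \<and> \<beta> < \<alpha>"
    unfolding sharkovskii_less_def using m n that by blast
  have nm: "n \<prec>\<^sub>S m" if "q > 1 \<and> p > 1 \<and> (\<beta> < \<alpha> \<or> \<beta> = \<alpha> \<and> q < p) \<or> q > 1 \<and> p = 1 \<or> q = 1 \<and> p = 1 \<and> \<alpha> < \<beta>"
    unfolding sharkovskii_less_def using m n that by blast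
  have "m = n" if "\<alpha> = \<beta>" "p = q" using m n that by simp
  then show ?thesis using mn nm pq by (metis linorder_neqE_nat)
qed

lemma pow2_sharkovskii:
  assumes "2 ^ l \<prec>\<^sub>S j" shows "\<exists>c<l. j = 2 ^ c"
proof -
  obtain \<alpha> p \<beta> q where *: "2 ^ l = 2 ^ \<alpha> * p" "odd p" "j = 2 ^ \<beta> * q" "odd q"
    "(p > 1 \<and> q > 1 \<and> (\<alpha> < \<beta> \<or> \<alpha> = \<beta> \<and> p < q)) \<or> (p > 1 \<and> q = 1) \<or> (p = 1 \<and> q = 1 \<and> \<beta> < \<alpha>)"
    using assms unfolding sharkovskii_less_def by blast
  have "l = \<alpha>" "1 = p" using pow2_odd_unique[of l 1 \<alpha> p] * by simp_all
  then show ?thesis using * by auto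
qed

section \<open>Consequences of a missing period\<close>

context interval_map
begin

text \<open>For \<open>i = n\<close> and \<open>k = 1\<close> the given period is the claimed one.
  In all other cases it strictly precedes the claimed one, also for \<open>k = 0\<close>, where the
  latter is a power of 2.\<close>

lemma period_forces_pow2_odd:
  assumes "2 ^ i * r \<in> cycle_periods {a..b} f" "odd r" "r \<ge> 3" "i < n \<or> i = n \<and> r = 3"
  shows "2 ^ n * (2 * k + 1) \<in> cycle_periods {a..b} f"
proof (cases "i = n \<and> k = 1")
  case True
  then show ?thesis using assms by (simp add: eval_nat_numeral)
next
  case False
  define t where "t = 2 * k + 1"
  have "r > 1 \<and> t > 1 \<and> (i < n \<or> i = n \<and> r < t) \<or> r > 1 \<and> t = 1"
    using assms(3,4) False unfolding t_def by (cases "k = 0") auto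
  moreover have "odd t" by (simp add: t_def)
  ultimately have "2 ^ i * r \<prec>\<^sub>S 2 ^ n * t"
    unfolding sharkovskii_less_def using assms(2) by blast
  then have "2 ^ i * r \<prec>\<^sub>S 2 ^ n * (2 * k + 1)" by (simp only: t_def)
  then show ?thesis using sharkovskii assms(1) by blast
qed

text \<open>One factor 2 is added at a time. An odd period \<open>q \<ge> 3\<close> of
  \<open>f ^^ (2 ^ j)\<close> comes from \<open>2 ^ i * q\<close> with \<open>i \<le> j < n\<close>,
  and period 3 of its square from \<open>2 ^ i * 3\<close> with \<open>i \<le> n\<close>; both force
  the missing period.\<close>

lemma nonwandering_pow2:
  assumes "2 ^ n * (2 * k + 1) \<notin> cycle_periods {a..b} f" "j \<le> n"
  shows "nonwandering {a..b} f = nonwandering {a..b} (f ^^ (2 ^ j))"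
  using assms(2)
proof (induction j)
  case 0
  then show ?case by simp
next
  case (Suc j)
  interpret g: interval_map a b "f ^^ (2 ^ j)" by (rule interval_map_funpow)
  have sq: "(f ^^ (2 ^ j)) ^^ 2 = f ^^ (2 ^ Suc j)" by (simp add: funpow_mult mult.commute)
  have "nonwandering {a..b} (f ^^ (2 ^ j)) = nonwandering {a..b} ((f ^^ (2 ^ j)) ^^ 2)"
  proof (rule g.nonwandering_square)
    fix q assume q: "q \<in> cycle_periods {a..b} (f ^^ (2 ^ j))" "odd q"
    show "q = 1"
    proof (rule ccontr)
      assume "q \<noteq> 1"
      then have "q \<ge> 3" using q(2) by (cases "q = 2"; cases "q = 0") auto
      moreover obtain i where "i \<le> j" "2 ^ i * q \<in> cycle_periods {a..b} f"
        using q(1) by (rule cycle_periods_pow2)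
      ultimately show False using period_forces_pow2_odd[of i q n k] q(2) Suc.prems assms(1) by simp
    qed
  next
    show "3 \<notin> cycle_periods {a..b} ((f ^^ (2 ^ j)) ^^ 2)"
    proof
      assume "3 \<in> cycle_periods {a..b} ((f ^^ (2 ^ j)) ^^ 2)"
      then obtain i where "i \<le> Suc j" "2 ^ i * 3 \<in> cycle_periods {a..b} f"
        unfolding sq by (rule cycle_periods_pow2)
      moreover from this have "i < n \<or> i = n" using Suc.prems by linarith
      ultimately show False using period_forces_pow2_odd[of i 3 n k] assms(1) by simp
    qed
  qed
  then show ?case using Suc sq by simp
qed

end

theorem theorem9p4:
  fixes f :: "real \<Rightarrow> real" and n k :: nat
  assumes "continuous_on {0..1} f"
    and "f ` {0..1} \<subseteq> {0..1}"
    and "2 ^ n * (2 * k + 1) \<notin> cycle_periods {0..1} f"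
  shows "(\<forall>B I m. is_basic_set {0..1} f m I B \<longrightarrow>
            2 ^ n * (2 * k + 1) \<prec>\<^sub>S m \<and> (n \<ge> 1 \<longrightarrow> m \<prec>\<^sub>S 2 ^ (n - 1)))
       \<and> nonwandering {0..1} f = nonwandering {0..1} (f ^^ (2 ^ n))
       \<and> ((\<exists>l. of_type {0..1} f (2 ^ l)) \<or> of_type_2_infinity {0..1} f \<longrightarrow>
            (\<forall>r\<ge>1. nonwandering {0..1} f = nonwandering {0..1} (f ^^ r)))"
proof (intro conjI allI impI)
  interpret interval_map 0 1 f using assms(1,2) by unfold_locales
  show "nonwandering {0..1} f = nonwandering {0..1} (f ^^ (2 ^ n))"
    by (rule nonwandering_pow2[OF assms(3)]) simp
  {
    fix B I m assume basic: "is_basic_set {0..1} f m I B"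
    have m: "m \<in> cycle_periods {0..1} f" by (rule basic_set_period(1)[OF basic])
    then have m1: "m \<ge> 1" by (simp add: cycle_periods_def)
    \<comment> \<open>As \<open>m\<close> is a period, it neither equals the missing period nor
      precedes it; totality of the ordering leaves one possibility.\<close>
    have "\<not> m \<prec>\<^sub>S 2 ^ n * (2 * k + 1)" "m \<noteq> 2 ^ n * (2 * k + 1)"
      using sharkovskii[OF m] m assms(3) by auto
    moreover have "2 ^ n * (2 * k + 1) \<ge> (1::nat)"
      by (metis One_nat_def Suc_eq_plus1 Suc_leI nat_0_less_mult_iff zero_less_Suc zero_less_numeral zero_less_power)
    ultimately show "2 ^ n * (2 * k + 1) \<prec>\<^sub>S m" using sharkovskii_total[OF m1] by blast
    assume "n \<ge> 1"
    show "m \<prec>\<^sub>S 2 ^ (n - 1)"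
    proof (rule ccontr)
      assume "\<not> m \<prec>\<^sub>S 2 ^ (n - 1)"
      then have "m = 2 ^ (n - 1) \<or> 2 ^ (n - 1) \<prec>\<^sub>S m" using sharkovskii_total[OF m1, of "2 ^ (n - 1)"] by auto
      \<comment> \<open>Now \<open>m = 2 ^ j\<close> with \<open>j < n\<close>, so the period
        \<open>m * q\<close> is \<open>2 ^ Suc j * 3\<close> or \<open>2 ^ j * q\<close> with odd
        \<open>q \<ge> 3\<close>. As \<open>Suc j \<le> n\<close>, both force the missing
        period.\<close>
      then obtain j where j: "m = 2 ^ j" "j < n"
        using pow2_sharkovskii[of "n - 1" m] \<open>n \<ge> 1\<close> by (metis Suc_pred' diff_less less_Suc_eq less_le_trans zero_less_one less_SucI)
      obtain q where q: "m * q \<in> cycle_periods {0..1} f" "q = 6 \<or> odd q \<and> q \<ge> 3"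
        using basic_set_period(2)[OF basic] by blast
      from q(2) show False
      proof
        assume "q = 6"
        then have "2 ^ Suc j * 3 \<in> cycle_periods {0..1} f" using q(1) j(1) by (simp add: mult.commute)
        moreover have "Suc j < n \<or> Suc j = n" using j(2) by linarith
        ultimately show False using period_forces_pow2_odd[of "Suc j" 3 n k] assms(3) by simp
      next
        assume "odd q \<and> q \<ge> 3"
        then show False using period_forces_pow2_odd[of j q n k] q(1) j assms(3) by auto
      qed
    qed
  }
  fix r :: nat
  assume type: "(\<exists>l. of_type {0..1} f (2 ^ l)) \<or> of_type_2_infinity {0..1} f" and "r \<ge> 1"
  have pow2: "\<exists>c. j = 2 ^ c" if "j \<in> cycle_periods {0..1} f" for j
    using type
  proof
    assume "\<exists>l. of_type {0..1} f (2 ^ l)"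
    then show ?thesis using that pow2_sharkovskii unfolding of_type_def by metis
  next
    assume "of_type_2_infinity {0..1} f"
    then show ?thesis using that unfolding of_type_2_infinity_def by auto
  qed
  obtain i t where r: "r = 2 ^ i * t" "odd t" using odd_part[OF \<open>r \<ge> 1\<close>] by blast
  \<comment> \<open>The hypothesis of claim 2 with \<open>i\<close> and 1 in place of
    \<open>n\<close> and \<open>k\<close>, where \<open>i\<close> is the exponent of 2 in
    \<open>r\<close>; it holds since \<open>2 ^ i * 3\<close> is not a power of 2.\<close>
  have "2 ^ i * (2 * 1 + 1) \<notin> cycle_periods {0..1} f"
  proof
    assume "2 ^ i * (2 * 1 + 1) \<in> cycle_periods {0..1} f"
    then obtain c where "2 ^ i * 3 = (2::nat) ^ c * 1" using pow2 by force
    then have "(3::nat) = 1" by (rule pow2_odd_unique) simp_all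
    then show False by simp
  qed
  then have "nonwandering {0..1} f = nonwandering {0..1} (f ^^ (2 ^ i))" by (rule nonwandering_pow2) simp
  also have "\<dots> = nonwandering {0..1} ((f ^^ (2 ^ i)) ^^ t)"
    by (rule interval_map.nonwandering_odd_power[OF interval_map_funpow r(2)])
  also have "(f ^^ (2 ^ i)) ^^ t = f ^^ r" using r(1) by (simp add: funpow_mult mult.commute)
  finally show "nonwandering {0..1} f = nonwandering {0..1} (f ^^ r)" .
qed

end
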